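(* Every cactus has a planar Lombardi drawing for its natural embedding.
   Context: A cactus is a graph in which each edge belongs to at most one cycle. The natural embedding of a cactus is the planar embedding in which every cycle bounds a face, with all other edges incident to the cycle's vertices placed outside the cycle. A Lombardi drawing maps each vertex to a point and each edge to a circular arc or line segment joining the points of its endpoints, such that at each vertex $v$ the incident arcs are equally spaced around $v$, consecutive arcs forming angles $2\pi/\deg(v)$. It is planar if the only intersection points of its arcs are shared endpoints; a Lombardi drawing for a given embedding is one whose rotation of arcs around each vertex and whose faces agree with that embedding. *)

theory Defs
  imports "HOL-Analysis.Analysis"
begin

definition simple_graph :: "'v set \<Rightarrow> 'v set set \<Rightarrow> bool" where
  "simple_graph V E \<longleftrightarrow> finite V \<and>
     (\<forall>e\<in>E. \<exists>u v. u \<noteq> v \<and> u \<in> V \<and> v \<in> V \<and> e = {u, v})"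

definition nbrs :: "'v set set \<Rightarrow> 'v \<Rightarrow> 'v set" where
  "nbrs E v = {u. {v, u} \<in> E}"

definition deg :: "'v set set \<Rightarrow> 'v \<Rightarrow> nat" where
  "deg E v = card (nbrs E v)"

definition is_cycle :: "'v set \<Rightarrow> 'v set set \<Rightarrow> 'v list \<Rightarrow> bool" where
  "is_cycle V E cs \<longleftrightarrow> length cs \<ge> 3 \<and> distinct cs \<and> set cs \<subseteq> V \<and>
     (\<forall>i < length cs. {cs ! i, cs ! ((i + 1) mod length cs)} \<in> E)"

definition cycle_edges :: "'v list \<Rightarrow> 'v set set" where
  "cycle_edges cs = {{cs ! i, cs ! ((i + 1) mod length cs)} | i. i < length cs}"

definition cactus :: "'v set \<Rightarrow> 'v set set \<Rightarrow> bool" where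
  "cactus V E \<longleftrightarrow> simple_graph V E \<and>
     (\<forall>e\<in>E. \<forall>c1 c2. is_cycle V E c1 \<and> is_cycle V E c2 \<and>
        e \<in> cycle_edges c1 \<and> e \<in> cycle_edges c2 \<longrightarrow> cycle_edges c1 = cycle_edges c2)"

definition circ_arc :: "(real \<Rightarrow> complex) \<Rightarrow> bool" where
  "circ_arc g \<longleftrightarrow>
     (\<exists>a b. a \<noteq> b \<and> g = linepath a b) \<or>
     (\<exists>c r t0 t1. r > 0 \<and> t0 \<noteq> t1 \<and> \<bar>t1 - t0\<bar> < 2 * pi \<and>
        g = (\<lambda>t. c + complex_of_real r * cis (t0 + t * (t1 - t0))))"

definition lombardi_drawing ::
  "'v set \<Rightarrow> 'v set set \<Rightarrow> ('v \<Rightarrow> complex) \<Rightarrow> ('v \<Rightarrow> 'v \<Rightarrow> real \<Rightarrow> complex) \<Rightarrow> bool" where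
  "lombardi_drawing V E p dr \<longleftrightarrow>
     (\<forall>u v. {u, v} \<in> E \<longrightarrow> circ_arc (dr u v) \<and> pathstart (dr u v) = p u \<and>
        pathfinish (dr u v) = p v \<and> dr v u = reversepath (dr u v)) \<and>
     (\<forall>v\<in>V. deg E v > 0 \<longrightarrow>
        (\<exists>w. norm w = 1 \<and>
           (\<lambda>u. sgn (vector_derivative (dr v u) (at 0))) ` nbrs E v =
             {w * cis (2 * pi * real k / real (deg E v)) | k. k < deg E v}))"

definition planar_drawing ::
  "'v set \<Rightarrow> 'v set set \<Rightarrow> ('v \<Rightarrow> complex) \<Rightarrow> ('v \<Rightarrow> 'v \<Rightarrow> real \<Rightarrow> complex) \<Rightarrow> bool" where
  "planar_drawing V E p dr \<longleftrightarrow> inj_on p V \<and>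
     (\<forall>u v w. {u, v} \<in> E \<and> w \<in> V \<and> w \<notin> {u, v} \<longrightarrow> p w \<notin> path_image (dr u v)) \<and>
     (\<forall>u v x y. {u, v} \<in> E \<and> {x, y} \<in> E \<and> {u, v} \<noteq> {x, y} \<longrightarrow>
        path_image (dr u v) \<inter> path_image (dr x y) \<subseteq> p ` ({u, v} \<inter> {x, y}))"

definition drawing_points ::
  "'v set \<Rightarrow> 'v set set \<Rightarrow> ('v \<Rightarrow> complex) \<Rightarrow> ('v \<Rightarrow> 'v \<Rightarrow> real \<Rightarrow> complex) \<Rightarrow> complex set" where
  "drawing_points V E p dr = p ` V \<union> \<Union>{path_image (dr u v) | u v. {u, v} \<in> E}"

text \<open>Natural embedding: every cycle bounds a face with everything else outside it, i.e.
  the bounded region enclosed by the (Jordan) curve of each cycle contains no point of the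
  drawing.\<close>
definition natural_embedding ::
  "'v set \<Rightarrow> 'v set set \<Rightarrow> ('v \<Rightarrow> complex) \<Rightarrow> ('v \<Rightarrow> 'v \<Rightarrow> real \<Rightarrow> complex) \<Rightarrow> bool" where
  "natural_embedding V E p dr \<longleftrightarrow>
     (\<forall>cs. is_cycle V E cs \<longrightarrow>
        inside (\<Union>i<length cs. path_image (dr (cs ! i) (cs ! ((i + 1) mod length cs))))
          \<inter> drawing_points V E p dr = {})"

end

theory Submission
  imports Defs
begin

text \<open>
  The drawing grows block by block. Every vertex \<open>v\<close> has \<open>deg v\<close> equally spaced slots from the start,
  and the edges drawn so far occupy an initial segment of them; the free slots point out of all cycles
  drawn so far. A bridge is added as a tiny segment in the next free slot, a cycle as a tiny closed curve
  that occupies the next two slots of its attachment vertex and stays in a narrow sector around them.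

  The shape of such a cycle is found in a picture in which its vertex of largest degree lies at infinity.
  The remaining vertices then form a chain of arcs between two rays whose tangent directions all have
  slope at most that of the rays, so that the chain is the graph of a Lipschitz function. An inversion
  centred far below the graph makes it a closed curve of circular arcs with the prescribed angles, and a
  second Moebius map, with pole just outside the attachment vertex, squeezes it into the sector.
\<close>

text \<open>Closing up \<open>n\<close> arcs with \<open>n\<close> prescribed angles is a global
  condition. A vertex at infinity removes it: its two arcs become rays, which may start anywhere, so
  the remaining arcs can be laid end to end without any equation to solve. The vertex of largest
  degree is chosen because its interior angle is the smallest and its turning angle the largest: the
  rays are then steep enough to bound the tangents at all other vertices. Moebius maps keep circular
  arcs and angles, hence every later normalisation is free of charge.

  The second obstacle is to decide on which side of a closed curve the free slots lie. A point is
  shown not to be enclosed by placing it in a connected unbounded set that avoids the curve. In the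
  picture with a vertex at infinity such sets are found below the graph, and the property is carried
  along by Moebius maps as long as their pole lies outside the curve.

  Slots are spaced by the degree in the whole graph, so the angles of a block are known before its
  neighbours are drawn.\<close>

section \<open>Circular arcs and Moebius maps\<close>

text \<open>The circular arc on which \<open>(z - a) / (b - z)\<close> is a nonnegative multiple of \<open>c\<close> (inscribed angles),
  where \<open>norm c = 1\<close>. It leaves \<open>a\<close> in direction \<open>sgn (b - a) * c\<close> and, traversed backwards, leaves \<open>b\<close> in
  direction \<open>sgn (a - b) * cnj c\<close>. For \<open>c = -1\<close> it would pass through infinity.\<close>

definition carc :: "complex \<Rightarrow> complex \<Rightarrow> complex \<Rightarrow> complex set" where
  "carc a b c = {z. \<exists>s. 0 \<le> s \<and> s \<le> 1 \<and> of_real (1 - s) * (z - a) = of_real s * c * (b - z)}"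

text \<open>The equation of \<open>carc\<close> solved for \<open>z\<close>, which turns
  \<open>s\<close> into a parameter. For unit \<open>c\<close> and \<open>s\<close> in
  \<open>{0..1}\<close> the denominator vanishes only at \<open>c = -1\<close>,
  \<open>s = 1 / 2\<close>.\<close>

definition cpt :: "complex \<Rightarrow> complex \<Rightarrow> complex \<Rightarrow> real \<Rightarrow> complex" where
  "cpt a b c s = (of_real (1 - s) * a + of_real s * c * b) / (of_real (1 - s) + of_real s * c)"

lemma cpt_denom_nonzero:
  assumes "norm c = 1" "c \<noteq> -1" "0 \<le> s" "s \<le> 1"
  shows "of_real (1 - s) + of_real s * c \<noteq> (0::complex)"
proof
  assume "of_real (1 - s) + of_real s * c = 0"
  then have eq: "of_real s * c = - of_real (1 - s)"
    by (simp add: add_eq_0_iff)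
  then have "norm (of_real s * c) = norm (of_real (1 - s) :: complex)"
    by (metis norm_minus_cancel)
  then have "s = 1 - s"
    using assms unfolding norm_mult norm_of_real by simp
  then have "s = 1 / 2" by simp
  with eq have "c = -1" by (simp add: field_simps)
  with assms show False by simp
qed

lemma carc_eq_image:
  assumes "norm c = 1" "c \<noteq> -1"
  shows "carc a b c = cpt a b c ` {0..1}"
proof -
  have "of_real (1 - s) * (z - a) = of_real s * c * (b - z) \<longleftrightarrow> z = cpt a b c s"
    if "0 \<le> s" "s \<le> 1" for s z
    using cpt_denom_nonzero[OF assms that] unfolding cpt_def
    by (simp add: eq_divide_eq algebra_simps)
  then show ?thesis
    unfolding carc_def image_def by fastforce
qed

lemma compact_carc:
  assumes "norm c = 1" "c \<noteq> -1"
  shows "compact (carc a b c)"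
proof -
  have "continuous_on {0..1} (cpt a b c)"
    unfolding cpt_def using cpt_denom_nonzero[OF assms]
    by (intro continuous_intros) auto
  then show ?thesis
    unfolding carc_eq_image[OF assms] by (rule compact_continuous_image) simp
qed

lemma carc_start [simp]: "a \<in> carc a b c"
  unfolding carc_def by (auto intro!: exI[of _ 0])

lemma carc_end [simp]: "b \<in> carc a b c"
  unfolding carc_def by (auto intro!: exI[of _ 1])

lemma carc_swap_subset:
  assumes "norm c = 1"
  shows "carc a b c \<subseteq> carc b a (cnj c)"
proof
  fix z assume "z \<in> carc a b c"
  then obtain s where s: "0 \<le> s" "s \<le> 1" and eq: "of_real (1 - s) * (z - a) = of_real s * c * (b - z)"
    unfolding carc_def by auto
  have cc: "cnj c * c = 1"
    using assms complex_norm_square[of c] by (simp add: mult.commute)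
  have "of_real s * (z - b) = - (cnj c * c) * (of_real s * (b - z))"
    unfolding cc by (simp add: algebra_simps)
  also have "\<dots> = - cnj c * (of_real (1 - s) * (z - a))"
    unfolding eq by (simp add: algebra_simps)
  finally have "of_real (1 - (1 - s)) * (z - b) = of_real (1 - s) * cnj c * (a - z)"
    by (simp add: algebra_simps)
  with s show "z \<in> carc b a (cnj c)"
    unfolding carc_def by (intro CollectI exI[of _ "1 - s"]) auto
qed

lemma carc_swap:
  assumes "norm c = 1"
  shows "carc b a (cnj c) = carc a b c"
  using carc_swap_subset[of c a b] carc_swap_subset[of "cnj c" b a] assms by auto

text \<open>Applying \<open>sgn\<close> to the equation of \<open>carc\<close> removes its two
  positive real factors. Letting \<open>z\<close> tend to \<open>a\<close> gives the tangent at
  \<open>a\<close>.\<close>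

lemma carc_direction:
  assumes "z \<in> carc a b c" "z \<noteq> a" "z \<noteq> b" "norm c = 1"
  shows "sgn (z - a) = c * sgn (b - z)"
proof -
  obtain s where s: "0 \<le> s" "s \<le> 1" and eq: "of_real (1 - s) * (z - a) = of_real s * c * (b - z)"
    using assms(1) unfolding carc_def by auto
  have "s \<noteq> 0" "s \<noteq> 1" using eq assms by auto
  with s have "sgn (of_real (1 - s) :: complex) = 1" "sgn (of_real s :: complex) = 1"
    unfolding sgn_of_real by simp_all
  moreover have "sgn c = c" using assms by (simp add: sgn_div_norm)
  ultimately show ?thesis
    using arg_cong[OF eq, of sgn] by (simp add: sgn_mult)
qed

text \<open>Germs at \<open>p\<close> in direction \<open>d\<close>; unlike straight rays, these are preserved by conformal maps.\<close>

definition dirf :: "complex \<Rightarrow> complex \<Rightarrow> complex filter" where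
  "dirf p d = inf (at p) (filtercomap (\<lambda>z. sgn (z - p)) (nhds d))"

lemma filterlim_dirf:
  "filterlim f (dirf p d) F \<longleftrightarrow> filterlim f (at p) F \<and> ((\<lambda>x. sgn (f x - p)) \<longlongrightarrow> d) F"
  unfolding dirf_def filterlim_inf filterlim_filtercomap_iff o_def ..

lemma dirf_le_at: "dirf p d \<le> at p"
  unfolding dirf_def by simp

lemma sgn_tendsto_dirf: "((\<lambda>z. sgn (z - p)) \<longlongrightarrow> d) (dirf p d)"
  using filterlim_dirf[of "\<lambda>x. x" p d "dirf p d"] by (simp add: filterlim_ident)

lemma eventually_dirf:
  "eventually P (dirf p d) \<longleftrightarrow>
     (\<exists>\<delta>>0. \<forall>z. z \<noteq> p \<and> dist z p < \<delta> \<and> dist (sgn (z - p)) d < \<delta> \<longrightarrow> P z)"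
proof
  assume "eventually P (dirf p d)"
  then obtain Q R where "eventually Q (at p)" "eventually R (filtercomap (\<lambda>z. sgn (z - p)) (nhds d))"
    and imp: "\<forall>x. Q x \<and> R x \<longrightarrow> P x"
    unfolding dirf_def eventually_inf by auto
  then obtain R' \<delta>1 \<delta>2 where "\<delta>1 > 0" "\<forall>x. x \<noteq> p \<and> dist x p < \<delta>1 \<longrightarrow> Q x"
    "\<delta>2 > 0" "\<forall>y. dist y d < \<delta>2 \<longrightarrow> R' y" "\<forall>x. R' (sgn (x - p)) \<longrightarrow> R x"
    unfolding eventually_at eventually_filtercomap eventually_nhds_metric by auto
  then show "\<exists>\<delta>>0. \<forall>z. z \<noteq> p \<and> dist z p < \<delta> \<and> dist (sgn (z - p)) d < \<delta> \<longrightarrow> P z"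
    using imp by (intro exI[of _ "min \<delta>1 \<delta>2"]) auto
next
  assume "\<exists>\<delta>>0. \<forall>z. z \<noteq> p \<and> dist z p < \<delta> \<and> dist (sgn (z - p)) d < \<delta> \<longrightarrow> P z"
  then obtain \<delta> where \<delta>: "\<delta> > 0" "\<forall>z. z \<noteq> p \<and> dist z p < \<delta> \<and> dist (sgn (z - p)) d < \<delta> \<longrightarrow> P z"
    by auto
  have "eventually (\<lambda>z. z \<noteq> p \<and> dist z p < \<delta>) (dirf p d)"
    by (rule filter_leD[OF dirf_le_at]) (use \<delta> in \<open>auto simp: eventually_at\<close>)
  moreover have "eventually (\<lambda>z. dist (sgn (z - p)) d < \<delta>) (dirf p d)"
    using sgn_tendsto_dirf \<delta>(1) by (rule tendstoD)
  ultimately show "eventually P (dirf p d)"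
    by eventually_elim (use \<delta>(2) in blast)
qed

text \<open>Finitely many of the germ neighbourhoods cover the compact set \<open>A\<close>, and the
  smallest of their radii serves all directions at once: germs become a truncated sector.\<close>

lemma eventually_dirf_uniform:
  assumes "compact A" and ev: "\<And>d. d \<in> A \<Longrightarrow> eventually P (dirf p d)"
  shows "\<exists>\<delta>>0. \<forall>z. z \<noteq> p \<and> dist z p < \<delta> \<and> sgn (z - p) \<in> A \<longrightarrow> P z"
proof -
  have "\<forall>d\<in>A. \<exists>\<delta>>0. \<forall>z. z \<noteq> p \<and> dist z p < \<delta> \<and> dist (sgn (z - p)) d < \<delta> \<longrightarrow> P z"
    using ev unfolding eventually_dirf by blast
  then obtain \<delta> where \<delta>: "\<And>d. d \<in> A \<Longrightarrow> \<delta> d > 0"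
    "\<And>d z. d \<in> A \<Longrightarrow> z \<noteq> p \<Longrightarrow> dist z p < \<delta> d \<Longrightarrow> dist (sgn (z - p)) d < \<delta> d \<Longrightarrow> P z"
    by (metis (full_types))
  have "A \<subseteq> (\<Union>d\<in>A. ball d (\<delta> d))" using \<delta>(1) by auto
  then obtain B where B: "B \<subseteq> A" "finite B" "A \<subseteq> (\<Union>d\<in>B. ball d (\<delta> d))"
    using compactE_image[OF assms(1), of A "\<lambda>d. ball d (\<delta> d)"] by auto
  obtain e where e: "e > 0" "\<And>d. d \<in> B \<Longrightarrow> e \<le> \<delta> d"
  proof (cases "B = {}")
    case True then show ?thesis using that[of 1] by auto
  next
    case False
    then show ?thesis using that[of "Min (\<delta> ` B)"] B \<delta>(1) by (auto simp: subset_iff)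
  qed
  show ?thesis
  proof (intro exI[of _ e] conjI allI impI)
    fix z assume z: "z \<noteq> p \<and> dist z p < e \<and> sgn (z - p) \<in> A"
    then obtain d where "d \<in> B" "dist d (sgn (z - p)) < \<delta> d" using B(3) by auto
    then show "P z" using \<delta>(2)[of d z] z e(2)[of d] B(1) by (auto simp: dist_commute)
  qed (use e in simp)
qed

text \<open>An arc leaves its endpoint along its tangent only: by \<open>carc_direction\<close>,
  points of the arc close to \<open>a\<close> have directions close to
  \<open>c * sgn (b - a)\<close>.\<close>

lemma eventually_not_carc_dirf:
  assumes c: "norm c = 1" and "a \<noteq> b" "d \<noteq> sgn (b - a) * c"
  shows "eventually (\<lambda>z. z \<notin> carc a b c) (dirf a d)"
proof -
  have at: "((\<lambda>z. z) \<longlongrightarrow> a) (dirf a d)"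
    using tendsto_mono[OF dirf_le_at tendsto_ident_at] .
  have "((\<lambda>z. sgn (z - a) - c * sgn (b - z)) \<longlongrightarrow> d - c * sgn (b - a)) (dirf a d)"
    using assms by (intro tendsto_intros sgn_tendsto_dirf at) auto
  moreover have "d - c * sgn (b - a) \<noteq> 0" using assms by (simp add: mult.commute)
  ultimately have "eventually (\<lambda>z. sgn (z - a) - c * sgn (b - z) \<noteq> 0) (dirf a d)"
    by (rule tendsto_imp_eventually_ne)
  moreover have "eventually (\<lambda>z. z \<noteq> b) (dirf a d)"
    using at assms(2) by (rule tendsto_imp_eventually_ne)
  moreover have "eventually (\<lambda>z. z \<noteq> a) (dirf a d)"
    by (rule filter_leD[OF dirf_le_at]) (simp add: eventually_at_filter)
  ultimately show ?thesis
    by eventually_elim (use carc_direction c in auto)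
qed

lemma eventually_not_closed_dirf:
  assumes "closed S" "p \<notin> S"
  shows "eventually (\<lambda>z. z \<notin> S) (dirf p d)"
proof (rule filter_leD[OF dirf_le_at])
  have "eventually (\<lambda>z. z \<in> -S) (nhds p)"
    using assms by (intro eventually_nhds_in_open) auto
  then show "eventually (\<lambda>z. z \<notin> S) (at p)"
    by (simp add: eventually_at_filter eventually_mono)
qed

text \<open>Conformality in the language of germs: directions are turned by the argument of the
  derivative.\<close>

lemma filterlim_dirf_has_field_derivative:
  assumes "(f has_field_derivative f') (at p)" "f' \<noteq> 0"
  shows "filterlim f (dirf (f p) (sgn f' * d)) (dirf p d)"
proof -
  have quot: "((\<lambda>z. (f z - f p) / (z - p)) \<longlongrightarrow> f') (dirf p d)"
    using assms(1) unfolding has_field_derivative_iff by (rule tendsto_mono[OF dirf_le_at])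
  have cont: "(f \<longlongrightarrow> f p) (dirf p d)"
    using DERIV_isCont[OF assms(1)] unfolding isCont_def by (rule tendsto_mono[OF dirf_le_at])
  have "eventually (\<lambda>z. (f z - f p) / (z - p) \<noteq> 0) (dirf p d)"
    using quot assms(2) by (rule tendsto_imp_eventually_ne)
  then have ne: "eventually (\<lambda>z. f z \<noteq> f p) (dirf p d)"
    by eventually_elim auto
  have nep: "eventually (\<lambda>z. z \<noteq> p) (dirf p d)"
    by (rule filter_leD[OF dirf_le_at]) (simp add: eventually_at_filter)
  have "((\<lambda>z. sgn ((f z - f p) / (z - p)) * sgn (z - p)) \<longlongrightarrow> sgn f' * d) (dirf p d)"
    using assms(2) by (intro tendsto_intros quot sgn_tendsto_dirf)
  moreover have "eventually (\<lambda>z. sgn ((f z - f p) / (z - p)) * sgn (z - p) = sgn (f z - f p)) (dirf p d)"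
    using nep by eventually_elim (simp add: sgn_mult [symmetric] del: sgn_divide)
  ultimately have "((\<lambda>z. sgn (f z - f p)) \<longlongrightarrow> sgn f' * d) (dirf p d)"
    by (rule Lim_transform_eventually)
  then show ?thesis
    unfolding filterlim_dirf filterlim_at using cont ne by (auto simp: eventually_conj_iff)
qed

text \<open>The form of \<open>diff\<close> covers inversions (\<open>h z = z - q\<close>) as well as affine maps (\<open>h z = 1\<close>).\<close>

locale moebius =
  fixes f h :: "complex \<Rightarrow> complex" and m l B :: complex
  assumes h: "h z = m * z + l"
    and B: "B \<noteq> 0"
    and diff: "h z \<noteq> 0 \<Longrightarrow> h w \<noteq> 0 \<Longrightarrow> f z - f w = B * (z - w) / (h z * h w)"
begin

lemma inj: "h z \<noteq> 0 \<Longrightarrow> h w \<noteq> 0 \<Longrightarrow> f z = f w \<longleftrightarrow> z = w"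
  using diff[of z w] B by (metis (no_types) diff_self divide_eq_0_iff eq_iff_diff_eq_0 mult_eq_0_iff)

text \<open>By \<open>diff\<close>, \<open>(f z - f a) / (f b - f z)\<close> is
  \<open>(z - a) / (b - z)\<close> times the constant \<open>h b / h a\<close>. The unit part of
  this constant changes \<open>c\<close>; its modulus only changes the parameter of the arc, as
  computed in \<open>moebius_ratio_param\<close>.\<close>

definition twist :: "complex \<Rightarrow> complex \<Rightarrow> complex \<Rightarrow> complex" where
  "twist a b c = c * (sgn (h b) / sgn (h a))"

lemma norm_twist: "norm c = 1 \<Longrightarrow> h a \<noteq> 0 \<Longrightarrow> h b \<noteq> 0 \<Longrightarrow> norm (twist a b c) = 1"
  unfolding twist_def by (simp add: norm_mult norm_divide norm_sgn)

lemma twist_swap: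
  assumes "h a \<noteq> 0" "h b \<noteq> 0"
  shows "cnj (twist a b c) = twist b a (cnj c)"
proof -
  have unit: "cnj (sgn z) = 1 / sgn z" if "z \<noteq> 0" for z :: complex
  proof -
    have "sgn z * cnj (sgn z) = 1"
      using complex_norm_square[of "sgn z"] that by (simp add: norm_sgn)
    then show ?thesis using that by (simp add: field_simps sgn_zero_iff)
  qed
  show ?thesis
    unfolding twist_def complex_cnj_mult complex_cnj_divide unit[OF assms(1)] unit[OF assms(2)] by simp
qed

lemma moebius_ratio_param:
  assumes h0: "h a \<noteq> 0" "h b \<noteq> 0" and s: "0 \<le> s" "s \<le> (1::real)"
  defines "t \<equiv> s * norm (h b) / ((1 - s) * norm (h a) + s * norm (h b))"
  shows "0 \<le> t" "t \<le> 1"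
    "h z \<noteq> 0 \<Longrightarrow> of_real (1 - s) * (z - a) = of_real s * c * (b - z) \<Longrightarrow>
      of_real (1 - t) * (f z - f a) = of_real t * twist a b c * (f b - f z)"
proof -
  define N where "N = (1 - s) * norm (h a) + s * norm (h b)"
  have N: "N > 0"
  proof (cases "s = 0")
    case False
    then show ?thesis unfolding N_def using s h0 by (intro add_nonneg_pos mult_pos_pos) auto
  qed (use h0 in \<open>auto simp: N_def\<close>)
  have t: "t = s * norm (h b) / N" "1 - t = (1 - s) * norm (h a) / N"
    using N unfolding t_def N_def by (simp_all add: field_simps)
  show "0 \<le> t" using N s t(1) by simp
  have "0 \<le> 1 - t" using N s t(2) by simp
  then show "t \<le> 1" by simp
  assume hz: "h z \<noteq> 0" and eq: "of_real (1 - s) * (z - a) = of_real s * c * (b - z)"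
  have sg: "sgn (h b) / sgn (h a) = of_real (norm (h a)) / of_real (norm (h b)) * (h b / h a)"
    by (simp add: sgn_eq)
  have "of_real (1 - t) * (f z - f a) = (of_real (norm (h a)) * B / (of_real N * h z * h a)) * (of_real (1 - s) * (z - a))"
    using diff[OF hz h0(1)] unfolding t(2) by (simp add: mult_ac)
  also have "\<dots> = (of_real (norm (h a)) * B / (of_real N * h z * h a)) * (of_real s * c * (b - z))"
    unfolding eq ..
  also have "\<dots> = of_real t * twist a b c * (f b - f z)"
    unfolding diff[OF h0(2) hz] t(1) twist_def sg using h0 N hz by (simp add: field_simps)
  finally show "of_real (1 - t) * (f z - f a) = of_real t * twist a b c * (f b - f z)" .
qed

text \<open>A twist of \<open>-1\<close> would mean an image arc through infinity, that is, a pole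
  of \<open>f\<close> on the original arc. The parameter \<open>s\<close> below is where the zero of
  \<open>h\<close> would sit.\<close>

lemma twist_ne:
  assumes c: "norm c = 1" "c \<noteq> -1" and nz: "\<And>z. z \<in> carc a b c \<Longrightarrow> h z \<noteq> 0"
  shows "twist a b c \<noteq> -1"
proof
  assume eq: "twist a b c = -1"
  have h0: "h a \<noteq> 0" "h b \<noteq> 0" using nz by auto
  define s where "s = norm (h a) / (norm (h a) + norm (h b))"
  have pos: "norm (h a) + norm (h b) > 0" using h0 by (simp add: add_pos_pos)
  have s: "0 \<le> s" "s \<le> 1" and s': "1 - s = norm (h b) / (norm (h a) + norm (h b))"
    using pos unfolding s_def by (simp_all add: field_simps)
  have "cpt a b c s \<in> carc a b c" unfolding carc_eq_image[OF c] using s by auto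
  then have "h (cpt a b c s) \<noteq> 0" by (rule nz)
  moreover have "h (cpt a b c s) = (of_real (1 - s) * h a + of_real s * c * h b) / (of_real (1 - s) + of_real s * c)"
    unfolding cpt_def h using cpt_denom_nonzero[OF c s] by (simp add: field_simps)
  moreover have "of_real (norm (h b)) * h a + of_real (norm (h a)) * c * h b = 0"
  proof -
    have "c * (of_real (norm (h a)) / of_real (norm (h b)) * (h b / h a)) = - 1"
      using eq unfolding twist_def sgn_eq by (simp add: mult_ac)
    then have "c * of_real (norm (h a)) * h b = - (of_real (norm (h b)) * h a)"
      using h0 by (simp add: field_simps)
    then show ?thesis by (simp add: algebra_simps)
  qed
  then have "of_real (1 - s) * h a + of_real s * c * h b = 0"
    unfolding s' unfolding s_def by (simp only: of_real_divide times_divide_eq_left times_divide_eq_right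
      add_divide_distrib[symmetric] div_0)
  ultimately show False by simp
qed

lemma image_carc:
  assumes c: "norm c = 1" "c \<noteq> -1" and nz: "\<And>z. z \<in> carc a b c \<Longrightarrow> h z \<noteq> 0"
  shows "f ` carc a b c = carc (f a) (f b) (twist a b c)"
proof (intro set_eqI iffI)
  have h0: "h a \<noteq> 0" "h b \<noteq> 0" using nz by auto
  note c' = norm_twist[OF c(1) h0] twist_ne[OF c nz]
  {
    fix y assume "y \<in> f ` carc a b c"
    then obtain z where z: "z \<in> carc a b c" "y = f z" by auto
    then obtain s where s: "0 \<le> s" "s \<le> 1" "of_real (1 - s) * (z - a) = of_real s * c * (b - z)"
      unfolding carc_def by auto
    show "y \<in> carc (f a) (f b) (twist a b c)"
      using moebius_ratio_param[OF h0 s(1,2)] s(3) nz[OF z(1)] unfolding z(2) carc_def by blast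
  next
    fix y assume "y \<in> carc (f a) (f b) (twist a b c)"
    then obtain t where t: "0 \<le> t" "t \<le> 1" and y: "y = cpt (f a) (f b) (twist a b c) t"
      using carc_eq_image[OF c'(1) c'(2)] by auto
    define N where "N = t * norm (h a) + (1 - t) * norm (h b)"
    have N: "N > 0"
    proof (cases "t = 1")
      case False
      then show ?thesis unfolding N_def using t h0 by (intro add_nonneg_pos mult_pos_pos) auto
    qed (use h0 in \<open>auto simp: N_def\<close>)
    \<comment> \<open>The inverse of the change of parameter in \<open>moebius_ratio_param\<close>,
      as \<open>ts\<close> confirms.\<close>
    define s where "s = t * norm (h a) / N"
    have s1: "1 - s = (1 - t) * norm (h b) / N"
      using N unfolding s_def N_def by (simp add: field_simps)
    then have "0 \<le> 1 - s" using N t by simp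
    then have s: "0 \<le> s" "s \<le> 1" using N t unfolding s_def by simp_all
    have "(1 - s) * norm (h a) + s * norm (h b) = norm (h a) * norm (h b) / N"
      unfolding s1 unfolding s_def using N by (simp add: field_simps)
    then have ts: "s * norm (h b) / ((1 - s) * norm (h a) + s * norm (h b)) = t"
      using N h0 unfolding s_def by simp
    define z where "z = cpt a b c s"
    have z: "z \<in> carc a b c" unfolding z_def carc_eq_image[OF c] using s by auto
    have "of_real (1 - s) * (z - a) = of_real s * c * (b - z)"
      unfolding z_def cpt_def using cpt_denom_nonzero[OF c s] by (simp add: field_simps)
    from moebius_ratio_param(3)[OF h0 s nz[OF z] this]
    have "of_real (1 - t) * (f z - f a) = of_real t * twist a b c * (f b - f z)"
      unfolding ts .
    then have "f z = y"
      unfolding y cpt_def using cpt_denom_nonzero[OF c' t] by (simp add: eq_divide_eq algebra_simps)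
    with z show "y \<in> f ` carc a b c" by auto
  }
qed

text \<open>\<open>B / (h a)\<^sup>2\<close> is the derivative of \<open>f\<close> at
  \<open>a\<close>, so this is conformality for the initial tangent of an arc. Applied to the
  swapped arc, it handles the other end.\<close>

lemma tangent_twist:
  assumes "h a \<noteq> 0" "h b \<noteq> 0"
  shows "sgn (f b - f a) * twist a b c = sgn (B / (h a)\<^sup>2) * (sgn (b - a) * c)"
proof -
  have "sgn (f b - f a) = sgn B * sgn (b - a) / (sgn (h b) * sgn (h a))"
    unfolding diff[OF assms(2,1)] by (simp add: sgn_mult)
  then show ?thesis
    unfolding twist_def using assms by (simp add: sgn_mult power2_eq_square sgn_zero_iff)
qed

lemma eventually_dirf_image:
  assumes hp: "h p \<noteq> 0" and ev: "eventually Q (dirf p d)"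
  shows "eventually (\<lambda>y. \<exists>z. h z \<noteq> 0 \<and> f z = y \<and> Q z) (dirf (f p) (sgn (B / (h p)\<^sup>2) * d))"
proof -
  \<comment> \<open>The inverse of \<open>f\<close> near \<open>f p\<close>, found by solving
    \<open>y - f p = B * (z - p) / (h z * h p)\<close> for \<open>z\<close>.\<close>
  define g where "g y = p + (y - f p) * (h p)\<^sup>2 / (B - m * h p * (y - f p))" for y
  have gp: "g (f p) = p" unfolding g_def by simp
  have "(g has_field_derivative (h p)\<^sup>2 / B) (at (f p))"
    unfolding g_def using B by (auto intro!: derivative_eq_intros simp: power2_eq_square)
  moreover have "(h p)\<^sup>2 / B \<noteq> 0" using hp B by simp
  ultimately have "filterlim g (dirf (g (f p)) (sgn ((h p)\<^sup>2 / B) * (sgn (B / (h p)\<^sup>2) * d)))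
      (dirf (f p) (sgn (B / (h p)\<^sup>2) * d))"
    by (rule filterlim_dirf_has_field_derivative)
  moreover have "sgn ((h p)\<^sup>2 / B) * (sgn (B / (h p)\<^sup>2) * d) = d"
    using hp B by (simp add: sgn_divide sgn_zero_iff)
  ultimately have "filterlim g (dirf p d) (dirf (f p) (sgn (B / (h p)\<^sup>2) * d))"
    unfolding gp by simp
  with ev have 1: "eventually (\<lambda>y. Q (g y)) (dirf (f p) (sgn (B / (h p)\<^sup>2) * d))"
    unfolding filterlim_iff by blast
  have "((\<lambda>y. B - m * h p * (y - f p)) \<longlongrightarrow> B - m * h p * (f p - f p)) (dirf (f p) (sgn (B / (h p)\<^sup>2) * d))"
    by (rule tendsto_mono[OF dirf_le_at]) (intro tendsto_intros)
  then have 2: "eventually (\<lambda>y. B - m * h p * (y - f p) \<noteq> 0) (dirf (f p) (sgn (B / (h p)\<^sup>2) * d))"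
    by (rule tendsto_imp_eventually_ne) (use B in simp)
  from 1 2 show ?thesis
  proof eventually_elim
    case (elim y)
    have "h (g y) = m * (g y - p) + h p" unfolding h by (simp add: algebra_simps)
    also have "\<dots> = h p * B / (B - m * h p * (y - f p))"
      unfolding g_def using elim(2) by (simp add: divide_simps) (simp add: algebra_simps power2_eq_square)
    finally have hg: "h (g y) = h p * B / (B - m * h p * (y - f p))" .
    then have hg0: "h (g y) \<noteq> 0" using hp B elim(2) by simp
    have "f (g y) - f p = B * (g y - p) / (h (g y) * h p)"
      by (rule diff[OF hg0 hp])
    also have "\<dots> = y - f p"
      unfolding hg using hp B elim(2) unfolding g_def by (simp add: power2_eq_square)
    finally have "f (g y) = y" by simp
    with hg0 elim(1) show ?case by blast
  qed
qed

lemma not_inside_image: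
  assumes S: "compact S" and nz: "\<And>z. z \<in> S \<Longrightarrow> h z \<noteq> 0"
    and pole: "m = 0 \<or> - l / m \<in> outside S"
    and x: "x \<notin> inside S" "h x \<noteq> 0"
  shows "f x \<notin> inside (f ` S)"
proof (cases "x \<in> S")
  case True
  then show ?thesis using inside_no_overlap by blast
next
  case False
  have out: "x \<in> outside S" using False x(1) by (auto simp: outside_inside)
  \<comment> \<open>\<open>diff\<close> says nothing about \<open>f\<close> at the pole, so the pole
    is deleted. Deleting a point keeps an open connected subset of the plane connected.\<close>
  define X where "X = outside S - {- l / m}"
  have hX: "h z \<noteq> 0" if "z \<in> X" for z
  proof (cases "m = 0")
    case True
    then show ?thesis using x(2) unfolding h by simp
  next
    case False
    then show ?thesis using that unfolding X_def h by (auto simp: field_simps add_eq_0_iff)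
  qed
  have xX: "x \<in> X \<or> m = 0" using out x(2) unfolding X_def h by (cases "m = 0") auto
  have opn: "open (outside S)" using S by (simp add: compact_imp_closed open_outside)
  have conn: "connected (outside S)"
    by (rule connected_outside) (use S in \<open>auto simp: compact_imp_bounded\<close>)
  define Y where "Y = (if m = 0 then outside S else X)"
  have hY: "h z \<noteq> 0" if "z \<in> Y" for z
    using that hX x(2) unfolding Y_def h by (auto split: if_splits)
  have xY: "x \<in> Y" using xX out unfolding Y_def by auto
  have connY: "connected Y"
    unfolding Y_def X_def using connected_open_delete[OF opn conn] conn by simp
  have fx: "f z = f x + B * (z - x) / (h z * h x)" if "h z \<noteq> 0" for z
    using diff[OF that x(2)] by (simp add: algebra_simps)
  have "continuous_on Y (\<lambda>z. f x + B * (z - x) / (h z * h x))"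
    unfolding h using hY x(2) by (intro continuous_intros) (auto simp: h)
  then have "continuous_on Y f"
    by (rule continuous_on_eq) (simp add: fx hY)
  then have connf: "connected (f ` Y)" using connY by (rule connected_continuous_image)
  have "\<not> bounded (f ` Y)"
  proof
    assume "bounded (f ` Y)"
    then have "bounded ((\<lambda>w. - f x + w) ` f ` Y)" by (rule bounded_translation)
    then obtain M where "\<And>z. z \<in> Y \<Longrightarrow> norm (f z - f x) \<le> M"
      unfolding bounded_iff by auto
    then have M: "norm B * norm (z - x) \<le> M * (norm (h z) * norm (h x))" if "z \<in> Y" for z
      using that fx[OF hY[OF that]] hY[OF that] x(2)
      by (force simp: norm_divide norm_mult pos_divide_le_eq)
    \<comment> \<open>If the image were bounded, then for affine \<open>f\<close> the outside of
      \<open>S\<close> would be bounded too; otherwise letting \<open>z\<close> tend to the pole in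
      \<open>M\<close> makes the right-hand side vanish and forces \<open>x\<close> to be the
      pole.\<close>
    show False
    proof (cases "m = 0")
      case True
      have "bounded ((\<lambda>z. - x + z) ` outside S)"
        unfolding bounded_iff
      proof (intro exI[of _ "M * (norm l * norm l) / norm B"] ballI)
        fix w assume "w \<in> (\<lambda>z. - x + z) ` outside S"
        then obtain z where z: "w = z - x" "z \<in> outside S" by auto
        then show "norm w \<le> M * (norm l * norm l) / norm B"
          using M[of z] B True unfolding Y_def h z(1) by (simp add: pos_le_divide_eq mult.commute)
      qed
      then have "bounded ((\<lambda>z. x + z) ` (\<lambda>z. - x + z) ` outside S)" by (rule bounded_translation)
      then have "bounded (outside S)" by (simp add: image_image)
      then show False using S compact_imp_bounded unbounded_outside by blast
    next
      case False
      have "eventually (\<lambda>z. z \<in> outside S) (nhds (- l / m))"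
        using opn pole False by (intro eventually_nhds_in_open) auto
      then have "eventually (\<lambda>z. norm B * norm (z - x) \<le> M * (norm (h z) * norm (h x))) (at (- l / m))"
        unfolding eventually_at_filter
        by eventually_elim (use M False in \<open>auto simp: Y_def X_def\<close>)
      moreover have "((\<lambda>z. norm B * norm (z - x)) \<longlongrightarrow> norm B * norm (- l / m - x)) (at (- l / m))"
        by (intro tendsto_intros)
      moreover have "((\<lambda>z. M * (norm (m * z + l) * norm (h x))) \<longlongrightarrow> M * (norm (m * (- l / m) + l) * norm (h x))) (at (- l / m))"
        by (intro tendsto_intros)
      ultimately have "norm B * norm (- l / m - x) \<le> M * (norm (m * (- l / m) + l) * norm (h x))"
        unfolding h by (intro tendsto_le[OF trivial_limit_at]) auto
      then have "norm B * norm (- l / m - x) \<le> 0" using False by simp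
      then have "x = - l / m" using B by (simp add: mult_le_0_iff)
      then show False using x(2) False unfolding h by simp
    qed
  qed
  moreover have "y \<notin> S" if "y \<in> Y" for y
    using that outside_no_overlap[of S] unfolding Y_def X_def disjoint_iff by (auto split: if_splits)
  then have "f ` Y \<inter> f ` S = {}"
    using inj hY nz by blast
  then have "f ` Y \<subseteq> - f ` S" by auto
  then have "f ` Y \<subseteq> connected_component_set (- f ` S) (f x)"
    using connf xY by (intro connected_component_maximal) auto
  ultimately have "\<not> bounded (connected_component_set (- f ` S) (f x))"
    using bounded_subset by blast
  then show ?thesis unfolding inside_def by blast
qed

end

section \<open>Closed chains of arcs with prescribed angles\<close>

lemma cis_neq_1: "0 < x \<Longrightarrow> x < 2 * pi \<Longrightarrow> cis x \<noteq> 1"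
proof
  assume x: "0 < x" "x < 2 * pi" "cis x = 1"
  then have "cos x = 1" by (simp add: complex_eq_iff)
  then obtain k :: int where k: "x = of_int k * 2 * pi" using cos_one_2pi_int by blast
  with x have "0 < real_of_int k" "real_of_int k < 1" by (auto simp: zero_less_mult_iff)
  then show False by simp
qed

lemma cis_neq: "0 < x - y \<Longrightarrow> x - y < 2 * pi \<Longrightarrow> cis x \<noteq> cis y"
  using cis_neq_1[of "x - y"] by (auto simp flip: cis_divide)

lemma connected_unbounded_not_inside:
  assumes "connected Z" "\<not> bounded Z" "Z \<inter> S = {}" "z \<in> Z"
  shows "z \<notin> inside S"
proof -
  have "Z \<subseteq> connected_component_set (- S) z"
    using assms by (intro connected_component_maximal) auto
  then show ?thesis using assms(2) bounded_subset unfolding inside_def by blast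
qed

lemma sgn_scale_unit: "r > 0 \<Longrightarrow> norm d = 1 \<Longrightarrow> sgn (of_real r * d) = (d :: complex)"
  by (simp add: sgn_mult sgn_of_real) (simp add: sgn_div_norm)

lemma connected_ray: "connected ((\<lambda>t. p + of_real t * d) ` {0<..} :: complex set)"
  by (intro connected_continuous_image continuous_intros) simp

lemma unbounded_ray:
  assumes "d \<noteq> 0"
  shows "\<not> bounded ((\<lambda>t. p + of_real t * d) ` {0<..} :: complex set)"
proof
  assume "bounded ((\<lambda>t. p + of_real t * d) ` {0<..})"
  then have "bounded ((\<lambda>z. - p + z) ` (\<lambda>t. p + of_real t * d) ` {0<..})" by (rule bounded_translation)
  then obtain M where M: "\<And>t. t > 0 \<Longrightarrow> norm (of_real t * d) \<le> M"
    unfolding bounded_iff by (auto simp: image_image)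
  then have "t * norm d \<le> M" if "t > 0" for t using that M[of t] by (simp add: norm_mult)
  from this[of "(\<bar>M\<bar> + 1) / norm d"] assms show False by simp
qed

lemma sector_connected:
  "connected ((\<lambda>x. p + of_real (fst x) * (snd x)) ` ({0<..<\<delta>} \<times> A) :: complex set)" if "connected A"
  using that by (intro connected_continuous_image continuous_intros connected_Times) auto

lemma eventually_sgn_in_cis_interval:
  assumes w: "norm w = 1" and \<phi>: "a < \<phi>" "\<phi> < b"
  shows "eventually (\<lambda>z. sgn (z - p) \<in> (\<lambda>x. w * cis x) ` {a..b}) (dirf p (w * cis \<phi>))"
proof -
  let ?F = "dirf p (w * cis \<phi>)"
  have w0: "w \<noteq> 0" using w by auto
  have "((\<lambda>z. sgn (z - p) / (w * cis \<phi>)) \<longlongrightarrow> (w * cis \<phi>) / (w * cis \<phi>)) ?F"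
    using w0 by (intro tendsto_intros sgn_tendsto_dirf) auto
  then have "((\<lambda>z. sgn (z - p) / (w * cis \<phi>)) \<longlongrightarrow> 1) ?F" using w0 by simp
  then have "((\<lambda>z. Arg (sgn (z - p) / (w * cis \<phi>))) \<longlongrightarrow> Arg 1) ?F"
    by (intro isCont_tendsto_compose[where g = Arg] continuous_at_Arg) auto
  then have "((\<lambda>z. Arg (sgn (z - p) / (w * cis \<phi>))) \<longlongrightarrow> 0) ?F" by simp
  from order_tendstoD(1)[OF this, of "a - \<phi>"] order_tendstoD(2)[OF this, of "b - \<phi>"]
  have "eventually (\<lambda>z. a - \<phi> < Arg (sgn (z - p) / (w * cis \<phi>))) ?F"
    "eventually (\<lambda>z. Arg (sgn (z - p) / (w * cis \<phi>)) < b - \<phi>) ?F"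
    using \<phi> by auto
  moreover have "eventually (\<lambda>z. z \<noteq> p) ?F"
    by (rule filter_leD[OF dirf_le_at]) (simp add: eventually_at_filter)
  ultimately show ?thesis
  proof eventually_elim
    case (elim z)
    let ?u = "sgn (z - p) / (w * cis \<phi>)"
    have "norm ?u = 1" using elim w by (simp add: norm_divide norm_mult norm_sgn)
    then have "?u = cis (Arg ?u)" by (metis cis_Arg norm_eq_zero sgn_eq div_by_1 of_real_1 zero_neq_one)
    then have "sgn (z - p) = w * cis (\<phi> + Arg ?u)"
      using w0 by (simp add: field_simps flip: cis_mult)
    then show ?case using elim by (intro image_eqI[of _ _ "\<phi> + Arg ?u"]) auto
  qed
qed

text \<open>A truncated sector that misses \<open>S\<close> is joined to one full ray that misses
  \<open>S\<close>. The union is connected and unbounded, so a single good ray settles every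
  direction of the sector.\<close>

lemma sector_not_inside:
  assumes w: "norm w = 1"
    and ev: "\<And>\<phi>. a \<le> \<phi> \<Longrightarrow> \<phi> \<le> b \<Longrightarrow> eventually (\<lambda>z. z \<notin> S) (dirf p (w * cis \<phi>))"
    and \<xi>: "a \<le> \<xi>" "\<xi> \<le> b" and ray: "\<And>t. t > 0 \<Longrightarrow> p + of_real t * (w * cis \<xi>) \<notin> S"
    and \<phi>: "a < \<phi>" "\<phi> < b"
  shows "eventually (\<lambda>z. z \<notin> inside S) (dirf p (w * cis \<phi>))"
proof -
  define A where "A = (\<lambda>x. w * cis x) ` {a..b}"
  have cont: "continuous_on {a..b} (\<lambda>x. w * cis x)" by (intro continuous_intros)
  have "compact A" "connected A"
    unfolding A_def using cont by (auto intro: compact_continuous_image connected_continuous_image)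
  obtain \<delta> where \<delta>: "\<delta> > 0" "\<And>z. z \<noteq> p \<Longrightarrow> dist z p < \<delta> \<Longrightarrow> sgn (z - p) \<in> A \<Longrightarrow> z \<notin> S"
    using eventually_dirf_uniform[OF \<open>compact A\<close>, of "\<lambda>z. z \<notin> S" p] ev unfolding A_def
    by (fastforce simp del: not_le)
  have unit: "norm d = 1" if "d \<in> A" for d using that w unfolding A_def by (auto simp: norm_mult)
  define Z where "Z = (\<lambda>x. p + of_real (fst x) * (snd x)) ` ({0<..<\<delta>} \<times> A)"
  define R where "R = (\<lambda>t. p + of_real t * (w * cis \<xi>)) ` {0<..}"
  have ZS: "Z \<inter> S = {}"
  proof -
    have "p + of_real r * d \<notin> S" if "0 < r" "r < \<delta>" "d \<in> A" for r d
      using that unit[OF that(3)] by (intro \<delta>(2)) (auto simp: dist_norm norm_mult sgn_scale_unit)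
    then show ?thesis unfolding Z_def by auto
  qed
  have RS: "R \<inter> S = {}" using ray unfolding R_def by auto
  have conn: "connected (Z \<union> R)"
  proof (rule connected_Un)
    have "p + of_real (\<delta> / 2) * (w * cis \<xi>) \<in> Z \<inter> R"
      unfolding Z_def R_def A_def using \<delta>(1) \<xi>
      by (intro IntI image_eqI[of _ _ "(\<delta> / 2, w * cis \<xi>)"] image_eqI[of _ _ "\<delta> / 2"]) auto
    then show "Z \<inter> R \<noteq> {}" by auto
  qed (auto simp: Z_def R_def intro: sector_connected \<open>connected A\<close> connected_ray)
  have "\<not> bounded R" unfolding R_def using w by (intro unbounded_ray) auto
  then have unb: "\<not> bounded (Z \<union> R)" by simp
  have Zout: "z \<notin> inside S" if "z \<in> Z" for z
    using connected_unbounded_not_inside[OF conn unb, of S z] ZS RS that by auto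
  have "eventually (\<lambda>z. sgn (z - p) \<in> A) (dirf p (w * cis \<phi>))"
    unfolding A_def using w \<phi> by (rule eventually_sgn_in_cis_interval)
  moreover have "eventually (\<lambda>z. z \<noteq> p \<and> dist z p < \<delta>) (dirf p (w * cis \<phi>))"
    by (rule filter_leD[OF dirf_le_at]) (use \<delta> in \<open>auto simp: eventually_at\<close>)
  ultimately show ?thesis
  proof eventually_elim
    case (elim z)
    have "z = p + of_real (norm (z - p)) * sgn (z - p)" using elim by (simp add: sgn_eq)
    then have "z \<in> Z"
      unfolding Z_def using elim
      by (intro image_eqI[of _ _ "(norm (z - p), sgn (z - p))"]) (auto simp: dist_norm)
    then show ?case by (rule Zout)
  qed
qed

section \<open>Rings of circular arcs\<close>

definition rarc :: "nat \<Rightarrow> (nat \<Rightarrow> complex) \<Rightarrow> (nat \<Rightarrow> complex) \<Rightarrow> nat \<Rightarrow> complex set" where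
  "rarc n P C i = carc (P i) (P ((i + 1) mod n)) (C i)"

definition rcurve :: "nat \<Rightarrow> (nat \<Rightarrow> complex) \<Rightarrow> (nat \<Rightarrow> complex) \<Rightarrow> complex set" where
  "rcurve n P C = (\<Union>i<n. rarc n P C i)"

definition rout :: "nat \<Rightarrow> (nat \<Rightarrow> complex) \<Rightarrow> (nat \<Rightarrow> complex) \<Rightarrow> nat \<Rightarrow> complex" where
  "rout n P C i = sgn (P ((i + 1) mod n) - P i) * C i"

text \<open>The last condition says that turning the outgoing direction at a vertex by \<open>\<alpha>\<close> gives the direction of
  the incoming arc traversed backwards, so the wedge of the enclosed region lies to the left.\<close>

definition arc_ring :: "nat \<Rightarrow> (nat \<Rightarrow> real) \<Rightarrow> (nat \<Rightarrow> complex) \<Rightarrow> (nat \<Rightarrow> complex) \<Rightarrow> bool" where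
  "arc_ring n \<alpha> P C \<longleftrightarrow> 3 \<le> n \<and> inj_on P {..<n} \<and>
     (\<forall>i<n. norm (C i) = 1 \<and> C i \<noteq> -1) \<and>
     (\<forall>i<n. \<forall>j<n. i \<noteq> j \<longrightarrow>
        rarc n P C i \<inter> rarc n P C j \<subseteq> P ` ({i, (i + 1) mod n} \<inter> {j, (j + 1) mod n})) \<and>
     (\<forall>i<n. sgn (P i - P ((i + 1) mod n)) * cnj (C i) =
        cis (\<alpha> ((i + 1) mod n)) * rout n P C ((i + 1) mod n))"

text \<open>Fixes the orientation: near \<open>P i\<close>, all directions beyond the wedge of
  angles from \<open>0\<close> to \<open>\<alpha> i\<close> point out of the enclosed region. The
  slots that a cycle leaves free at its vertices lie in these directions.\<close>

definition ring_ext :: "nat \<Rightarrow> (nat \<Rightarrow> real) \<Rightarrow> (nat \<Rightarrow> complex) \<Rightarrow> (nat \<Rightarrow> complex) \<Rightarrow> bool" where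
  "ring_ext n \<alpha> P C \<longleftrightarrow> (\<forall>i<n. \<forall>\<phi>. \<alpha> i < \<phi> \<and> \<phi> < 2 * pi \<longrightarrow>
     eventually (\<lambda>z. z \<notin> inside (rcurve n P C)) (dirf (P i) (rout n P C i * cis \<phi>)))"

lemma mod_succ_neq: "3 \<le> n \<Longrightarrow> i < n \<Longrightarrow> (i + 1) mod n \<noteq> (i::nat)"
  by (cases "i + 1 = n") auto

lemma mod_succ_inj: "i < n \<Longrightarrow> j < n \<Longrightarrow> (i + 1) mod n = (j + 1) mod n \<Longrightarrow> i = (j::nat)"
  by (cases "i + 1 = n"; cases "j + 1 = n") auto

lemma mod_succ_surj: "k < n \<Longrightarrow> \<exists>i<n. (i + 1) mod n = (k::nat)"
  by (cases k) (auto intro: exI[of _ "n - 1"] exI[of _ "k - 1"])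

context
  fixes n \<alpha> P C
  assumes R: "arc_ring n \<alpha> P C"
begin

lemma ring_n: "3 \<le> n"
  and ring_inj: "inj_on P {..<n}"
  and ring_norm: "i < n \<Longrightarrow> norm (C i) = 1"
  and ring_ne: "i < n \<Longrightarrow> C i \<noteq> -1"
  and ring_disj: "i < n \<Longrightarrow> j < n \<Longrightarrow> i \<noteq> j \<Longrightarrow>
        rarc n P C i \<inter> rarc n P C j \<subseteq> P ` ({i, (i + 1) mod n} \<inter> {j, (j + 1) mod n})"
  and ring_turn: "i < n \<Longrightarrow> sgn (P i - P ((i + 1) mod n)) * cnj (C i) =
        cis (\<alpha> ((i + 1) mod n)) * rout n P C ((i + 1) mod n)"
  using R unfolding arc_ring_def by auto

lemma ring_succ_less: "(i + 1) mod n < n" using ring_n by simp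

lemma ring_vertex_arc:
  assumes "k < n" "i < n" "P k \<in> rarc n P C i"
  shows "k = i \<or> k = (i + 1) mod n"
proof (cases "k = i")
  case False
  have "P k \<in> rarc n P C k" unfolding rarc_def by simp
  then obtain x where "x \<in> {i, (i + 1) mod n}" "P k = P x"
    using ring_disj[OF assms(1,2) False] assms(3) by auto
  then show ?thesis
    using ring_inj assms ring_succ_less[of i] unfolding inj_on_def by auto
qed simp

lemma ring_P_neq: "i < n \<Longrightarrow> P i \<noteq> P ((i + 1) mod n)"
  using ring_inj mod_succ_neq[OF ring_n, of i] ring_succ_less[of i] unfolding inj_on_def by fastforce

lemma compact_rarc: "i < n \<Longrightarrow> compact (rarc n P C i)"
  unfolding rarc_def using ring_norm ring_ne by (intro compact_carc)

lemma compact_rcurve: "compact (rcurve n P C)"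
  unfolding rcurve_def using compact_rarc by (intro compact_UN) auto

lemma norm_rout: "i < n \<Longrightarrow> norm (rout n P C i) = 1"
  unfolding rout_def using ring_norm ring_P_neq[of i] by (simp add: norm_mult norm_sgn)

text \<open>Only the two arcs that end at \<open>P k\<close> matter, with the tangents
  \<open>rout n P C k\<close> and, by \<open>ring_turn\<close>,
  \<open>rout n P C k * cis (\<alpha> k)\<close>.\<close>

lemma ring_eventually_not_rcurve:
  assumes k: "k < n" and d: "d \<noteq> rout n P C k" "d \<noteq> rout n P C k * cis (\<alpha> k)"
  shows "eventually (\<lambda>z. z \<notin> rcurve n P C) (dirf (P k) d)"
proof -
  have "eventually (\<lambda>z. z \<notin> rarc n P C i) (dirf (P k) d)" if i: "i < n" for i
  proof -
    consider "i = k" | "(i + 1) mod n = k" | "P k \<notin> rarc n P C i"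
      using ring_vertex_arc[OF k i] by blast
    then show ?thesis
    proof cases
      case 1
      then show ?thesis
        using d(1) ring_norm[OF k] ring_P_neq[OF k] unfolding rarc_def rout_def 1
        by (intro eventually_not_carc_dirf) auto
    next
      case 2
      have "eventually (\<lambda>z. z \<notin> carc (P k) (P i) (cnj (C i))) (dirf (P k) d)"
        using ring_norm[OF i] ring_P_neq[OF i] ring_turn[OF i] d(2) unfolding 2
        by (intro eventually_not_carc_dirf) (auto simp: mult.commute)
      then show ?thesis unfolding rarc_def 2 carc_swap[OF ring_norm[OF i]] .
    next
      case 3
      then show ?thesis using compact_rarc[OF i]
        by (intro eventually_not_closed_dirf compact_imp_closed)
    qed
  qed
  then have "eventually (\<lambda>z. \<forall>i\<in>{..<n}. z \<notin> rarc n P C i) (dirf (P k) d)"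
    by (intro eventually_ball_finite) auto
  then show ?thesis by eventually_elim (auto simp: rcurve_def)
qed

text \<open>The directions strictly between \<open>\<alpha> i\<close> and \<open>2 * pi\<close> form
  one interval without tangents, so one ray per vertex that misses the curve is enough, by
  \<open>sector_not_inside\<close>.\<close>

lemma ring_ext_from_rays:
  assumes \<alpha>: "\<And>i. i < n \<Longrightarrow> 0 < \<alpha> i"
    and ray: "\<And>i. i < n \<Longrightarrow> \<exists>\<xi>. \<alpha> i < \<xi> \<and> \<xi> < 2 * pi \<and>
        (\<forall>t>0. P i + of_real t * (rout n P C i * cis \<xi>) \<notin> rcurve n P C)"
  shows "ring_ext n \<alpha> P C"
  unfolding ring_ext_def
proof (intro allI impI, elim conjE)
  fix i \<phi> assume i: "i < n" and \<phi>: "\<alpha> i < \<phi>" "\<phi> < 2 * pi"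
  obtain \<xi> where \<xi>: "\<alpha> i < \<xi>" "\<xi> < 2 * pi" "\<And>t. t > 0 \<Longrightarrow> P i + of_real t * (rout n P C i * cis \<xi>) \<notin> rcurve n P C"
    using ray[OF i] by blast
  \<comment> \<open>The closed interval \<open>{a..b}\<close> holds both \<open>\<phi>\<close> and
    \<open>\<xi>\<close>, with \<open>\<phi>\<close> in its interior, and stays clear of the two
    tangents.\<close>
  obtain a where a: "\<alpha> i < a" "a < min \<phi> \<xi>" using dense[of "\<alpha> i" "min \<phi> \<xi>"] \<phi> \<xi> by auto
  obtain b where b: "max \<phi> \<xi> < b" "b < 2 * pi" using dense[of "max \<phi> \<xi>" "2 * pi"] \<phi> \<xi> by auto
  show "eventually (\<lambda>z. z \<notin> inside (rcurve n P C)) (dirf (P i) (rout n P C i * cis \<phi>))"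
  proof (rule sector_not_inside[where a = a and b = b and \<xi> = \<xi>])
    fix x assume x: "a \<le> x" "x \<le> b"
    have r0: "rout n P C i \<noteq> 0" using norm_rout[OF i] by auto
    have "cis x \<noteq> 1" using x a b \<alpha>[OF i] by (intro cis_neq_1) auto
    moreover have "cis x \<noteq> cis (\<alpha> i)" using x a b \<alpha>[OF i] by (intro cis_neq) auto
    ultimately show "eventually (\<lambda>z. z \<notin> rcurve n P C) (dirf (P i) (rout n P C i * cis x))"
      using r0 by (intro ring_eventually_not_rcurve i) auto
  qed (use norm_rout[OF i] \<xi> a b in auto)
qed

end

text \<open>For \<open>0 \<le> \<eta> < pi / 2\<close>, the vectors of argument at most
  \<open>\<eta>\<close> in absolute value, together with \<open>0\<close>. Products instead of a
  slope make sums and positive multiples easy.\<close>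

definition rcone :: "real \<Rightarrow> complex set" where
  "rcone \<eta> = {d. 0 \<le> Re d \<and> \<bar>Im d\<bar> * cos \<eta> \<le> Re d * sin \<eta>}"

text \<open>Vectors that go down more steeply than every vector of \<open>rcone \<eta>\<close> or
  its negative: from a point of a graph with slopes in \<open>rcone \<eta>\<close> they lead
  strictly below the graph.\<close>

definition dcone :: "real \<Rightarrow> complex set" where
  "dcone \<eta> = {d. \<bar>Re d\<bar> * sin \<eta> < - Im d * cos \<eta>}"

lemma rcone_0 [simp]: "0 \<in> rcone \<eta>" unfolding rcone_def by simp

lemma rcone_add:
  assumes "0 \<le> \<eta>" "\<eta> < pi / 2" "x \<in> rcone \<eta>" "y \<in> rcone \<eta>"
  shows "x + y \<in> rcone \<eta>"
proof -
  have "cos \<eta> > 0" using assms by (intro cos_gt_zero_pi) auto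
  then have "\<bar>Im x + Im y\<bar> * cos \<eta> \<le> (\<bar>Im x\<bar> + \<bar>Im y\<bar>) * cos \<eta>"
    by (intro mult_right_mono) auto
  with assms show ?thesis unfolding rcone_def by (auto simp: algebra_simps)
qed

lemma rcone_scale: "x \<in> rcone \<eta> \<Longrightarrow> 0 \<le> r \<Longrightarrow> of_real r * x \<in> rcone \<eta>"
  unfolding rcone_def by (auto simp: abs_mult mult.assoc intro: mult_left_mono)

lemma cis_in_rcone:
  assumes "\<bar>x\<bar> \<le> \<eta>" "\<eta> < pi / 2"
  shows "cis x \<in> rcone \<eta>"
proof -
  have "0 \<le> sin (\<eta> - \<bar>x\<bar>)" using assms by (intro sin_ge_zero) auto
  then have "sin \<bar>x\<bar> * cos \<eta> \<le> cos \<bar>x\<bar> * sin \<eta>" by (simp add: sin_diff mult.commute)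
  moreover have "sin \<bar>x\<bar> = \<bar>sin x\<bar>" using assms sin_ge_zero[of "\<bar>x\<bar>"] by (auto simp: abs_if split: if_splits)
  moreover have "0 \<le> cos x" using assms by (intro cos_ge_zero) auto
  ultimately show ?thesis unfolding rcone_def by simp
qed

text \<open>With \<open>rcone_add\<close>, this makes "the difference lies in
  \<open>rcone \<eta>\<close>" a partial order of the plane, along which the chain will run.\<close>

lemma rcone_antisym:
  assumes "0 \<le> \<eta>" "\<eta> < pi / 2" "x \<in> rcone \<eta>" "- x \<in> rcone \<eta>"
  shows "x = 0"
proof -
  have "cos \<eta> > 0" using assms by (intro cos_gt_zero_pi) auto
  moreover have "Re x = 0" using assms unfolding rcone_def by auto
  ultimately show ?thesis using assms unfolding rcone_def
    by (auto simp: complex_eq_iff mult_le_0_iff)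
qed

lemma rcone_sgn:
  assumes "0 \<le> \<eta>" "\<eta> < pi / 2" "x \<in> rcone \<eta>" "x \<noteq> 0"
  shows "\<exists>\<phi>. \<bar>\<phi>\<bar> \<le> \<eta> \<and> sgn x = cis \<phi>"
proof (intro exI[of _ "Arg x"] conjI)
  have cos: "cos \<eta> > 0" using assms by (intro cos_gt_zero_pi) auto
  have "Re x \<noteq> 0"
  proof
    assume "Re x = 0"
    then show False using assms(3,4) cos unfolding rcone_def by (auto simp: complex_eq_iff mult_le_0_iff)
  qed
  then have "Re x > 0" using assms unfolding rcone_def by auto
  then have a: "\<bar>Arg x\<bar> < pi / 2" using Arg_Re_pos[of x] by auto
  define r where "r = norm x"
  have r: "r > 0" using assms unfolding r_def by auto
  have x: "Re x = r * cos (Arg x)" "Im x = r * sin (Arg x)"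
    using assms(4) unfolding r_def by (metis Arg_eq rcis_def Re_rcis Im_rcis rcis_cmod_Arg)+
  have "r * (\<bar>sin (Arg x)\<bar> * cos \<eta>) \<le> r * (cos (Arg x) * sin \<eta>)"
    using assms(3) r unfolding rcone_def mem_Collect_eq x by (simp add: abs_mult mult.assoc)
  then have le: "\<bar>sin (Arg x)\<bar> * cos \<eta> \<le> cos (Arg x) * sin \<eta>" using r by simp
  have "sin \<bar>Arg x\<bar> = \<bar>sin (Arg x)\<bar>" using a sin_ge_zero[of "\<bar>Arg x\<bar>"] by (auto simp: abs_if split: if_splits)
  then have "sin (\<bar>Arg x\<bar> - \<eta>) \<le> 0" using le by (simp add: sin_diff mult.commute)
  then show "\<bar>Arg x\<bar> \<le> \<eta>" using a assms sin_gt_zero[of "\<bar>Arg x\<bar> - \<eta>"] by force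
  show "sgn x = cis (Arg x)" using assms by (simp add: cis_Arg)
qed

lemma dcone_not_rcone:
  assumes "0 \<le> \<eta>" "\<eta> < pi / 2" "d \<in> dcone \<eta>"
  shows "d \<notin> rcone \<eta>" "- d \<notin> rcone \<eta>"
proof -
  have "cos \<eta> > 0" using assms by (intro cos_gt_zero_pi) auto
  then have le: "- Im d * cos \<eta> \<le> \<bar>Im d\<bar> * cos \<eta>" by (intro mult_right_mono) auto
  show "d \<notin> rcone \<eta>" using le assms(3) unfolding rcone_def dcone_def by auto
  show "- d \<notin> rcone \<eta>" using le assms(3) unfolding rcone_def dcone_def by auto
qed

lemma dcone_scale: "d \<in> dcone \<eta> \<Longrightarrow> 0 < r \<Longrightarrow> of_real r * d \<in> dcone \<eta>"
proof -
  assume d: "d \<in> dcone \<eta>" and r: "0 < r"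
  then have "r * (\<bar>Re d\<bar> * sin \<eta>) < r * (- Im d * cos \<eta>)" unfolding dcone_def
    by (intro mult_strict_left_mono) auto
  with r show ?thesis unfolding dcone_def by (simp add: abs_mult mult.assoc)
qed

lemma dcone_sgn:
  assumes "0 \<le> \<eta>" "\<eta> < pi / 2" "d \<in> dcone \<eta>"
  shows "\<exists>\<omega>. - pi + \<eta> < \<omega> \<and> \<omega> < - \<eta> \<and> sgn d = cis \<omega>"
proof -
  \<comment> \<open>Multiplication by \<open>\<i>\<close> turns the downward axis into the positive
    real axis, around which \<open>Arg\<close> is symmetric.\<close>
  define x where "x = \<i> * d"
  have x0: "x \<noteq> 0" using assms(3) unfolding x_def dcone_def by auto
  have cos: "cos \<eta> > 0" using assms by (intro cos_gt_zero_pi) auto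
  have lt: "\<bar>Im x\<bar> * sin \<eta> < Re x * cos \<eta>" using assms(3) unfolding x_def dcone_def by simp
  moreover have "sin \<eta> \<ge> 0" using assms by (intro sin_ge_zero) auto
  ultimately have "0 < Re x * cos \<eta>" by (meson abs_ge_zero mult_nonneg_nonneg order_le_less_trans)
  then have "Re x > 0" using cos by (simp add: zero_less_mult_iff)
  then have a: "\<bar>Arg x\<bar> < pi / 2" using Arg_Re_pos[of x] by auto
  define r where "r = norm x"
  have r: "r > 0" using x0 unfolding r_def by auto
  have x: "Re x = r * cos (Arg x)" "Im x = r * sin (Arg x)"
    using x0 unfolding r_def by (metis Arg_eq rcis_def Re_rcis Im_rcis rcis_cmod_Arg)+
  have "r * (\<bar>sin (Arg x)\<bar> * sin \<eta>) < r * (cos (Arg x) * cos \<eta>)"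
    using lt r unfolding x by (simp add: abs_mult mult.assoc)
  then have "\<bar>sin (Arg x)\<bar> * sin \<eta> < cos (Arg x) * cos \<eta>" using r by simp
  moreover have "sin \<bar>Arg x\<bar> = \<bar>sin (Arg x)\<bar>" using a sin_ge_zero[of "\<bar>Arg x\<bar>"] by (auto simp: abs_if split: if_splits)
  ultimately have "0 < cos (\<bar>Arg x\<bar> + \<eta>)" by (simp add: cos_add)
  moreover have "cos (\<bar>Arg x\<bar> + \<eta>) \<le> 0" if "pi / 2 \<le> \<bar>Arg x\<bar> + \<eta>"
  proof -
    have "cos (\<bar>Arg x\<bar> + \<eta>) \<le> cos (pi / 2)"
      using that a assms by (intro cos_monotone_0_pi_le) auto
    then show ?thesis by simp
  qed
  ultimately have "\<bar>Arg x\<bar> + \<eta> < pi / 2" by force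
  moreover have "sgn d = cis (Arg x - pi / 2)"
  proof -
    have "d = - \<i> * x" unfolding x_def by simp
    then have "sgn d = - \<i> * cis (Arg x)" using x0 by (simp add: sgn_mult cis_Arg sgn_minus sgn_div_norm[of \<i>])
    also have "\<dots> = cis (- (pi / 2)) * cis (Arg x)" by (simp add: cis.ctr complex_eq_iff)
    also have "\<dots> = cis (Arg x - pi / 2)" unfolding cis_mult by (simp add: add.commute)
    finally show ?thesis .
  qed
  ultimately show ?thesis by (intro exI[of _ "Arg x - pi / 2"]) auto
qed

text \<open>Every chord of the arc, oriented forwards, is a nonnegative combination of the initial
  tangent vector \<open>(b - a) * c\<close>, the vector \<open>b - a\<close> and the final tangent
  vector \<open>(b - a) * cnj c\<close>. The coefficients in \<open>w\<close> come from expanding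
  \<open>c * cnj d1 * cnj d2\<close> with \<open>c * cnj c = 1\<close>.\<close>

lemma cpt_diff_in_rcone:
  assumes \<eta>: "0 \<le> \<eta>" "\<eta> < pi / 2" and c: "norm c = 1" "c \<noteq> -1"
    and in_cone: "(b - a) * c \<in> rcone \<eta>" "b - a \<in> rcone \<eta>" "(b - a) * cnj c \<in> rcone \<eta>"
    and s: "0 \<le> s1" "s1 \<le> s2" "s2 \<le> 1"
  shows "cpt a b c s2 - cpt a b c s1 \<in> rcone \<eta>"
proof -
  define d1 d2 where "d1 = of_real (1 - s1) + of_real s1 * c" and "d2 = of_real (1 - s2) + of_real s2 * c"
  have d: "d1 \<noteq> 0" "d2 \<noteq> 0" unfolding d1_def d2_def using cpt_denom_nonzero[OF c] s by auto
  have cc: "c * cnj c = 1" using c complex_norm_square[of c] by simp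
  define w where "w = of_real ((1 - s1) * (1 - s2)) * ((b - a) * c)
    + of_real (s1 * (1 - s2) + s2 * (1 - s1)) * (b - a) + of_real (s1 * s2) * ((b - a) * cnj c)"
  have w: "w \<in> rcone \<eta>"
    unfolding w_def using s by (intro rcone_add[OF \<eta>] rcone_scale in_cone) auto
  have "w = (b - a) * (c * cnj d1 * cnj d2)"
  proof -
    have "c * cnj d1 * cnj d2 = of_real ((1 - s1) * (1 - s2)) * c
      + of_real (s1 * (1 - s2) + s2 * (1 - s1)) * (c * cnj c) + of_real (s1 * s2) * ((c * cnj c) * cnj c)"
      unfolding d1_def d2_def by (simp add: algebra_simps)
    then have e: "c * cnj d1 * cnj d2 = of_real ((1 - s1) * (1 - s2)) * c
      + of_real (s1 * (1 - s2) + s2 * (1 - s1)) + of_real (s1 * s2) * cnj c"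
      unfolding cc by simp
    show ?thesis unfolding w_def e by (simp add: algebra_simps)
  qed
  moreover have "cpt a b c s2 - cpt a b c s1 = (b - a) * c * of_real (s2 - s1) / (d1 * d2)"
    unfolding cpt_def d1_def[symmetric] d2_def[symmetric] using d
    by (simp add: divide_simps) (simp add: d1_def d2_def algebra_simps)
  moreover have "1 / (d1 * d2) = cnj d1 * cnj d2 / of_real ((norm d1)\<^sup>2 * (norm d2)\<^sup>2)"
  proof -
    have "of_real ((norm d1)\<^sup>2 * (norm d2)\<^sup>2) = d1 * cnj d1 * (d2 * cnj d2)"
      by (simp only: of_real_mult complex_norm_square)
    then show ?thesis using d by simp
  qed
  ultimately have "cpt a b c s2 - cpt a b c s1 = of_real ((s2 - s1) / ((norm d1)\<^sup>2 * (norm d2)\<^sup>2)) * w"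
    by (simp add: divide_inverse mult_ac)
  then show ?thesis using s by (simp only:) (intro rcone_scale w, simp)
qed

lemma carc_rcone:
  assumes "0 \<le> \<eta>" "\<eta> < pi / 2" and c: "norm c = 1" "c \<noteq> -1"
    and "(b - a) * c \<in> rcone \<eta>" "b - a \<in> rcone \<eta>" "(b - a) * cnj c \<in> rcone \<eta>"
    and z: "z \<in> carc a b c"
  shows "z - a \<in> rcone \<eta>" "b - z \<in> rcone \<eta>"
proof -
  obtain s where s: "0 \<le> s" "s \<le> 1" "z = cpt a b c s"
    using z unfolding carc_eq_image[OF c] by auto
  have ends: "a = cpt a b c 0" "b = cpt a b c 1" using c unfolding cpt_def by auto
  show "z - a \<in> rcone \<eta>"
    using cpt_diff_in_rcone[OF assms(1-7), of 0 s] s unfolding ends(1)[symmetric] by simp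
  show "b - z \<in> rcone \<eta>"
    using cpt_diff_in_rcone[OF assms(1-7), of s 1] s unfolding ends(2)[symmetric] by simp
qed

text \<open>Inversion sends infinity to \<open>0\<close>, so an arc that ends at \<open>0\<close>
  comes from a ray. The value of \<open>t\<close> is the arc parameter \<open>s / (1 - s)\<close>
  rescaled by the distance from \<open>p\<close> to \<open>q\<close>.\<close>

lemma ray_arc:
  assumes p: "p \<noteq> q" and d: "norm d = 1" and z: "z \<in> carc (1 / (p - q)) 0 (sgn (d / (p - q)))" "z \<noteq> 0"
  shows "\<exists>t\<ge>0. 1 / z + q = p + of_real t * d"
proof -
  obtain s where s: "0 \<le> s" "s \<le> 1"
    and eq: "of_real (1 - s) * (z - 1 / (p - q)) = of_real s * sgn (d / (p - q)) * (0 - z)"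
    using z unfolding carc_def by blast
  have d0: "d \<noteq> 0" using d by auto
  have s1: "s \<noteq> 1" using eq z(2) p d0 by (auto simp: sgn_zero_iff)
  define t where "t = s / (1 - s) * norm (p - q)"
  have sg: "sgn (d / (p - q)) = of_real (norm (p - q)) * d / (p - q)"
    using d by (simp add: sgn_eq norm_divide)
  define w where "w = p - q"
  have w: "w \<noteq> 0" using p unfolding w_def by simp
  have "w * (of_real (1 - s) * (z * w - 1)) = w * (- of_real (s * norm w) * d * z)"
    using eq w unfolding w_def[symmetric] sg[folded w_def] by (simp add: field_simps)
  then have "of_real (1 - s) * (z * w - 1) = - of_real (s * norm w) * d * z"
    unfolding mult_left_cancel[OF w] .
  then have "of_real (1 - s) * w + of_real (s * norm w) * d = of_real (1 - s) / z"
    using z(2) by (simp add: field_simps)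
  then have "of_real (1 - s) * (p - q) + of_real (s * norm (p - q)) * d = of_real (1 - s) / z"
    unfolding w_def .
  moreover have s1c: "(of_real (1 - s) :: complex) \<noteq> 0" using s1 by (simp del: of_real_diff)
  then have "(p - q) + of_real t * d
      = (of_real (1 - s) * (p - q) + of_real (s * norm (p - q)) * d) / of_real (1 - s)"
    unfolding t_def by (simp add: add_divide_distrib del: of_real_diff)
  ultimately have "(p - q) + of_real t * d = 1 / z"
    using s1c by (simp del: of_real_diff)
  then show ?thesis using s s1 unfolding t_def by (intro exI[of _ t]) (auto simp: t_def algebra_simps)
qed

interpretation reciprocal: moebius "\<lambda>z. 1 / (z - q)" "\<lambda>z. z - q" 1 "- q" "-1" for q
  by unfold_locales (auto simp: field_simps)

text \<open>Vertex \<open>0\<close>, with the largest turning angle \<open>\<gamma> 0 = pi - \<alpha> 0\<close>, is at infinity and the enclosed region is above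
  the chain. At \<open>Q i\<close> the chain arrives in direction \<open>\<zeta> i\<close> and leaves in direction \<open>\<theta> i\<close>; both lie in
  \<open>{- \<eta>..\<eta>}\<close> because \<open>\<gamma> i \<le> 2 * \<eta>\<close>.\<close>

locale chain =
  fixes n :: nat and \<gamma> :: "nat \<Rightarrow> real" and \<eta> :: real
  assumes n: "3 \<le> n" and \<eta>: "0 \<le> \<eta>" "\<eta> < pi / 2" and \<gamma>0: "\<gamma> 0 = 2 * \<eta>"
    and \<gamma>: "i < n \<Longrightarrow> 0 \<le> \<gamma> i \<and> \<gamma> i \<le> 2 * \<eta>"
begin

definition N where "N = n - 1"

text \<open>The turning \<open>\<gamma> i\<close> is split evenly between arrival and departure,
  except at the two ends, where the direction of the adjacent ray is prescribed:
  \<open>\<zeta> 1 = - \<eta>\<close> and \<open>\<theta> N = \<eta>\<close>. Thus the rays meet at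
  infinity with turning angle \<open>2 * \<eta> = \<gamma> 0\<close>.\<close>

definition \<theta> where "\<theta> i = (if i = 1 then \<gamma> 1 - \<eta> else if i = N then \<eta> else \<gamma> i / 2)"

definition \<zeta> where "\<zeta> i = \<theta> i - \<gamma> i"

text \<open>Chord and tangents of a circular arc make equal angles at both ends, so the chord has
  the mean of the directions \<open>\<theta> j\<close> and \<open>\<zeta> (Suc j)\<close>. All
  chords get length 1; any lengths would do, since nothing has to close up.\<close>

definition Q :: "nat \<Rightarrow> complex" where "Q i = (\<Sum>j\<in>{1..<i}. cis ((\<theta> j + \<zeta> (Suc j)) / 2))"

definition c where "c i = cis ((\<theta> i - \<zeta> (Suc i)) / 2)"

text \<open>The arcs before inversion. The first ray arrives at \<open>Q 1\<close> from infinity in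
  direction \<open>- \<eta>\<close>, hence the minus sign of its outward vector.\<close>

definition piece where
  "piece i = (if i = 0 then (\<lambda>t. Q 1 + of_real t * (- cis (- \<eta>))) ` {0..}
    else if i = N then (\<lambda>t. Q N + of_real t * cis \<eta>) ` {0..}
    else carc (Q i) (Q (Suc i)) (c i))"

lemma N: "2 \<le> N" "n = Suc N" using n unfolding N_def by auto

lemma \<theta>_bound: "1 \<le> i \<Longrightarrow> i \<le> N \<Longrightarrow> \<bar>\<theta> i\<bar> \<le> \<eta>"
  using \<gamma>[of 1] \<gamma>[of i] \<eta> N unfolding \<theta>_def by auto

lemma \<zeta>_bound: "1 \<le> i \<Longrightarrow> i \<le> N \<Longrightarrow> \<bar>\<zeta> i\<bar> \<le> \<eta>"
  using \<gamma>[of 1] \<gamma>[of i] \<eta> N unfolding \<zeta>_def \<theta>_def by auto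

lemma cis_\<theta>: "1 \<le> i \<Longrightarrow> i \<le> N \<Longrightarrow> cis (\<theta> i) \<in> rcone \<eta>"
  using \<theta>_bound \<eta> by (intro cis_in_rcone)

lemma cis_\<zeta>: "1 \<le> i \<Longrightarrow> i \<le> N \<Longrightarrow> cis (\<zeta> i) \<in> rcone \<eta>"
  using \<zeta>_bound \<eta> by (intro cis_in_rcone)

lemma \<theta>_N: "\<theta> N = \<eta>" using N unfolding \<theta>_def by simp

lemma Q_Suc: "1 \<le> i \<Longrightarrow> Q (Suc i) - Q i = cis ((\<theta> i + \<zeta> (Suc i)) / 2)"
  unfolding Q_def by simp

lemma Q_Suc_c: "1 \<le> i \<Longrightarrow> (Q (Suc i) - Q i) * c i = cis (\<theta> i)"
  "1 \<le> i \<Longrightarrow> (Q (Suc i) - Q i) * cnj (c i) = cis (\<zeta> (Suc i))"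
  unfolding Q_Suc c_def by (auto simp: cis_mult cis_cnj field_simps)

lemma Q_step: "1 \<le> i \<Longrightarrow> i < N \<Longrightarrow> Q (Suc i) - Q i \<in> rcone \<eta>"
  unfolding Q_Suc using \<theta>_bound[of i] \<zeta>_bound[of "Suc i"] \<eta> by (intro cis_in_rcone) auto

lemma Q_mono: "1 \<le> i \<Longrightarrow> i \<le> j \<Longrightarrow> j \<le> N \<Longrightarrow> Q j - Q i \<in> rcone \<eta>"
proof (induction j)
  case (Suc j)
  show ?case
  proof (cases "i = Suc j")
    case False
    then have "Q j - Q i \<in> rcone \<eta>" "Q (Suc j) - Q j \<in> rcone \<eta>"
      using Suc Q_step[of j] by auto
    then show ?thesis using rcone_add[OF \<eta>] by fastforce
  qed simp
qed simp

lemma Q_neq: assumes "1 \<le> i" "i < j" "j \<le> N" shows "Q i \<noteq> Q j"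
proof
  assume eq: "Q i = Q j"
  have "- (Q (Suc i) - Q i) \<in> rcone \<eta>"
    using Q_mono[of "Suc i" j] assms eq by simp
  then have "Q (Suc i) - Q i = 0"
    using rcone_antisym[OF \<eta> Q_step[of i]] assms by simp
  then show False using Q_Suc[of i] assms by simp
qed

lemma c_norm: "norm (c i) = 1" unfolding c_def by simp

lemma c_ne: assumes "1 \<le> i" "i < N" shows "c i \<noteq> -1"
proof -
  have "cos ((\<theta> i - \<zeta> (Suc i)) / 2) > 0"
    using \<theta>_bound[of i] \<zeta>_bound[of "Suc i"] assms \<eta> by (intro cos_gt_zero_pi) auto
  then show ?thesis unfolding c_def by (auto simp: complex_eq_iff)
qed

lemma piece_ge: assumes "1 \<le> i" "i \<le> N" "z \<in> piece i" shows "z - Q i \<in> rcone \<eta>"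
proof (cases "i = N")
  case True
  then show ?thesis using assms N \<eta> unfolding piece_def
    by (auto intro!: rcone_scale cis_in_rcone)
next
  case False
  then have "z \<in> carc (Q i) (Q (Suc i)) (c i)" using assms unfolding piece_def by auto
  then show ?thesis
    using carc_rcone(1)[OF \<eta> c_norm c_ne, of i "Q (Suc i)" "Q i"] assms False Q_step[of i] Q_Suc_c[of i]
      cis_\<theta>[of i] cis_\<zeta>[of "Suc i"] by auto
qed

lemma piece_le: assumes "i < N" "z \<in> piece i" shows "Q (Suc i) - z \<in> rcone \<eta>"
proof (cases "i = 0")
  case True
  have "of_real t * cis (- \<eta>) \<in> rcone \<eta>" if "t \<ge> 0" for t
    using that \<eta> by (intro rcone_scale cis_in_rcone) auto
  then show ?thesis using True assms unfolding piece_def by (auto)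
next
  case False
  then have "z \<in> carc (Q i) (Q (Suc i)) (c i)" using assms unfolding piece_def by auto
  then show ?thesis
    using carc_rcone(2)[OF \<eta> c_norm c_ne, of i "Q (Suc i)" "Q i"] assms False Q_step[of i] Q_Suc_c[of i]
      cis_\<theta>[of i] cis_\<zeta>[of "Suc i"] by auto
qed

text \<open>Each point of the chain precedes or follows each vertex in the order given by
  \<open>rcone \<eta>\<close>, so it is never steeply below the vertex. Every later avoidance
  argument goes through this fact.\<close>

lemma piece_comparable:
  assumes "i \<le> N" "1 \<le> j" "j \<le> N" "z \<in> piece i"
  shows "z - Q j \<notin> dcone \<eta>"
proof (cases "j \<le> i")
  case True
  have "z - Q j = (z - Q i) + (Q i - Q j)" by simp
  also have "\<dots> \<in> rcone \<eta>" using assms True by (intro rcone_add[OF \<eta>] piece_ge Q_mono) auto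
  finally show ?thesis using dcone_not_rcone[OF \<eta>] by blast
next
  case False
  have "- (z - Q j) = (Q (Suc i) - z) + (Q j - Q (Suc i))" by simp
  also have "\<dots> \<in> rcone \<eta>" using assms False by (intro rcone_add[OF \<eta>] piece_le Q_mono) auto
  finally show ?thesis using dcone_not_rcone[OF \<eta>] by blast
qed

text \<open>A common point would lie both before and after the vertices between the two pieces;
  antisymmetry collapses them to one vertex.\<close>

lemma piece_disj:
  assumes "i < j" "j \<le> N" "z \<in> piece i" "z \<in> piece j"
  shows "j = Suc i \<and> z = Q j"
proof -
  have 1: "Q (Suc i) - z \<in> rcone \<eta>" "Q j - Q (Suc i) \<in> rcone \<eta>" "z - Q j \<in> rcone \<eta>"
    using assms by (auto intro: piece_le Q_mono piece_ge)
  have "- (z - Q j) \<in> rcone \<eta>"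
    using rcone_add[OF \<eta> 1(1,2)] by simp
  then have z: "z = Q j" using rcone_antisym[OF \<eta> 1(3)] by simp
  then have "- (Q j - Q (Suc i)) \<in> rcone \<eta>" using 1(1) by simp
  then have "Q j = Q (Suc i)" using rcone_antisym[OF \<eta> 1(2)] by simp
  then show ?thesis using Q_neq[of "Suc i" j] assms z by (cases "Suc i < j") auto
qed

text \<open>Far enough down the imaginary axis a point is steeply below each of the finitely many
  vertices.\<close>

lemma exists_q: "\<exists>q. \<forall>i\<in>{1..N}. q - Q i \<in> dcone \<eta>"
proof -
  have cos: "cos \<eta> > 0" using \<eta> by (intro cos_gt_zero_pi) auto
  have "eventually (\<lambda>T. \<forall>i\<in>{1..N}. of_real T * (- \<i>) - Q i \<in> dcone \<eta>) at_top"
  proof (rule eventually_ball_finite)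
    show "\<forall>i\<in>{1..N}. eventually (\<lambda>T. of_real T * (- \<i>) - Q i \<in> dcone \<eta>) at_top"
    proof
      fix i
      show "eventually (\<lambda>T. of_real T * (- \<i>) - Q i \<in> dcone \<eta>) at_top"
        using eventually_gt_at_top[of "\<bar>Re (Q i)\<bar> * sin \<eta> / cos \<eta> - Im (Q i)"]
        by eventually_elim (use cos in \<open>auto simp: dcone_def field_simps\<close>)
    qed
  qed simp
  then show ?thesis by (auto dest!: eventually_happens)
qed

definition q where "q = (SOME q. \<forall>i\<in>{1..N}. q - Q i \<in> dcone \<eta>)"

lemma q: "1 \<le> i \<Longrightarrow> i \<le> N \<Longrightarrow> q - Q i \<in> dcone \<eta>"
  using someI_ex[OF exists_q] unfolding q_def by auto

lemma q_notin_piece: "i \<le> N \<Longrightarrow> q \<notin> piece i"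
  using piece_comparable[of i 1 q] q[of 1] N by auto

lemma Q_q: "1 \<le> i \<Longrightarrow> i \<le> N \<Longrightarrow> Q i - q \<noteq> 0"
  using q[of i] dcone_not_rcone(1)[OF \<eta>, of 0] by auto

text \<open>Images under \<open>z \<mapsto> 1 / (z - q)\<close>; vertex \<open>0\<close>, at
  infinity before, goes to \<open>0\<close>. In \<open>C\<close>, the arc with index
  \<open>0\<close> starts at this point, so its value is the conjugate of the one that
  \<open>ray_arc\<close> gives for the opposite orientation.\<close>

definition P where "P i = (if i = 0 then 0 else 1 / (Q i - q))"

definition C where
  "C i = (if i = 0 then cnj (sgn (- cis (- \<eta>) / (Q 1 - q)))
     else if i = N then sgn (cis \<eta> / (Q N - q))
     else reciprocal.twist q (Q i) (Q (Suc i)) (c i))"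

lemma Suc_mod: "i < n \<Longrightarrow> (i + 1) mod n = (if i = N then 0 else Suc i)"
  using N by auto

text \<open>The value \<open>-1\<close> would put the centre \<open>q\<close> of the inversion on
  the ray, at distance \<open>norm (p - q)\<close> from its start.\<close>

lemma ray_ne_minus_1:
  assumes p: "p - q \<noteq> 0" and d: "norm d = 1" and nq: "\<And>t. t \<ge> 0 \<Longrightarrow> p + of_real t * d \<noteq> q"
  shows "sgn (d / (p - q)) \<noteq> -1"
proof
  assume "sgn (d / (p - q)) = -1"
  then have "of_real (norm (p - q)) * d / (p - q) = -1"
    using d by (simp add: sgn_eq norm_divide mult.commute)
  then have "p + of_real (norm (p - q)) * d = q" using p by (simp add: field_simps)
  then show False using nq[of "norm (p - q)"] by simp
qed

lemma C_norm: "i < n \<Longrightarrow> norm (C i) = 1"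
  using Q_q[of 1] Q_q[of N] Q_q[of i] Q_q[of "Suc i"] N c_norm
  by (auto simp: C_def norm_sgn norm_divide intro!: reciprocal.norm_twist)

lemma inner_piece_nz: "1 \<le> i \<Longrightarrow> i < N \<Longrightarrow> z \<in> carc (Q i) (Q (Suc i)) (c i) \<Longrightarrow> z - q \<noteq> 0"
  using q_notin_piece[of i] unfolding piece_def by auto

lemma C_ne: assumes "i < n" shows "C i \<noteq> -1"
proof -
  consider "i = 0" | "i = N" "i \<noteq> 0" | "1 \<le> i" "i < N" using assms N by linarith
  then show ?thesis
  proof cases
    case 1
    have "Q 1 + of_real t * (- cis (- \<eta>)) \<in> piece 0" if "t \<ge> 0" for t
      unfolding piece_def using that by auto
    from this have "Q 1 + of_real t * (- cis (- \<eta>)) \<noteq> q" if "t \<ge> 0" for t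
      using q_notin_piece[of 0] that by (metis zero_le)
    then have "sgn (- cis (- \<eta>) / (Q 1 - q)) \<noteq> -1"
      using N Q_q[of 1] by (intro ray_ne_minus_1) auto
    then show ?thesis unfolding C_def using 1 by (metis complex_cnj_cnj complex_cnj_minus complex_cnj_one)
  next
    case 2
    have "Q N + of_real t * cis \<eta> \<in> piece N" if "t \<ge> 0" for t
      unfolding piece_def using that 2 by auto
    from this have "Q N + of_real t * cis \<eta> \<noteq> q" if "t \<ge> 0" for t
      using q_notin_piece[of N] that by (metis order_refl)
    then have "sgn (cis \<eta> / (Q N - q)) \<noteq> -1"
      using N Q_q[of N] by (intro ray_ne_minus_1) auto
    then show ?thesis unfolding C_def using 2 by simp
  next
    case 3
    then show ?thesis
      unfolding C_def using reciprocal.twist_ne[OF c_norm c_ne inner_piece_nz] by auto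
  qed
qed

lemma inner_rarc:
  assumes "1 \<le> i" "i < N"
  shows "rarc n P C i = (\<lambda>z. 1 / (z - q)) ` carc (Q i) (Q (Suc i)) (c i)"
proof -
  have "(\<lambda>z. 1 / (z - q)) ` carc (Q i) (Q (Suc i)) (c i) =
      carc (1 / (Q i - q)) (1 / (Q (Suc i) - q)) (reciprocal.twist q (Q i) (Q (Suc i)) (c i))"
    by (rule reciprocal.image_carc) (use c_norm c_ne inner_piece_nz assms in auto)
  then show ?thesis
    using assms Suc_mod[of i] N unfolding rarc_def P_def C_def by simp
qed

lemma rarc_subset_piece:
  assumes "i < n" "z \<in> rarc n P C i" "z \<noteq> 0"
  shows "1 / z + q \<in> piece i"
proof -
  consider "i = 0" | "i = N" "i \<noteq> 0" | "1 \<le> i" "i < N" using assms N by linarith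
  then show ?thesis
  proof cases
    case 1
    have "z \<in> carc 0 (1 / (Q 1 - q)) (cnj (sgn (- cis (- \<eta>) / (Q 1 - q))))"
      using assms(2) 1 N unfolding rarc_def P_def C_def by simp
    moreover have "norm (sgn (- cis (- \<eta>) / (Q 1 - q))) = 1"
      unfolding norm_sgn using Q_q[of 1] N by simp
    ultimately have "z \<in> carc (1 / (Q 1 - q)) 0 (sgn (- cis (- \<eta>) / (Q 1 - q)))"
      using carc_swap by blast
    then show ?thesis
      using ray_arc[of "Q 1" q "- cis (- \<eta>)" z] Q_q[of 1] N assms(3) 1 unfolding piece_def by auto
  next
    case 2
    have "z \<in> carc (1 / (Q N - q)) 0 (sgn (cis \<eta> / (Q N - q)))"
      using assms(1,2) 2 Suc_mod[of N] N unfolding rarc_def P_def C_def by simp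
    then show ?thesis
      using ray_arc[of "Q N" q "cis \<eta>" z] Q_q[of N] N assms(3) 2 unfolding piece_def by auto
  next
    case 3
    then show ?thesis using inner_rarc[of i] assms(2) unfolding piece_def by auto
  qed
qed

lemma zero_in_rarc:
  assumes "i < n" "0 \<in> rarc n P C i"
  shows "i = 0 \<or> i = N"
proof (rule ccontr)
  assume ni: "\<not> (i = 0 \<or> i = N)"
  then have i: "1 \<le> i" "i < N" using assms N by auto
  then show False using inner_rarc[OF i] inner_piece_nz[OF i] assms(2) by auto
qed

lemma P_inj: "inj_on P {..<n}"
proof -
  have "P i \<noteq> P j" if "i < j" "j < n" for i j
    using Q_q[of i] Q_q[of j] Q_neq[of i j] that N unfolding P_def by auto
  then show ?thesis unfolding inj_on_def by (metis lessThan_iff linorder_neqE_nat)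
qed

lemma rarc_disj:
  assumes "i < n" "j < n" "i < j"
  shows "rarc n P C i \<inter> rarc n P C j \<subseteq> P ` ({i, (i + 1) mod n} \<inter> {j, (j + 1) mod n})"
proof
  fix z assume z: "z \<in> rarc n P C i \<inter> rarc n P C j"
  show "z \<in> P ` ({i, (i + 1) mod n} \<inter> {j, (j + 1) mod n})"
  proof (cases "z = 0")
    case True
    \<comment> \<open>The point \<open>0\<close> is the image of infinity, where only the two rays
      meet.\<close>
    then have "i = 0 \<or> i = N" "j = 0 \<or> j = N" using z zero_in_rarc assms by auto
    then have "i = 0" "j = N" using assms N by auto
    then show ?thesis using True assms Suc_mod[of N] by (intro image_eqI[of _ _ 0]) (auto simp: P_def)
  next
    case False
    have "1 / z + q \<in> piece i" "1 / z + q \<in> piece j"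
      using rarc_subset_piece z False assms by auto
    then have j: "j = Suc i" "1 / z + q = Q j"
      using piece_disj[of i j] assms N by auto
    then have "Q j - q = 1 / z" by (metis add_diff_cancel_right')
    then have "z = P j" using j(1) unfolding P_def by simp
    then show ?thesis using j assms Suc_mod[of i] N by (intro image_eqI[of _ _ j]) auto
  qed
qed

text \<open>The direction of the derivative of the inversion at \<open>Q i\<close>: the common
  rotation of all tangents there.\<close>

definition \<tau> where "\<tau> i = sgn (- 1 / (Q i - q)\<^sup>2)"

lemma rout_eq:
  assumes "1 \<le> i" "i \<le> N"
  shows "rout n P C i = \<tau> i * cis (\<theta> i)"
proof (cases "i = N")
  case True
  have "rout n P C i = sgn (- (1 / (Q N - q))) * sgn (cis \<eta> / (Q N - q))"
    unfolding rout_def using True Suc_mod[of N] N by (simp add: P_def C_def)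
  also have "\<dots> = \<tau> N * cis \<eta>"
    unfolding \<tau>_def by (simp add: sgn_mult sgn_minus power2_eq_square)
  finally show ?thesis using True \<theta>_N by simp
next
  case False
  have "rout n P C i = sgn (1 / (Q (Suc i) - q) - 1 / (Q i - q)) * reciprocal.twist q (Q i) (Q (Suc i)) (c i)"
    unfolding rout_def using False assms Suc_mod[of i] N by (simp add: P_def C_def)
  also have "\<dots> = \<tau> i * (sgn (Q (Suc i) - Q i) * c i)"
    unfolding \<tau>_def using assms False Q_q[of i] Q_q[of "Suc i"] by (intro reciprocal.tangent_twist) auto
  also have "sgn (Q (Suc i) - Q i) = Q (Suc i) - Q i" unfolding Q_Suc[OF assms(1)] by (simp add: sgn_div_norm)
  also have "(Q (Suc i) - Q i) * c i = cis (\<theta> i)" using Q_Suc_c assms by auto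
  finally show ?thesis .
qed

text \<open>Far out on the first ray the point \<open>1 / (Q 1 - t * cis (- \<eta>) - q)\<close> has
  a direction close to \<open>- cis \<eta>\<close>, the tangent of its image at
  \<open>0\<close>.\<close>

lemma rout_0: "rout n P C 0 = - cis \<eta>"
proof -
  let ?u = "sgn (Q 1 - q)"
  have u: "?u * cnj ?u = 1" using Q_q[of 1] N complex_norm_square[of ?u] by (simp add: norm_sgn)
  have "rout n P C 0 = sgn (1 / (Q 1 - q)) * cnj (sgn (- cis (- \<eta>) / (Q 1 - q)))"
    unfolding rout_def using Suc_mod[of 0] N by (simp add: P_def C_def)
  also have "\<dots> = - cis \<eta> / (?u * cnj ?u)"
    by (simp add: sgn_minus cis_cnj)
  finally show ?thesis unfolding u by simp
qed

lemma turn: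
  assumes "i < n"
  shows "sgn (P i - P ((i + 1) mod n)) * cnj (C i) =
        cis (pi - \<gamma> ((i + 1) mod n)) * rout n P C ((i + 1) mod n)"
proof -
  consider "i = 0" | "i = N" "i \<noteq> 0" | "1 \<le> i" "i < N" using assms N by linarith
  then show ?thesis
  proof cases
    case 1
    have "sgn (P 0 - P 1) * cnj (C 0) = sgn (- (1 / (Q 1 - q))) * sgn (- cis (- \<eta>) / (Q 1 - q))"
      unfolding P_def C_def by simp
    also have "\<dots> = \<tau> 1 * - cis (- \<eta>)"
      unfolding \<tau>_def by (simp add: sgn_minus sgn_mult power2_eq_square)
    also have "- cis (- \<eta>) = cis (pi - \<gamma> 1) * cis (\<theta> 1)"
      unfolding cis_mult \<theta>_def by (simp add: minus_cis)
    finally show ?thesis using 1 N Suc_mod[of 0] rout_eq[of 1] by simp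
  next
    case 2
    have "sgn (P N - P 0) * cnj (C N) = sgn (1 / (Q N - q)) * cnj (sgn (cis \<eta> / (Q N - q)))"
      using N unfolding P_def C_def by simp
    also have "\<dots> = cis (- \<eta>)"
    proof -
      let ?u = "sgn (Q N - q)"
      have u: "?u * cnj ?u = 1" using Q_q[of N] N complex_norm_square[of ?u] by (simp add: norm_sgn)
      have "sgn (1 / (Q N - q)) * cnj (sgn (cis \<eta> / (Q N - q))) = cis (- \<eta>) / (?u * cnj ?u)"
        by (simp add: cis_cnj)
      then show ?thesis unfolding u by simp
    qed
    also have "\<dots> = cis (pi - \<gamma> 0) * - cis \<eta>"
      unfolding \<gamma>0 minus_cis cis_mult by (simp add: cis.ctr complex_eq_iff)
    finally show ?thesis using 2 N Suc_mod[of N] rout_0 by simp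
  next
    case 3
    have "sgn (P i - P (Suc i)) * cnj (C i) =
        sgn (1 / (Q i - q) - 1 / (Q (Suc i) - q)) * reciprocal.twist q (Q (Suc i)) (Q i) (cnj (c i))"
      using 3 reciprocal.twist_swap[of "Q i" q "Q (Suc i)" "c i"] Q_q[of i] Q_q[of "Suc i"]
      by (simp add: P_def C_def)
    also have "\<dots> = \<tau> (Suc i) * (sgn (Q i - Q (Suc i)) * cnj (c i))"
      unfolding \<tau>_def using 3 Q_q[of i] Q_q[of "Suc i"] by (intro reciprocal.tangent_twist) auto
    also have "sgn (Q i - Q (Suc i)) = - (Q (Suc i) - Q i)"
    proof -
      have "sgn (- (Q (Suc i) - Q i)) = - (Q (Suc i) - Q i)" unfolding Q_Suc[OF 3(1)] by (simp add: sgn_minus sgn_div_norm)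
      then show ?thesis by simp
    qed
    also have "- (Q (Suc i) - Q i) * cnj (c i) = - cis (\<zeta> (Suc i))"
      using Q_Suc_c(2)[of i] 3 by (simp only: mult_minus_left)
    also have "\<dots> = cis (pi - \<gamma> (Suc i)) * cis (\<theta> (Suc i))"
      unfolding cis_mult \<zeta>_def minus_cis by (simp add: algebra_simps)
    finally show ?thesis using 3 N Suc_mod[of i] rout_eq[of "Suc i"] by simp
  qed
qed

lemma arc_ring: "arc_ring n (\<lambda>i. pi - \<gamma> i) P C"
  unfolding arc_ring_def
proof (intro conjI allI impI)
  show "rarc n P C i \<inter> rarc n P C j \<subseteq> P ` ({i, (i + 1) mod n} \<inter> {j, (j + 1) mod n})"
    if "i < n" "j < n" "i \<noteq> j" for i j
    using rarc_disj[of i j] rarc_disj[of j i] that by (cases i j rule: linorder_cases) auto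
qed (use n P_inj C_norm C_ne turn in auto)

text \<open>Each ray is the image of a path below the graph: for vertex \<open>0\<close> the
  vertical ray below \<open>q\<close>, for the others the segment from \<open>Q i\<close> down to
  \<open>q\<close>, which becomes the radial ray from \<open>P i\<close> away from
  \<open>0\<close>.\<close>

lemma exterior_ray:
  assumes i: "i < n"
  shows "\<exists>\<xi>. pi - \<gamma> i < \<xi> \<and> \<xi> < 2 * pi \<and>
        (\<forall>t>0. P i + of_real t * (rout n P C i * cis \<xi>) \<notin> rcurve n P C)"
proof -
  have avoid: "z \<notin> rcurve n P C" if "z \<noteq> 0" "1 \<le> j" "j \<le> N" "1 / z + q - Q j \<in> dcone \<eta>" for z j
    using rarc_subset_piece[of _ z] piece_comparable[of _ j "1 / z + q"] that N unfolding rcurve_def by force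
  show ?thesis
  proof (cases "i = 0")
    case True
    \<comment> \<open>The angle is chosen so that \<open>rout n P C 0\<close> is turned into
      \<open>\<i>\<close>; inversion takes the points \<open>t * \<i>\<close> to
      \<open>q - \<i> / t\<close>.\<close>
    have "- cis \<eta> * cis (3 / 2 * pi - \<eta>) = \<i>"
      unfolding mult_minus_left cis_mult
      using sin_3over2_pi cos_3over2_pi by (simp add: complex_eq_iff del: sin_3over2_pi cos_3over2_pi)
    moreover have "of_real t * \<i> \<notin> rcurve n P C" if "t > 0" for t
    proof (rule avoid[of _ 1])
      have "1 / (of_real t * \<i>) = of_real (1 / t) * (- \<i>)"
        using that by (simp add: field_simps)
      then have "1 / (of_real t * \<i>) + q - Q 1 = (q - Q 1) + of_real (1 / t) * (- \<i>)" by simp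
      also have "\<dots> \<in> dcone \<eta>"
      proof -
        have "cos \<eta> > 0" using \<eta> by (intro cos_gt_zero_pi) auto
        then have "0 < 1 / t * cos \<eta>" using that by simp
        then show ?thesis using q[of 1] N unfolding dcone_def by (simp add: algebra_simps)
      qed
      finally show "1 / (of_real t * \<i>) + q - Q 1 \<in> dcone \<eta>" .
    qed (use that N in auto)
    ultimately show ?thesis using True \<eta> \<gamma>0 pi_gt_zero unfolding True rout_0
      by (intro exI[of _ "3 / 2 * pi - \<eta>"]) (auto simp: P_def simp del: mult_minus_left)
  next
    case False
    then have i: "1 \<le> i" "i \<le> N" using i N by auto
    obtain \<omega> where \<omega>: "- pi + \<eta> < \<omega>" "\<omega> < - \<eta>" "sgn (q - Q i) = cis \<omega>"
      using dcone_sgn[OF \<eta> q[OF i]] by blast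
    define u where "u = sgn (Q i - q)"
    have u: "u \<noteq> 0" unfolding u_def using Q_q[OF i] by (simp add: sgn_zero_iff)
    \<comment> \<open>\<open>\<omega>\<close> is the direction from \<open>Q i\<close> to
      \<open>q\<close>, measured here against the outgoing tangent; the summand
      \<open>2 * pi\<close> moves the angle between \<open>pi - \<gamma> i\<close> and
      \<open>2 * pi\<close>.\<close>
    have "cis (\<omega> - \<theta> i + 2 * pi) = cis \<omega> / cis (\<theta> i)"
      unfolding cis_divide by (simp add: cis.ctr complex_eq_iff)
    also have "cis \<omega> = - u" unfolding \<omega>(3)[symmetric] u_def by (simp flip: sgn_minus)
    finally have "rout n P C i * cis (\<omega> - \<theta> i + 2 * pi) = 1 / u"
      unfolding rout_eq[OF i] \<tau>_def u_def[symmetric] using u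
      by (simp add: sgn_minus sgn_mult power2_eq_square u_def)
    also have "\<dots> = sgn (P i)" unfolding P_def u_def using False by simp
    finally have dir: "rout n P C i * cis (\<omega> - \<theta> i + 2 * pi) = sgn (P i)" .
    have P0: "P i \<noteq> 0" unfolding P_def using False Q_q[OF i] by simp
    have "P i + of_real t * sgn (P i) \<notin> rcurve n P C" if t: "t > 0" for t
    proof -
      define s where "s = t / norm (P i)"
      have s: "s > 0" unfolding s_def using t P0 by simp
      have z: "P i + of_real t * sgn (P i) = of_real (1 + s) * P i"
        unfolding s_def using P0 by (simp add: sgn_eq algebra_simps)
      have s1: "1 + s \<noteq> 0" "1 + complex_of_real s \<noteq> 0" using s
        by (auto simp: complex_eq_iff)
      have "1 / (of_real (1 + s) * P i) = (Q i - q) / of_real (1 + s)"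
        unfolding P_def using False by simp
      then have "1 / (of_real (1 + s) * P i) + q - Q i = of_real (s / (1 + s)) * (q - Q i)"
        using s1 by (simp add: field_simps)
      also have "\<dots> \<in> dcone \<eta>" using s by (intro dcone_scale q i) auto
      finally show ?thesis unfolding z using P0 i s1 by (intro avoid[of _ i]) auto
    qed
    moreover have "pi - \<gamma> i < \<omega> - \<theta> i + 2 * pi" "\<omega> - \<theta> i + 2 * pi < 2 * pi"
      using \<omega> \<zeta>_bound[OF i] \<theta>_bound[OF i] unfolding \<zeta>_def by auto
    ultimately show ?thesis using dir by (intro exI[of _ "\<omega> - \<theta> i + 2 * pi"]) auto
  qed
qed

end

text \<open>The slope bound \<open>(pi - \<alpha> 0) / 2\<close> is half the turning angle at the
  vertex sent to infinity; minimality of \<open>\<alpha> 0\<close> bounds the other turning angles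
  by twice this number.\<close>

lemma ring_exists:
  assumes n: "3 \<le> n" and \<alpha>: "\<And>i. i < n \<Longrightarrow> \<alpha> 0 \<le> \<alpha> i \<and> \<alpha> i \<le> pi" "0 < \<alpha> 0"
  shows "\<exists>P C. arc_ring n \<alpha> P C \<and> ring_ext n \<alpha> P C"
proof -
  interpret chain n "\<lambda>i. pi - \<alpha> i" "(pi - \<alpha> 0) / 2"
    using n \<alpha>(1)[of 0] \<alpha>(2) by unfold_locales (auto dest: \<alpha>(1))
  have R: "arc_ring n \<alpha> P C" using arc_ring by simp
  have "ring_ext n \<alpha> P C"
  proof (rule ring_ext_from_rays[OF R])
    show "0 < \<alpha> i" if "i < n" for i using \<alpha>(1)[OF that] \<alpha>(2) by simp
    show "\<exists>\<xi>. \<alpha> i < \<xi> \<and> \<xi> < 2 * pi \<and> (\<forall>t>0. P i + of_real t * (rout n P C i * cis \<xi>) \<notin> rcurve n P C)"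
      if "i < n" for i using exterior_ray[OF that] by simp
  qed
  with R show ?thesis by blast
qed

section \<open>Moebius images of rings and their normalisation\<close>

context moebius
begin

context
  fixes n \<alpha> P C
  assumes R: "arc_ring n \<alpha> P C" and nz: "\<And>z. z \<in> rcurve n P C \<Longrightarrow> h z \<noteq> 0"
begin

definition twisted :: "nat \<Rightarrow> complex" where
  "twisted i = twist (P i) (P ((i + 1) mod n)) (C i)"

lemma nz_P: "i < n \<Longrightarrow> h (P i) \<noteq> 0"
  by (rule nz) (auto simp: rcurve_def rarc_def intro!: bexI[of _ i])

lemma nz_arc: "i < n \<Longrightarrow> z \<in> rarc n P C i \<Longrightarrow> h z \<noteq> 0"
  by (rule nz) (auto simp: rcurve_def)

lemma nz_succ: "h (P ((i + 1) mod n)) \<noteq> 0"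
  using nz_P ring_succ_less[OF R] .

lemma rarc_moebius:
  assumes "i < n"
  shows "rarc n (f \<circ> P) twisted i = f ` rarc n P C i"
proof -
  have "f ` carc (P i) (P ((i + 1) mod n)) (C i)
      = carc (f (P i)) (f (P ((i + 1) mod n))) (twist (P i) (P ((i + 1) mod n)) (C i))"
    by (rule image_carc) (use ring_norm[OF R assms] ring_ne[OF R assms] nz_arc[OF assms] in \<open>auto simp: rarc_def\<close>)
  then show ?thesis by (simp add: rarc_def twisted_def)
qed

lemma rcurve_moebius: "rcurve n (f \<circ> P) twisted = f ` rcurve n P C"
  unfolding rcurve_def image_UN using rarc_moebius by auto

lemma rout_moebius:
  assumes "i < n"
  shows "rout n (f \<circ> P) twisted i = sgn (B / (h (P i))\<^sup>2) * rout n P C i"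
  unfolding rout_def twisted_def comp_def by (rule tangent_twist[OF nz_P[OF assms] nz_succ])

lemma arc_ring_moebius: "arc_ring n \<alpha> (f \<circ> P) twisted"
  unfolding arc_ring_def
proof (intro conjI allI impI)
  show "3 \<le> n" by (rule ring_n[OF R])
  show "inj_on (f \<circ> P) {..<n}"
    using ring_inj[OF R] inj nz_P unfolding inj_on_def by auto
  fix i assume i: "i < n"
  show "norm (twisted i) = 1"
    unfolding twisted_def using ring_norm[OF R i] nz_P[OF i] nz_succ by (rule norm_twist)
  show "twisted i \<noteq> -1"
    unfolding twisted_def
    by (rule twist_ne) (use ring_norm[OF R i] ring_ne[OF R i] nz_arc[OF i] in \<open>auto simp: rarc_def\<close>)
  show "sgn ((f \<circ> P) i - (f \<circ> P) ((i + 1) mod n)) * cnj (twisted i) =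
        cis (\<alpha> ((i + 1) mod n)) * rout n (f \<circ> P) twisted ((i + 1) mod n)"
  proof -
    have "sgn ((f \<circ> P) i - (f \<circ> P) ((i + 1) mod n)) * cnj (twisted i)
      = sgn (B / (h (P ((i + 1) mod n)))\<^sup>2) * (sgn (P i - P ((i + 1) mod n)) * cnj (C i))"
      unfolding twisted_def comp_def twist_swap[OF nz_P[OF i] nz_succ]
      by (rule tangent_twist[OF nz_succ nz_P[OF i]])
    then show ?thesis
      unfolding ring_turn[OF R i] rout_moebius[OF ring_succ_less[OF R]] by simp
  qed
next
  fix i j assume i: "i < n" and j: "j < n" and "i \<noteq> j"
  then have "rarc n P C i \<inter> rarc n P C j \<subseteq> P ` ({i, (i + 1) mod n} \<inter> {j, (j + 1) mod n})"
    using ring_disj[OF R] by blast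
  moreover have "f ` rarc n P C i \<inter> f ` rarc n P C j = f ` (rarc n P C i \<inter> rarc n P C j)"
    using inj nz_arc[OF i] nz_arc[OF j] by blast
  ultimately show "rarc n (f \<circ> P) twisted i \<inter> rarc n (f \<circ> P) twisted j
      \<subseteq> (f \<circ> P) ` ({i, (i + 1) mod n} \<inter> {j, (j + 1) mod n})"
    unfolding rarc_moebius[OF i] rarc_moebius[OF j] image_comp[symmetric] by blast
qed

text \<open>Germs are pulled back by \<open>eventually_dirf_image\<close>; the condition on the pole
  keeps exterior and interior from being exchanged.\<close>

lemma ring_ext_moebius:
  assumes ext: "ring_ext n \<alpha> P C" and pole: "m = 0 \<or> - l / m \<in> outside (rcurve n P C)"
  shows "ring_ext n \<alpha> (f \<circ> P) twisted"
  unfolding ring_ext_def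
proof (intro allI impI)
  fix i \<phi> assume i: "i < n" and \<phi>: "\<alpha> i < \<phi> \<and> \<phi> < 2 * pi"
  have "eventually (\<lambda>z. z \<notin> inside (rcurve n P C)) (dirf (P i) (rout n P C i * cis \<phi>))"
    using ext i \<phi> unfolding ring_ext_def by blast
  from eventually_dirf_image[OF nz_P[OF i] this]
  have "eventually (\<lambda>y. y \<notin> inside (f ` rcurve n P C)) (dirf (f (P i)) (sgn (B / (h (P i))\<^sup>2) * (rout n P C i * cis \<phi>)))"
    by (rule eventually_mono) (use not_inside_image[OF compact_rcurve[OF R] nz pole] in blast)
  then show "eventually (\<lambda>z. z \<notin> inside (rcurve n (f \<circ> P) twisted))
      (dirf ((f \<circ> P) i) (rout n (f \<circ> P) twisted i * cis \<phi>))"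
    unfolding rcurve_moebius rout_moebius[OF i] by (simp add: mult.assoc)
qed

end

end

text \<open>The Moebius maps with \<open>p\<close> sent to \<open>0\<close> and derivative
  \<open>\<rho>\<close> there. In the coordinate \<open>1 / (z - p)\<close> they are the translation
  by \<open>k\<close> followed by division by \<open>\<rho>\<close>.\<close>

lemma moebius_fixing:
  assumes "\<rho> \<noteq> 0"
  shows "moebius (\<lambda>z. \<rho> * (z - p) / (1 + k * (z - p))) (\<lambda>z. 1 + k * (z - p)) k (1 - k * p) \<rho>"
  using assms by unfold_locales (auto simp: divide_simps, auto simp: algebra_simps)

lemma ring_vertex_in_rcurve: "arc_ring n \<alpha> P C \<Longrightarrow> i < n \<Longrightarrow> P i \<in> rcurve n P C"
  by (auto simp: rcurve_def rarc_def intro!: bexI[of _ i])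

text \<open>For a straight angle the required sector has opening \<open>2 * pi\<close>, so moving
  \<open>P j\<close> to \<open>0\<close> and rotating is enough.\<close>

lemma ring_normalize_flat:
  assumes R: "arc_ring n \<alpha> P C" and ext: "ring_ext n \<alpha> P C" and j: "j < n" and \<alpha>: "\<alpha> j = pi"
    and \<omega>: "norm \<omega> = 1"
  shows "\<exists>P C. arc_ring n \<alpha> P C \<and> ring_ext n \<alpha> P C \<and> P j = 0 \<and> rout n P C j = \<omega> \<and>
    (\<forall>z\<in>rcurve n P C. z \<noteq> 0 \<longrightarrow> sgn z \<in> (\<lambda>x. \<omega> * cis x) ` {-\<alpha> j / 2..3 * \<alpha> j / 2})"
proof -
  define \<rho> where "\<rho> = \<omega> / rout n P C j"
  have r: "norm (rout n P C j) = 1" by (rule norm_rout[OF R j])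
  have \<rho>: "norm \<rho> = 1" unfolding \<rho>_def using r \<omega> by (simp add: norm_divide)
  then have "\<rho> \<noteq> 0" by auto
  then interpret M: moebius "\<lambda>z. \<rho> * (z - P j) / (1 + 0 * (z - P j))" "\<lambda>z. 1 + 0 * (z - P j)" 0 "1 - 0 * P j" \<rho>
    by (rule moebius_fixing)
  have nz: "1 + 0 * (z - P j) \<noteq> 0" for z by simp
  let ?f = "\<lambda>z. \<rho> * (z - P j) / (1 + 0 * (z - P j))" and ?C = "M.twisted n P C"
  have "arc_ring n \<alpha> (?f \<circ> P) ?C" "ring_ext n \<alpha> (?f \<circ> P) ?C"
    using M.arc_ring_moebius[OF R] M.ring_ext_moebius[OF R _ ext] nz by auto
  moreover have "rout n (?f \<circ> P) ?C j = \<omega>"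
    using M.rout_moebius[OF R nz j] \<rho> r unfolding \<rho>_def by (auto simp: sgn_div_norm norm_divide \<omega>)
  moreover have "sgn z \<in> (\<lambda>x. \<omega> * cis x) ` {-\<alpha> j / 2..3 * \<alpha> j / 2}" if "z \<noteq> 0" for z
  proof -
    define u where "u = sgn z / \<omega>"
    have "norm u = 1" unfolding u_def using that \<omega> by (simp add: norm_divide norm_sgn)
    then have u: "u = cis (Arg u)" by (metis cis_Arg norm_eq_zero sgn_eq div_by_1 of_real_1 zero_neq_one)
    \<comment> \<open>\<open>Arg\<close> has values up to \<open>pi\<close> only; a full turn brings
      the lowest quarter into the range from \<open>- pi / 2\<close> to
      \<open>3 * pi / 2\<close>.\<close>
    define x where "x = (if Arg u < - pi / 2 then Arg u + 2 * pi else Arg u)"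
    have "cis x = cis (Arg u)" unfolding x_def by (simp add: cis.ctr)
    moreover have "x \<in> {-\<alpha> j / 2..3 * \<alpha> j / 2}"
      unfolding x_def \<alpha> using Arg_bounded[of u] by auto
    moreover have "sgn z = \<omega> * u" unfolding u_def using \<omega> by auto
    ultimately show ?thesis using u by (intro image_eqI[of _ _ x]) auto
  qed
  ultimately show ?thesis by (intro exI[of _ "?f \<circ> P"] exI[of _ ?C]) auto
qed

text \<open>In the coordinate \<open>1 / z\<close> centred at the vertex, the map used here is a translation by a large \<open>T\<close> along the
  bisector of the interior angle. Near the vertex the curve is already in a cone around the bisector, and the
  rest is bounded in that coordinate, hence moved into the cone.\<close>

lemma ring_normalize_sharp:
  assumes R: "arc_ring n \<alpha> P C" and ext: "ring_ext n \<alpha> P C" and j: "j < n"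
    and \<alpha>: "0 < \<alpha> j" "\<alpha> j \<le> 2 * pi / 3" and \<omega>: "norm \<omega> = 1"
  shows "\<exists>P C. arc_ring n \<alpha> P C \<and> ring_ext n \<alpha> P C \<and> P j = 0 \<and> rout n P C j = \<omega> \<and>
    (\<forall>z\<in>rcurve n P C. z \<noteq> 0 \<longrightarrow> sgn z \<in> (\<lambda>x. \<omega> * cis x) ` {-\<alpha> j / 2..3 * \<alpha> j / 2})"
proof -
  let ?S = "rcurve n P C"
  define r where "r = rout n P C j"
  define p where "p = P j"
  define a where "a = \<alpha> j"
  \<comment> \<open>Half-opening of the cone around the bisector: above \<open>a / 2\<close>, to
    contain both tangents strictly; at most \<open>a\<close>, to fit the sector; below
    \<open>pi / 2\<close>, since \<open>a \<le> 2 * pi / 3\<close> gives at most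
    \<open>5 * pi / 12\<close>.\<close>
  define \<beta> where "\<beta> = 5 / 8 * a"
  have a: "0 < a" "a \<le> 2 * pi / 3" unfolding a_def using \<alpha> by auto
  have \<beta>: "0 \<le> \<beta>" "\<beta> < pi / 2" "a / 2 < \<beta>" "\<beta> \<le> a" unfolding \<beta>_def using a pi_gt_zero by auto
  have r: "norm r = 1" unfolding r_def by (rule norm_rout[OF R j])
  have r0: "r \<noteq> 0" using r by auto
  define \<rho> where "\<rho> = \<omega> / r"
  have \<rho>: "norm \<rho> = 1" unfolding \<rho>_def using r \<omega> by (simp add: norm_divide)
  then have \<rho>0: "\<rho> \<noteq> 0" by auto
  \<comment> \<open>Rotates the interior bisector \<open>r * cis (a / 2)\<close> to the positive
    real axis.\<close>
  define \<sigma> where "\<sigma> = cis (- a / 2) / r"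
  have \<sigma>: "norm \<sigma> = 1" unfolding \<sigma>_def using r by (simp add: norm_divide)
  then have \<sigma>0: "\<sigma> \<noteq> 0" by auto
  \<comment> \<open>The unit directions outside the open cone. None is tangent to the curve, so by
    compactness the curve near \<open>p\<close> stays within the cone.\<close>
  define A where "A = sphere 0 1 \<inter> ({d. Re (\<sigma> * d) \<le> 0} \<union> {d. Re (\<sigma> * d) * sin \<beta> \<le> \<bar>Im (\<sigma> * d)\<bar> * cos \<beta>})"
  have "compact A"
    unfolding A_def by (intro compact_Int_closed closed_Un closed_Collect_le continuous_intros) auto
  moreover have "eventually (\<lambda>z. z \<notin> ?S) (dirf p d)" if "d \<in> A" for d
    unfolding p_def
  proof (rule ring_eventually_not_rcurve[OF R j])
    have cos: "cos (a / 2) > 0" using a by (intro cos_gt_zero_pi) auto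
    have "0 < sin (\<beta> - a / 2)" using \<beta> pi_gt_zero by (intro sin_gt_zero) auto
    then have lt: "sin (a / 2) * cos \<beta> < cos (a / 2) * sin \<beta>" by (simp add: sin_diff mult.commute)
    have sn: "\<bar>sin (a / 2)\<bar> = sin (a / 2)" using a by (intro abs_of_nonneg sin_ge_zero) auto
    have AD: "Re w \<le> 0 \<or> Re w * sin \<beta> \<le> \<bar>Im w\<bar> * cos \<beta>" if "\<sigma> * d = w" for w
      using \<open>d \<in> A\<close> that unfolding A_def by blast
    have "\<sigma> * r = cis (- a / 2)" unfolding \<sigma>_def using r0 by simp
    then show "d \<noteq> rout n P C j" using AD[of "cis (- a / 2)"] cos lt sn unfolding r_def[symmetric] by auto
    have "\<sigma> * (r * cis a) = cis (a / 2)" unfolding \<sigma>_def using r0 by (simp add: cis_mult)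
    then show "d \<noteq> rout n P C j * cis (\<alpha> j)"
      using AD[of "cis (a / 2)"] cos lt sn unfolding r_def[symmetric] a_def[symmetric] by auto
  qed
  ultimately obtain \<delta> where \<delta>: "\<delta> > 0"
    "\<And>z. z \<noteq> p \<Longrightarrow> dist z p < \<delta> \<Longrightarrow> sgn (z - p) \<in> A \<Longrightarrow> z \<notin> ?S"
    using eventually_dirf_uniform[of A "\<lambda>z. z \<notin> ?S" p] by blast
  \<comment> \<open>Opposite to the bisector, hence pointing out of the curve: the pole will be
    placed here.\<close>
  let ?d = "r * cis (a / 2 + pi)"
  have "eventually (\<lambda>z. z \<notin> inside ?S) (dirf p ?d)"
    using ext j a unfolding ring_ext_def r_def p_def a_def by auto
  moreover have "eventually (\<lambda>z. z \<notin> ?S) (dirf p ?d)"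
    unfolding p_def
  proof (rule ring_eventually_not_rcurve[OF R j])
    show "?d \<noteq> rout n P C j" unfolding r_def[symmetric] using r0 cis_neq_1[of "a / 2 + pi"] a by auto
    show "?d \<noteq> rout n P C j * cis (\<alpha> j)"
      unfolding r_def[symmetric] a_def[symmetric] using r0 cis_neq[of "a / 2 + pi" a] a by auto
  qed
  ultimately have "eventually (\<lambda>z. z \<in> outside ?S) (dirf p ?d)"
    by eventually_elim (auto simp: outside_inside)
  then obtain \<epsilon> where \<epsilon>: "\<epsilon> > 0" "\<And>z. z \<noteq> p \<Longrightarrow> dist z p < \<epsilon> \<Longrightarrow> dist (sgn (z - p)) ?d < \<epsilon> \<Longrightarrow> z \<in> outside ?S"
    unfolding eventually_dirf by blast
  have sin: "sin \<beta> > 0" using \<beta> a by (intro sin_gt_zero) auto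
  \<comment> \<open>The summands serve three purposes: \<open>1 / \<delta>\<close> keeps the real
    part positive for points at distance at least \<open>\<delta>\<close>,
    \<open>1 / (\<delta> * sin \<beta>)\<close> pushes these points into the cone, and
    \<open>1 / \<epsilon>\<close> brings the pole, at distance \<open>1 / T\<close> from
    \<open>p\<close>, within \<open>\<epsilon>\<close>.\<close>
  define T where "T = 1 + 1 / \<delta> + 1 / (\<delta> * sin \<beta>) + 1 / \<epsilon>"
  have T: "T > 0" "T > 1 / \<delta>" "T > 1 / \<epsilon>" "(T - 1 / \<delta>) * sin \<beta> \<ge> 1 / \<delta>"
  proof -
    have pos: "0 < 1 / \<delta>" "0 < 1 / (\<delta> * sin \<beta>)" "0 < 1 / \<epsilon>"
      using \<delta>(1) \<epsilon>(1) sin by simp_all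
    then show "T > 0" "T > 1 / \<delta>" "T > 1 / \<epsilon>" unfolding T_def by linarith+
    have "T - 1 / \<delta> \<ge> 1 / (\<delta> * sin \<beta>)" unfolding T_def using pos by linarith
    then have "(T - 1 / \<delta>) * sin \<beta> \<ge> 1 / (\<delta> * sin \<beta>) * sin \<beta>"
      using sin by (intro mult_right_mono) auto
    then show "(T - 1 / \<delta>) * sin \<beta> \<ge> 1 / \<delta>" using sin by simp
  qed
  \<comment> \<open>Near \<open>p\<close> the reciprocal already lies in the cone, which is
    symmetric about the real axis, and translation by \<open>T\<close> stays in it. Elsewhere the
    reciprocal has norm at most \<open>1 / \<delta>\<close>.\<close>
  have cone: "of_real T + 1 / (\<sigma> * (z - p)) \<in> rcone \<beta> \<and> Re (of_real T + 1 / (\<sigma> * (z - p))) > 0"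
    if z: "z \<in> ?S" "z \<noteq> p" for z
  proof (cases "dist z p < \<delta>")
    case True
    define w where "w = \<sigma> * (z - p)"
    have w0: "w \<noteq> 0" unfolding w_def using z \<sigma>0 by auto
    have "sgn (z - p) \<notin> A" using \<delta>(2)[OF z(2) True] z(1) by blast
    moreover have "norm (sgn (z - p)) = 1" using z by (simp add: norm_sgn)
    moreover obtain v where v: "v = \<sigma> * sgn (z - p)" by blast
    ultimately have "Re v > 0" "\<bar>Im v\<bar> * cos \<beta> < Re v * sin \<beta>"
      unfolding A_def v by (auto simp del: times_complex.sel)
    moreover obtain k where k: "k > 0" "w = of_real k * v"
    proof (rule that)
      show "norm (z - p) > 0" using z by simp
      show "w = of_real (norm (z - p)) * v" unfolding w_def v sgn_eq using z(2) by simp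
    qed
    ultimately have "Re w > 0" "k * (\<bar>Im v\<bar> * cos \<beta>) < k * (Re v * sin \<beta>)" by auto
    then have "Re w > 0" "\<bar>Im w\<bar> * cos \<beta> < Re w * sin \<beta>"
      unfolding k(2) using k(1) by (simp_all add: abs_mult mult.assoc)
    then have "cnj w \<in> rcone \<beta>" unfolding rcone_def by auto
    then have "of_real (1 / (norm w)\<^sup>2) * cnj w \<in> rcone \<beta>" by (rule rcone_scale) simp
    moreover have "of_real (1 / (norm w)\<^sup>2) * cnj w = 1 / w"
      using w0 unfolding of_real_divide complex_norm_square by simp
    ultimately have iw: "1 / w \<in> rcone \<beta>" by simp
    have "of_real T * cis 0 \<in> rcone \<beta>" using T(1) \<beta> by (intro rcone_scale cis_in_rcone) auto
    then have "of_real T + 1 / w \<in> rcone \<beta>" using rcone_add[OF \<beta>(1,2) _ iw] by simp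
    moreover have "Re (of_real T + 1 / w) > 0" using iw T(1) unfolding rcone_def by simp
    ultimately show ?thesis unfolding w_def by simp
  next
    case False
    define e where "e = 1 / (\<sigma> * (z - p))"
    have "norm e \<le> 1 / \<delta>"
      unfolding e_def using False \<delta>(1) \<sigma> by (simp add: norm_divide norm_mult dist_norm frac_le)
    then have e: "\<bar>Re e\<bar> \<le> 1 / \<delta>" "\<bar>Im e\<bar> \<le> 1 / \<delta>"
      using abs_Re_le_cmod[of e] abs_Im_le_cmod[of e] by linarith+
    have "Re e \<ge> - (1 / \<delta>)" using e by linarith
    then have re: "T + Re e \<ge> T - 1 / \<delta>" by simp
    have "\<bar>Im e\<bar> * cos \<beta> \<le> 1 / \<delta> * 1"
      using e by (intro mult_mono) (use \<beta> cos_ge_zero[of \<beta>] \<delta>(1) in auto)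
    also have "\<dots> \<le> (T - 1 / \<delta>) * sin \<beta>" using T by simp
    also have "\<dots> \<le> (T + Re e) * sin \<beta>" using re sin by (intro mult_right_mono) auto
    finally show ?thesis using re T unfolding e_def[symmetric] rcone_def by auto
  qed
  interpret M: moebius "\<lambda>z. \<rho> * (z - p) / (1 + T * \<sigma> * (z - p))" "\<lambda>z. 1 + T * \<sigma> * (z - p)" "T * \<sigma>" "1 - T * \<sigma> * p" \<rho>
    by (rule moebius_fixing) (rule \<rho>0)
  let ?f = "\<lambda>z. \<rho> * (z - p) / (1 + T * \<sigma> * (z - p))" and ?C = "M.twisted n P C"
  have hz: "1 + T * \<sigma> * (z - p) = \<sigma> * (z - p) * (of_real T + 1 / (\<sigma> * (z - p)))" if "z \<noteq> p" for z
    using that \<sigma>0 by (simp add: field_simps)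
  have nz: "1 + T * \<sigma> * (z - p) \<noteq> 0" if "z \<in> ?S" for z
  proof (cases "z = p")
    case False
    have "Re (of_real T + 1 / (\<sigma> * (z - p))) \<noteq> 0" using cone[OF that False] by linarith
    then have "of_real T + 1 / (\<sigma> * (z - p)) \<noteq> 0" by force
    then show ?thesis unfolding hz[OF False] using False \<sigma>0 by simp
  qed simp
  \<comment> \<open>The pole equals \<open>p - 1 / (T * \<sigma>)\<close>, a point close to
    \<open>p\<close> in direction \<open>?d\<close>.\<close>
  have "- (1 - T * \<sigma> * p) / (T * \<sigma>) \<in> outside ?S"
  proof -
    have "1 / \<sigma> = r * cis (a / 2)" unfolding \<sigma>_def using r0 by (simp add: cis_inverse[symmetric] field_simps cis_mult)
    then have "- (1 / \<sigma>) = ?d" unfolding cis_mult[symmetric] by simp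
    moreover have "- (1 - T * \<sigma> * p) / (T * \<sigma>) = p + of_real (1 / T) * (- (1 / \<sigma>))"
      using T(1) \<sigma>0 by (simp add: field_simps)
    ultimately have e: "- (1 - T * \<sigma> * p) / (T * \<sigma>) = p + of_real (1 / T) * ?d" by (simp only:)
    have "1 / T < \<epsilon>" using T \<epsilon>(1) by (simp add: field_simps)
    then show ?thesis unfolding e using T(1) r r0 \<epsilon>(1)
      by (intro \<epsilon>(2)) (auto simp: dist_norm norm_mult norm_divide sgn_scale_unit simp del: of_real_divide)
  qed
  then have "arc_ring n \<alpha> (?f \<circ> P) ?C" "ring_ext n \<alpha> (?f \<circ> P) ?C"
    using M.arc_ring_moebius[OF R nz] M.ring_ext_moebius[OF R nz ext] by auto
  moreover have "rout n (?f \<circ> P) ?C j = \<omega>"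
    using M.rout_moebius[OF R nz j] \<rho> r0 unfolding p_def[symmetric] r_def[symmetric]
    by (simp add: sgn_div_norm) (simp add: \<rho>_def)
  moreover have "sgn y \<in> (\<lambda>x. \<omega> * cis x) ` {-\<alpha> j / 2..3 * \<alpha> j / 2}"
    if y: "y \<in> rcurve n (?f \<circ> P) ?C" "y \<noteq> 0" for y
  proof -
    obtain z where z: "z \<in> ?S" "y = ?f z" using y(1) unfolding M.rcurve_moebius[OF R nz, simplified] by auto
    have zp: "z \<noteq> p" using z y(2) by auto
    define u where "u = of_real T + 1 / (\<sigma> * (z - p))"
    have "Re u > 0" and u: "u \<in> rcone \<beta>" using cone[OF z(1) zp] unfolding u_def by blast+
    then have u: "u \<in> rcone \<beta>" "u \<noteq> 0" by auto
    then obtain \<phi> where \<phi>: "\<bar>\<phi>\<bar> \<le> \<beta>" "sgn u = cis \<phi>" using rcone_sgn[OF \<beta>(1,2)] by blast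
    \<comment> \<open>Division by \<open>u\<close> reflects the cone and
      \<open>\<rho> / \<sigma>\<close> turns it to the bisector
      \<open>\<omega> * cis (a / 2)\<close>, so the angles lie within \<open>\<beta> \<le> a\<close>
      of \<open>a / 2\<close>.\<close>
    have "y = (\<rho> / \<sigma>) / u" unfolding z(2) hz[OF zp] u_def[symmetric] using zp \<sigma>0 u by simp
    also have "\<rho> / \<sigma> = \<omega> * cis (a / 2)"
      unfolding \<rho>_def \<sigma>_def using r0 by (simp add: cis_inverse[symmetric] field_simps cis_mult)
    finally have "sgn y = (sgn \<omega> * cis (a / 2)) / cis \<phi>" using \<phi>(2) by (simp add: sgn_mult)
    then have "sgn y = \<omega> * cis (a / 2 - \<phi>)" using \<omega> by (simp add: sgn_div_norm flip: cis_divide)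
    then show ?thesis using \<phi>(1) \<beta> unfolding a_def[symmetric] by (intro image_eqI[of _ _ "a / 2 - \<phi>"]) auto
  qed
  ultimately show ?thesis by (intro exI[of _ "?f \<circ> P"] exI[of _ ?C]) (auto simp: p_def)
qed

section \<open>Drawings of graphs\<close>

definition etrack :: "('v \<Rightarrow> complex) \<Rightarrow> ('v \<Rightarrow> 'v \<Rightarrow> complex) \<Rightarrow> 'v set set \<Rightarrow> complex set" where
  "etrack p c X = \<Union>{carc (p u) (p v) (c u v) | u v. {u, v} \<in> X}"

definition dpts where
  "dpts W F p c = p ` W \<union> etrack p c F"

text \<open>Edges are kept as point sets, given by the unit numbers \<open>c\<close>, because
  Moebius and affine maps act simply on these. Parametrised paths are produced from them only at the
  end.\<close>

definition is_draw :: "'v set \<Rightarrow> 'v set set \<Rightarrow> ('v \<Rightarrow> complex) \<Rightarrow> ('v \<Rightarrow> 'v \<Rightarrow> complex) \<Rightarrow> bool" where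
  "is_draw W F p c \<longleftrightarrow> finite W \<and>
     (\<forall>e\<in>F. \<exists>u v. e = {u, v}) \<and>
     (\<forall>u v. {u, v} \<in> F \<longrightarrow> u \<noteq> v \<and> u \<in> W \<and> v \<in> W \<and>
        norm (c u v) = 1 \<and> c u v \<noteq> -1 \<and> c v u = cnj (c u v)) \<and>
     inj_on p W \<and>
     (\<forall>u v w. {u, v} \<in> F \<and> w \<in> W \<and> p w \<in> carc (p u) (p v) (c u v) \<longrightarrow> w \<in> {u, v}) \<and>
     (\<forall>u v x y. {u, v} \<in> F \<and> {x, y} \<in> F \<and> {u, v} \<noteq> {x, y} \<longrightarrow>
        carc (p u) (p v) (c u v) \<inter> carc (p x) (p y) (c x y) \<subseteq> p ` ({u, v} \<inter> {x, y}))"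

context
  fixes W F p c
  assumes dr: "is_draw W F p c"
begin

lemma draw_finite: "finite W"
  and draw_edge: "{u, v} \<in> F \<Longrightarrow> u \<noteq> v \<and> u \<in> W \<and> v \<in> W"
  and draw_norm: "{u, v} \<in> F \<Longrightarrow> norm (c u v) = 1"
  and draw_ne: "{u, v} \<in> F \<Longrightarrow> c u v \<noteq> -1"
  and draw_cnj: "{u, v} \<in> F \<Longrightarrow> c v u = cnj (c u v)"
  and draw_inj: "inj_on p W"
  and draw_off: "{u, v} \<in> F \<Longrightarrow> w \<in> W \<Longrightarrow> p w \<in> carc (p u) (p v) (c u v) \<Longrightarrow> w \<in> {u, v}"
  and draw_disj: "{u, v} \<in> F \<Longrightarrow> {x, y} \<in> F \<Longrightarrow> {u, v} \<noteq> {x, y} \<Longrightarrow>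
        carc (p u) (p v) (c u v) \<inter> carc (p x) (p y) (c x y) \<subseteq> p ` ({u, v} \<inter> {x, y})"
  and draw_pair: "e \<in> F \<Longrightarrow> \<exists>u v. e = {u, v}"
proof -
  note d = dr[unfolded is_draw_def]
  show "finite W" using d by (elim conjE)
  have e: "\<forall>u v. {u, v} \<in> F \<longrightarrow> u \<noteq> v \<and> u \<in> W \<and> v \<in> W \<and> norm (c u v) = 1 \<and> c u v \<noteq> -1 \<and> c v u = cnj (c u v)"
    using d by (elim conjE)
  show "u \<noteq> v \<and> u \<in> W \<and> v \<in> W" "norm (c u v) = 1" "c u v \<noteq> -1" "c v u = cnj (c u v)" if "{u, v} \<in> F"
    using e[rule_format, OF that] by simp_all
  show "inj_on p W" using d by (elim conjE)
  have "\<forall>u v w. {u, v} \<in> F \<and> w \<in> W \<and> p w \<in> carc (p u) (p v) (c u v) \<longrightarrow> w \<in> {u, v}"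
    using d by (elim conjE)
  then show "w \<in> {u, v}" if "{u, v} \<in> F" "w \<in> W" "p w \<in> carc (p u) (p v) (c u v)"
    using that by (elim allE impE) (intro conjI)
  have "\<forall>u v x y. {u, v} \<in> F \<and> {x, y} \<in> F \<and> {u, v} \<noteq> {x, y} \<longrightarrow>
        carc (p u) (p v) (c u v) \<inter> carc (p x) (p y) (c x y) \<subseteq> p ` ({u, v} \<inter> {x, y})"
    using d by (elim conjE)
  then show "carc (p u) (p v) (c u v) \<inter> carc (p x) (p y) (c x y) \<subseteq> p ` ({u, v} \<inter> {x, y})"
    if "{u, v} \<in> F" "{x, y} \<in> F" "{u, v} \<noteq> {x, y}"
    using that by (elim allE impE) (intro conjI)
  have "\<forall>e\<in>F. \<exists>u v. e = {u, v}" using d by (elim conjE)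
  then show "\<exists>u v. e = {u, v}" if "e \<in> F" using that by (rule bspec)
qed

lemma finite_edge_pairs: "X \<subseteq> F \<Longrightarrow> finite {(u, v). {u, v} \<in> X}"
  by (rule finite_subset[of _ "W \<times> W"]) (use draw_edge draw_finite in auto)

lemma etrack_UN: "etrack p c X = (\<Union>(u, v)\<in>{(u, v). {u, v} \<in> X}. carc (p u) (p v) (c u v))"
  unfolding etrack_def by auto

lemma compact_etrack: "X \<subseteq> F \<Longrightarrow> compact (etrack p c X)"
  unfolding etrack_UN by (intro compact_UN finite_edge_pairs) (auto intro!: compact_carc draw_norm draw_ne)

lemma etrack_mono: "X \<subseteq> F \<Longrightarrow> etrack p c X \<subseteq> dpts W F p c"
  unfolding dpts_def etrack_def by blast

lemma carc_dpts: "{u, v} \<in> F \<Longrightarrow> carc (p u) (p v) (c u v) \<subseteq> dpts W F p c"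
  unfolding dpts_def etrack_def by blast

lemma vertex_dpts: "v \<in> W \<Longrightarrow> p v \<in> dpts W F p c"
  unfolding dpts_def by blast

lemma compact_dpts: "compact (dpts W F p c)"
  unfolding dpts_def using draw_finite by (intro compact_Un compact_etrack finite_imp_compact) auto

lemma finite_nbrs: "finite (nbrs F v)"
  by (rule finite_subset[OF _ draw_finite]) (use draw_edge in \<open>auto simp: nbrs_def\<close>)

text \<open>Arcs at \<open>u\<close> avoid any direction other than their tangents, and the rest of
  the drawing is closed and misses \<open>p u\<close>.\<close>

lemma draw_eventually_not_dpts:
  assumes u: "u \<in> W" and d: "\<And>x. x \<in> nbrs F u \<Longrightarrow> d \<noteq> sgn (p x - p u) * c u x"
  shows "eventually (\<lambda>z. z \<notin> dpts W F p c) (dirf (p u) d)"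
proof -
  have arc: "eventually (\<lambda>z. z \<notin> carc (p x) (p y) (c x y)) (dirf (p u) d)" if e: "{x, y} \<in> F" for x y
  proof -
    have pne: "p x \<noteq> p y" using draw_edge[OF e] draw_inj by (auto simp: inj_on_def)
    consider "u = x" | "u = y" | "p u \<notin> carc (p x) (p y) (c x y)" using draw_off[OF e u] by auto
    then show ?thesis
    proof cases
      case 1
      have "eventually (\<lambda>z. z \<notin> carc (p x) (p y) (c x y)) (dirf (p x) d)"
        using d[of y] e pne draw_norm[OF e] 1 by (intro eventually_not_carc_dirf) (auto simp: nbrs_def)
      then show ?thesis unfolding 1 .
    next
      case 2
      have e': "{y, x} \<in> F" using e by (simp add: insert_commute)
      have "eventually (\<lambda>z. z \<notin> carc (p y) (p x) (c y x)) (dirf (p y) d)"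
        using d[of x] e' pne draw_norm[OF e'] 2 by (intro eventually_not_carc_dirf) (auto simp: nbrs_def)
      then show ?thesis unfolding draw_cnj[OF e] carc_swap[OF draw_norm[OF e]] 2 .
    next
      case 3
      then show ?thesis by (intro eventually_not_closed_dirf compact_imp_closed compact_carc draw_norm[OF e] draw_ne[OF e])
    qed
  qed
  have "eventually (\<lambda>z. \<forall>e\<in>{(x, y). {x, y} \<in> F}. z \<notin> carc (p (fst e)) (p (snd e)) (c (fst e) (snd e))) (dirf (p u) d)"
    using finite_edge_pairs[of F] arc by (intro eventually_ball_finite) auto
  moreover have "eventually (\<lambda>z. z \<notin> p ` (W - {u})) (dirf (p u) d)"
    using draw_finite draw_inj u
    by (intro eventually_not_closed_dirf finite_imp_closed) (auto simp: inj_on_def)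
  moreover have "eventually (\<lambda>z. z \<noteq> p u) (dirf (p u) d)"
    by (rule filter_leD[OF dirf_le_at]) (simp add: eventually_at_filter)
  ultimately show ?thesis
    by eventually_elim (auto simp: dpts_def etrack_def)
qed

end

lemma carc_affine:
  assumes "k \<noteq> 0"
  shows "carc (b + k * x) (b + k * y) c = (\<lambda>z. b + k * z) ` carc x y c"
proof -
  have iff: "of_real (1 - s) * (b + k * z - (b + k * x)) = of_real s * c * (b + k * y - (b + k * z))
      \<longleftrightarrow> of_real (1 - s) * (z - x) = of_real s * c * (y - z)" for s z
  proof -
    have "of_real (1 - s) * (b + k * z - (b + k * x)) - of_real s * c * (b + k * y - (b + k * z))
      = k * (of_real (1 - s) * (z - x) - of_real s * c * (y - z))" by (simp add: algebra_simps)
    then show ?thesis using assms by (metis eq_iff_diff_eq_0 mult_eq_0_iff)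
  qed
  then have mem: "b + k * z \<in> carc (b + k * x) (b + k * y) c \<longleftrightarrow> z \<in> carc x y c" for z
    unfolding carc_def by blast
  show ?thesis
  proof (intro set_eqI iffI)
    fix w assume w: "w \<in> carc (b + k * x) (b + k * y) c"
    have "(w - b) / k \<in> carc x y c" using mem[of "(w - b) / k"] w assms by simp
    then show "w \<in> (\<lambda>z. b + k * z) ` carc x y c" by (rule image_eqI[rotated]) (use assms in simp)
  qed (use mem in auto)
qed

lemma etrack_affine:
  assumes "k \<noteq> 0" "\<And>x y. {x, y} \<in> X \<Longrightarrow> p' x = b + k * p x \<and> p' y = b + k * p y \<and> c' x y = c x y"
  shows "etrack p' c' X = (\<lambda>z. b + k * z) ` etrack p c X"
proof -
  have eq: "carc (p' x) (p' y) (c' x y) = (\<lambda>z. b + k * z) ` carc (p x) (p y) (c x y)" if "{x, y} \<in> X" for x y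
    using assms(2)[OF that] carc_affine[OF assms(1)] by simp
  have "{carc (p' u) (p' v) (c' u v) | u v. {u, v} \<in> X}
    = image (\<lambda>z. b + k * z) ` {carc (p u) (p v) (c u v) | u v. {u, v} \<in> X}"
    using eq by (auto simp: image_iff) (metis, metis)
  then show ?thesis unfolding etrack_def image_Union by simp
qed

lemma is_draw_affine:
  assumes dr: "is_draw W F p c" and k: "k \<noteq> 0"
    and p': "\<And>x. x \<in> W \<Longrightarrow> p' x = b + k * p x" and c': "\<And>x y. {x, y} \<in> F \<Longrightarrow> c' x y = c x y"
  shows "is_draw W F p' c'" "dpts W F p' c' = (\<lambda>z. b + k * z) ` dpts W F p c"
proof -
  have carc: "carc (p' x) (p' y) (c' x y) = (\<lambda>z. b + k * z) ` carc (p x) (p y) (c x y)" if "{x, y} \<in> F" for x y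
    using p'[of x] p'[of y] c'[OF that] draw_edge[OF dr that] carc_affine[OF k] by simp
  have inj: "inj (\<lambda>z. b + k * z)" using k by (auto simp: inj_on_def)
  show "is_draw W F p' c'"
    unfolding is_draw_def
  proof (intro conjI allI impI ballI; (elim conjE)?)
    show "inj_on p' W" using draw_inj[OF dr] p' k by (auto simp: inj_on_def)
  next
    fix u v w assume e: "{u, v} \<in> F" and w: "w \<in> W" and "p' w \<in> carc (p' u) (p' v) (c' u v)"
    then have "p w \<in> carc (p u) (p v) (c u v)" unfolding carc[OF e] p'[OF w] using k by auto
    then show "w \<in> {u, v}" by (rule draw_off[OF dr e w])
  next
    fix u v x y assume e: "{u, v} \<in> F" "{x, y} \<in> F" "{u, v} \<noteq> {x, y}"
    have "carc (p' u) (p' v) (c' u v) \<inter> carc (p' x) (p' y) (c' x y)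
      = (\<lambda>z. b + k * z) ` (carc (p u) (p v) (c u v) \<inter> carc (p x) (p y) (c x y))"
      unfolding carc[OF e(1)] carc[OF e(2)] using inj by (simp add: image_Int)
    also have "\<dots> \<subseteq> (\<lambda>z. b + k * z) ` p ` ({u, v} \<inter> {x, y})"
      using draw_disj[OF dr e] by (rule image_mono)
    also have "\<dots> = p' ` ({u, v} \<inter> {x, y})"
      unfolding image_image using draw_edge[OF dr e(1)] by (intro image_cong) (auto simp: p')
    finally show "carc (p' u) (p' v) (c' u v) \<inter> carc (p' x) (p' y) (c' x y) \<subseteq> p' ` ({u, v} \<inter> {x, y})" .
  next
    fix u v assume e: "{u, v} \<in> F"
    have e': "{v, u} \<in> F" using e by (simp add: insert_commute)
    show "norm (c' u v) = 1" "c' u v \<noteq> -1" "u \<noteq> v" "u \<in> W" "v \<in> W"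
      using draw_norm[OF dr e] draw_ne[OF dr e] draw_edge[OF dr e] c'[OF e] by auto
    show "c' v u = cnj (c' u v)" using c'[OF e] c'[OF e'] draw_cnj[OF dr e] by simp
  qed (fact draw_finite[OF dr], fact draw_pair[OF dr])
  have "etrack p' c' F = (\<lambda>z. b + k * z) ` etrack p c F"
  proof (rule etrack_affine[OF k])
    fix x y assume "{x, y} \<in> F"
    then show "p' x = b + k * p x \<and> p' y = b + k * p y \<and> c' x y = c x y"
      using p'[of x] p'[of y] c'[of x y] draw_edge[OF dr, of x y] by simp
  qed
  then show "dpts W F p' c' = (\<lambda>z. b + k * z) ` dpts W F p c"
    unfolding dpts_def image_Un image_image using p' by auto
qed

text \<open>A vertex of one drawing on an arc of the other is, by \<open>meet\<close>, a common
  vertex, to which the conditions of a single drawing apply.\<close>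

lemma is_draw_union:
  assumes d1: "is_draw W1 F1 p c" and d2: "is_draw W2 F2 p c"
    and meet: "dpts W1 F1 p c \<inter> dpts W2 F2 p c \<subseteq> p ` (W1 \<inter> W2)"
  shows "is_draw (W1 \<union> W2) (F1 \<union> F2) p c"
proof -
  have same: "v = w \<and> w \<in> W1 \<inter> W2" if "v \<in> W1" "w \<in> W2" "p v = p w" for v w
  proof -
    have "p v \<in> p ` (W1 \<inter> W2)" using that meet vertex_dpts[OF d1, of v] vertex_dpts[OF d2, of w] by auto
    then show ?thesis using that draw_inj[OF d1] draw_inj[OF d2] by (auto simp: inj_on_def)
  qed
  have off1: "w \<in> {u, v}" if e: "{u, v} \<in> F1" "w \<in> W2" "p w \<in> carc (p u) (p v) (c u v)" for u v w
  proof -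
    have "p w \<in> p ` (W1 \<inter> W2)" using e meet vertex_dpts[OF d2, of w] carc_dpts[OF d1 e(1)] by auto
    then have "w \<in> W1" using e draw_inj[OF d2] by (auto simp: inj_on_def)
    then show ?thesis using draw_off[OF d1 e(1)] e(3) by blast
  qed
  have off2: "w \<in> {u, v}" if e: "{u, v} \<in> F2" "w \<in> W1" "p w \<in> carc (p u) (p v) (c u v)" for u v w
  proof -
    have "p w \<in> p ` (W1 \<inter> W2)" using e meet vertex_dpts[OF d1, of w] carc_dpts[OF d2 e(1)] by auto
    then have "w \<in> W2" using e draw_inj[OF d1] by (auto simp: inj_on_def)
    then show ?thesis using draw_off[OF d2 e(1)] e(3) by blast
  qed
  have cross: "carc (p u) (p v) (c u v) \<inter> carc (p x) (p y) (c x y) \<subseteq> p ` ({u, v} \<inter> {x, y})"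
    if e: "{u, v} \<in> F1" "{x, y} \<in> F2" for u v x y
  proof
    fix z assume z: "z \<in> carc (p u) (p v) (c u v) \<inter> carc (p x) (p y) (c x y)"
    then have "z \<in> p ` (W1 \<inter> W2)" using meet carc_dpts[OF d1 e(1)] carc_dpts[OF d2 e(2)] by auto
    then obtain w where w: "w \<in> W1" "w \<in> W2" "z = p w" by auto
    then have "w \<in> {u, v} \<inter> {x, y}" using off1[OF e(1), of w] off2[OF e(2), of w] z by blast
    then show "z \<in> p ` ({u, v} \<inter> {x, y})" using w(3) by blast
  qed
  show ?thesis
    unfolding is_draw_def
  proof (intro conjI allI impI ballI; (elim conjE)?)
    show "finite (W1 \<union> W2)" using draw_finite[OF d1] draw_finite[OF d2] by simp
    show "\<exists>u v. e = {u, v}" if "e \<in> F1 \<union> F2" for e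
      using that draw_pair[OF d1, of e] draw_pair[OF d2, of e] by (elim UnE) simp_all
    show "inj_on p (W1 \<union> W2)"
      using same draw_inj[OF d1] draw_inj[OF d2] unfolding inj_on_def by (metis Un_iff)
    show "w \<in> {u, v}" if "{u, v} \<in> F1 \<union> F2" "w \<in> W1 \<union> W2" "p w \<in> carc (p u) (p v) (c u v)" for u v w
      using that(1,2) off1[of u v w] off2[of u v w] draw_off[OF d1, of u v w] draw_off[OF d2, of u v w] that(3)
      by (elim UnE) simp_all
    fix u v x y assume "{u, v} \<in> F1 \<union> F2" "{x, y} \<in> F1 \<union> F2" "{u, v} \<noteq> {x, y}"
    then show "carc (p u) (p v) (c u v) \<inter> carc (p x) (p y) (c x y) \<subseteq> p ` ({u, v} \<inter> {x, y})"
      using draw_disj[OF d1, of u v x y] draw_disj[OF d2, of u v x y] cross[of u v x y] cross[of x y u v]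
      unfolding Int_commute[of "carc (p x) (p y) (c x y)"] Int_commute[of "{x, y}"] by (elim UnE) simp_all
  next
    fix u v assume "{u, v} \<in> F1 \<union> F2"
    then consider "{u, v} \<in> F1" | "{u, v} \<in> F2" by blast
    then have "u \<noteq> v \<and> u \<in> W1 \<union> W2 \<and> v \<in> W1 \<union> W2 \<and> norm (c u v) = 1 \<and> c u v \<noteq> -1 \<and> c v u = cnj (c u v)"
    proof cases
      case 1
      then show ?thesis using draw_edge[OF d1 1] draw_norm[OF d1 1] draw_ne[OF d1 1] draw_cnj[OF d1 1] by simp
    next
      case 2
      then show ?thesis using draw_edge[OF d2 2] draw_norm[OF d2 2] draw_ne[OF d2 2] draw_cnj[OF d2 2] by simp
    qed
    then show "u \<noteq> v" "u \<in> W1 \<union> W2" "v \<in> W1 \<union> W2" "norm (c u v) = 1" "c u v \<noteq> -1" "c v u = cnj (c u v)"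
      by blast+
  qed
qed

section \<open>Attaching a small drawing at a vertex\<close>

definition slot :: "('v \<Rightarrow> nat) \<Rightarrow> ('v \<Rightarrow> complex) \<Rightarrow> 'v \<Rightarrow> nat \<Rightarrow> complex" where
  "slot D w v k = w v * cis (2 * pi * real k / real (D v))"

definition edge_dirs :: "'v set set \<Rightarrow> ('v \<Rightarrow> complex) \<Rightarrow> ('v \<Rightarrow> 'v \<Rightarrow> complex) \<Rightarrow> 'v \<Rightarrow> complex set" where
  "edge_dirs F p c v = (\<lambda>u. sgn (p u - p v) * c v u) ` nbrs F v"

text \<open>\<open>CY\<close> contains the edge sets of the cycles drawn so far. The slots from \<open>deg F v\<close> on are still free.\<close>

definition dstate where
  "dstate D CY W F p c w \<longleftrightarrow> is_draw W F p c \<and>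
     (\<forall>v\<in>W. norm (w v) = 1 \<and> edge_dirs F p c v = slot D w v ` {..<deg F v}) \<and>
     (\<forall>X\<in>CY. X \<subseteq> F \<and> inside (etrack p c X) \<inter> dpts W F p c = {}) \<and>
     (\<forall>v\<in>W. \<forall>k X. deg F v \<le> k \<and> k < D v \<and> X \<in> CY \<longrightarrow>
        eventually (\<lambda>z. z \<notin> inside (etrack p c X)) (dirf (p v) (slot D w v k)))"

lemma ray_not_inside:
  fixes z d :: complex
  assumes "d \<noteq> 0" and avoid: "\<And>t. t \<ge> 0 \<Longrightarrow> z + of_real t * d \<notin> S"
  shows "z \<notin> inside S"
proof (rule connected_unbounded_not_inside)
  let ?Z = "(\<lambda>t. z + of_real t * d) ` {0..}"
  show "connected ?Z" by (intro connected_continuous_image continuous_intros) simp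
  show "\<not> bounded ?Z"
  proof
    assume "bounded ?Z"
    then have "bounded ((\<lambda>t. z + of_real t * d) ` {0<..})" by (rule bounded_subset) auto
    then show False using unbounded_ray[OF assms(1)] by blast
  qed
  show "?Z \<inter> S = {}" using avoid by auto
  show "z \<in> ?Z" by (auto intro!: image_eqI[of _ _ 0])
qed

text \<open>From a point outside the star-shaped set \<open>Z\<close>, the ray that continues away
  from \<open>b\<close> meets neither \<open>Z\<close> nor \<open>b\<close>, hence not
  \<open>S\<close>, and leads to infinity.\<close>

lemma inside_subset_star:
  fixes b :: complex
  assumes S: "S \<subseteq> insert b Z" and b: "b \<notin> inside S"
    and Z: "\<And>z t. z \<noteq> b \<Longrightarrow> b + of_real t * (z - b) \<in> Z \<Longrightarrow> t \<ge> 1 \<Longrightarrow> z \<in> Z"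
  shows "inside S \<subseteq> Z"
proof
  fix z assume z: "z \<in> inside S"
  show "z \<in> Z"
  proof (rule ccontr)
    assume nz: "z \<notin> Z"
    have zb: "z \<noteq> b" using z b by auto
    have "z \<notin> inside S"
    proof (rule ray_not_inside)
      show "z - b \<noteq> 0" using zb by simp
      fix t :: real assume t: "t \<ge> 0"
      have e: "z + of_real t * (z - b) = b + of_real (1 + t) * (z - b)" by (simp add: algebra_simps)
      have "of_real (1 + t) \<noteq> (0 :: complex)" using t unfolding of_real_eq_0_iff by simp
      then have "z + of_real t * (z - b) \<noteq> b" unfolding e using zb by simp
      moreover have "z + of_real t * (z - b) \<notin> Z" unfolding e using Z[OF zb, of "1 + t"] nz t by auto
      ultimately show "z + of_real t * (z - b) \<notin> S" using S by auto
    qed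
    with z show False by simp
  qed
qed

lemma moebius_affine: "k \<noteq> 0 \<Longrightarrow> moebius (\<lambda>z. b + k * z) (\<lambda>z. 1) 0 1 k"
  by unfold_locales (auto simp: algebra_simps)

lemma not_inside_affine:
  fixes z :: complex
  assumes "k \<noteq> 0" "compact S" "z \<notin> inside S"
  shows "b + k * z \<notin> inside ((\<lambda>z. b + k * z) ` S)"
proof -
  interpret moebius "\<lambda>z. b + k * z" "\<lambda>z. 1" 0 1 k by (rule moebius_affine[OF assms(1)])
  show ?thesis using not_inside_image[OF assms(2)] assms(3) by simp
qed

lemma eventually_not_inside_affine:
  assumes k: "k > 0" and S: "compact S" and ev: "eventually (\<lambda>z. z \<notin> inside S) (dirf p d)"
  shows "eventually (\<lambda>z. z \<notin> inside ((\<lambda>z. b + of_real k * z) ` S)) (dirf (b + of_real k * p) d)"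
proof -
  have k0: "of_real k \<noteq> (0 :: complex)" using k by simp
  interpret moebius "\<lambda>z. b + of_real k * z" "\<lambda>z. 1" 0 1 "of_real k" by (rule moebius_affine[OF k0])
  have "eventually (\<lambda>y. \<exists>z. (1::complex) \<noteq> 0 \<and> b + of_real k * z = y \<and> z \<notin> inside S)
      (dirf (b + of_real k * p) (sgn (of_real k / 1\<^sup>2) * d))"
    using eventually_dirf_image[OF _ ev] by simp
  moreover have sg: "sgn (of_real k :: complex) = 1" using k by (simp add: sgn_of_real)
  ultimately have "eventually (\<lambda>y. \<exists>z. b + of_real k * z = y \<and> z \<notin> inside S) (dirf (b + of_real k * p) d)"
    by simp
  then show ?thesis by eventually_elim (use not_inside_affine[OF k0 S] in blast)
qed

lemma connected_not_inside:
  assumes "connected Z" "Z \<inter> S = {}" "y \<in> Z" "y \<notin> inside S"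
  shows "Z \<inter> inside S = {}"
proof (rule ccontr)
  assume "Z \<inter> inside S \<noteq> {}"
  then obtain x where x: "x \<in> Z" "x \<in> inside S" by auto
  have "connected_component (- S) x y"
    using assms x unfolding connected_component_def by (intro exI[of _ Z]) auto
  then show False using inside_same_component x(2) assms(4) by blast
qed

lemma edge_dirs_affine:
  assumes "k > 0" "\<And>x. x \<in> nbrs F v \<Longrightarrow> p' x = b + of_real k * p x \<and> c' v x = c v x" "p' v = b + of_real k * p v"
  shows "edge_dirs F p' c' v = edge_dirs F p c v"
proof -
  have "sgn (p' x - p' v) * c' v x = sgn (p x - p v) * c v x" if "x \<in> nbrs F v" for x
  proof -
    have "p' x - p' v = of_real k * (p x - p v)" using assms(2)[OF that] assms(3) by (simp add: algebra_simps)
    then have "sgn (p' x - p' v) = sgn (p x - p v)" using assms(1) by (simp add: sgn_mult sgn_of_real)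
    then show ?thesis using assms(2)[OF that] by simp
  qed
  then show ?thesis unfolding edge_dirs_def by (intro image_cong) auto
qed

lemma nbrs_Un: "nbrs (F \<union> G) v = nbrs F v \<union> nbrs G v"
  unfolding nbrs_def by auto

text \<open>One frame for bridges and cycles. The new piece has \<open>u\<close> at the origin and
  \<open>N\<close> as its other vertices, with reference directions \<open>w2\<close>. The set
  \<open>A\<close> contains the directions of all its points and separates the slots it takes at
  \<open>u\<close> from all other slots: a single direction for a bridge, a closed interval of
  angles for a cycle.\<close>

locale attachment =
  fixes D :: "'v \<Rightarrow> nat" and CY W F p c w u N F2 P C CY2 A w2
  assumes S: "dstate D CY W F p c w" and u: "u \<in> W"
    and dr2: "is_draw (insert u N) F2 P C" and NW: "N \<inter> W = {}" and Pu: "P u = 0"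
    and A: "compact A" "connected A" "A \<subseteq> sphere 0 1"
    and dirs: "\<And>z. z \<in> dpts (insert u N) F2 P C \<Longrightarrow> z \<noteq> 0 \<Longrightarrow> sgn z \<in> A"
    and CY2: "\<And>X. X \<in> CY2 \<Longrightarrow> X \<subseteq> F2 \<and> inside (etrack P C X) \<inter> dpts (insert u N) F2 P C = {}"
    and room: "0 < deg F2 u" "deg F u + deg F2 u \<le> D u"
    and dirs_u: "edge_dirs F2 P C u = slot D w u ` {deg F u..<deg F u + deg F2 u}"
    and A_in: "slot D w u (deg F u) \<in> A"
    and A_out: "\<And>k. k < D u \<Longrightarrow> k < deg F u \<or> deg F u + deg F2 u \<le> k \<Longrightarrow> slot D w u k \<notin> A"
    and w2: "\<And>v. v \<in> N \<Longrightarrow> norm (w2 v) = 1 \<and> edge_dirs F2 P C v = slot D w2 v ` {..<deg F2 v}"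
    and free2: "\<And>v k X. v \<in> N \<Longrightarrow> deg F2 v \<le> k \<Longrightarrow> k < D v \<Longrightarrow> X \<in> CY2 \<Longrightarrow>
        eventually (\<lambda>z. z \<notin> inside (etrack P C X)) (dirf (P v) (slot D w2 v k))"
begin

lemma dr: "is_draw W F p c"
  and w: "v \<in> W \<Longrightarrow> norm (w v) = 1" "v \<in> W \<Longrightarrow> edge_dirs F p c v = slot D w v ` {..<deg F v}"
  and CY: "X \<in> CY \<Longrightarrow> X \<subseteq> F" "X \<in> CY \<Longrightarrow> inside (etrack p c X) \<inter> dpts W F p c = {}"
  and free: "v \<in> W \<Longrightarrow> deg F v \<le> k \<Longrightarrow> k < D v \<Longrightarrow> X \<in> CY \<Longrightarrow>
        eventually (\<lambda>z. z \<notin> inside (etrack p c X)) (dirf (p v) (slot D w v k))"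
  using S unfolding dstate_def by simp_all

text \<open>\<open>A\<close> is compact and contains no occupied slot, so a uniform radius exists.
  The second condition keeps the other vertices at a positive distance from the new piece, hence the
  half of \<open>\<delta>2\<close>.\<close>

lemma exists_radius:
  "\<exists>\<delta>>0. (\<forall>z. z \<noteq> p u \<and> dist z (p u) < \<delta> \<and> sgn (z - p u) \<in> A \<longrightarrow> z \<notin> dpts W F p c) \<and>
     (\<forall>x\<in>W. x \<noteq> u \<longrightarrow> \<delta> < dist (p x) (p u))"
proof -
  have "eventually (\<lambda>z. z \<notin> dpts W F p c) (dirf (p u) d)" if d: "d \<in> A" for d
  proof (rule draw_eventually_not_dpts[OF dr u])
    fix x assume "x \<in> nbrs F u"
    then have "sgn (p x - p u) * c u x \<in> slot D w u ` {..<deg F u}"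
      using w(2)[OF u] unfolding edge_dirs_def by blast
    then show "d \<noteq> sgn (p x - p u) * c u x" using A_out d room by force
  qed
  then obtain \<delta>1 where \<delta>1: "\<delta>1 > 0" "\<forall>z. z \<noteq> p u \<and> dist z (p u) < \<delta>1 \<and> sgn (z - p u) \<in> A \<longrightarrow> z \<notin> dpts W F p c"
    using eventually_dirf_uniform[OF A(1), of "\<lambda>z. z \<notin> dpts W F p c" "p u"] by blast
  obtain \<delta>2 where \<delta>2: "\<delta>2 > 0" "\<And>y. y \<in> p ` (W - {u}) \<Longrightarrow> y \<noteq> p u \<Longrightarrow> \<delta>2 \<le> dist (p u) y"
    using finite_set_avoid[of "p ` (W - {u})" "p u"] draw_finite[OF dr] by blast
  have "p x \<noteq> p u" if "x \<in> W" "x \<noteq> u" for x using that draw_inj[OF dr] u by (auto simp: inj_on_def)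
  then have "\<delta>2 \<le> dist (p x) (p u)" if "x \<in> W" "x \<noteq> u" for x
    using that \<delta>2(2)[of "p x"] by (simp add: dist_commute)
  then show ?thesis using \<delta>1 \<delta>2(1) by (intro exI[of _ "min \<delta>1 (\<delta>2 / 2)"]) force
qed

definition \<delta> where "\<delta> = (SOME \<delta>. \<delta> > 0 \<and> (\<forall>z. z \<noteq> p u \<and> dist z (p u) < \<delta> \<and> sgn (z - p u) \<in> A \<longrightarrow> z \<notin> dpts W F p c) \<and>
     (\<forall>x\<in>W. x \<noteq> u \<longrightarrow> \<delta> < dist (p x) (p u)))"

lemma \<delta>: "\<delta> > 0" "z \<noteq> p u \<Longrightarrow> dist z (p u) < \<delta> \<Longrightarrow> sgn (z - p u) \<in> A \<Longrightarrow> z \<notin> dpts W F p c"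
  "x \<in> W \<Longrightarrow> x \<noteq> u \<Longrightarrow> \<delta> < dist (p x) (p u)"
  using someI_ex[OF exists_radius, folded \<delta>_def] by auto

text \<open>The truncated sector without its apex, the only place where the drawing will
  change.\<close>

definition Z where "Z = (\<lambda>x. p u + of_real (fst x) * snd x) ` ({0<..<\<delta>} \<times> A)"

lemma norm_A: "d \<in> A \<Longrightarrow> norm d = 1" using A(3) by auto

lemma Z_iff: "z \<in> Z \<longleftrightarrow> z \<noteq> p u \<and> dist z (p u) < \<delta> \<and> sgn (z - p u) \<in> A"
proof
  assume "z \<in> Z"
  then obtain r d where "0 < r" "r < \<delta>" "d \<in> A" "z = p u + of_real r * d" unfolding Z_def by auto
  then show "z \<noteq> p u \<and> dist z (p u) < \<delta> \<and> sgn (z - p u) \<in> A"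
    using norm_A[of d] by (auto simp: dist_norm norm_mult sgn_scale_unit)
next
  assume z: "z \<noteq> p u \<and> dist z (p u) < \<delta> \<and> sgn (z - p u) \<in> A"
  then have "z = p u + of_real (norm (z - p u)) * sgn (z - p u)" by (simp add: sgn_eq)
  then show "z \<in> Z"
    unfolding Z_def using z
    by (intro image_eqI[of _ _ "(norm (z - p u), sgn (z - p u))"]) (auto simp: dist_norm)
qed

lemma Z_dpts: "Z \<inter> dpts W F p c = {}"
  using \<delta>(2) Z_iff by blast

lemma connected_Z: "connected Z"
  unfolding Z_def by (rule sector_connected[OF A(2)])

lemma Z_star: "z \<noteq> p u \<Longrightarrow> p u + of_real t * (z - p u) \<in> Z \<Longrightarrow> t \<ge> 1 \<Longrightarrow> z \<in> Z"
proof -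
  assume z: "z \<noteq> p u" "p u + of_real t * (z - p u) \<in> Z" and t: "t \<ge> 1"
  have "sgn (of_real t * (z - p u)) = sgn (z - p u)" using t by (simp add: sgn_mult sgn_of_real)
  moreover have "norm (z - p u) \<le> t * norm (z - p u)" using mult_right_mono[OF t, of "norm (z - p u)"] by simp
  moreover have "t * norm (z - p u) < \<delta>" using z(2) t unfolding Z_iff by (simp add: dist_norm norm_mult)
  ultimately have "norm (z - p u) < \<delta> \<and> sgn (of_real t * (z - p u)) = sgn (z - p u)" by linarith
  moreover have "sgn (of_real t * (z - p u)) \<in> A" using z(2) unfolding Z_iff by simp
  ultimately show "z \<in> Z" using z(1) unfolding Z_iff by (simp add: dist_norm)
qed

text \<open>\<open>Z\<close> is connected and misses the drawing, so it suffices to look at one of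
  its points: a point close to \<open>p u\<close> in the first free slot, which points out of all
  drawn cycles.\<close>

lemma Z_not_inside:
  assumes X: "X \<in> CY"
  shows "Z \<inter> inside (etrack p c X) = {}"
proof -
  let ?d = "slot D w u (deg F u)"
  have "eventually (\<lambda>z. z \<notin> inside (etrack p c X)) (dirf (p u) ?d)"
    using room X by (intro free u) auto
  then obtain e where e: "e > 0" "\<And>z. z \<noteq> p u \<Longrightarrow> dist z (p u) < e \<Longrightarrow> dist (sgn (z - p u)) ?d < e \<Longrightarrow> z \<notin> inside (etrack p c X)"
    unfolding eventually_dirf by blast
  define r where "r = min e \<delta> / 2"
  have r: "r > 0" "r < e" "r < \<delta>" using e(1) \<delta>(1) unfolding r_def by auto
  have y: "dist (p u + of_real r * ?d) (p u) = r" "sgn (p u + of_real r * ?d - p u) = ?d" "p u + of_real r * ?d \<noteq> p u"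
    using r norm_A[OF A_in] by (auto simp: dist_norm norm_mult sgn_scale_unit)
  show ?thesis
  proof (rule connected_not_inside[OF connected_Z])
    show "Z \<inter> etrack p c X = {}" using Z_dpts etrack_mono[OF dr CY(1)[OF X]] by blast
    show "p u + of_real r * ?d \<in> Z" unfolding Z_iff y using y r A_in by simp
    show "p u + of_real r * ?d \<notin> inside (etrack p c X)" using e y r by auto
  qed
qed

lemma exists_scale: "\<exists>k>0. \<forall>z\<in>dpts (insert u N) F2 P C. k * norm z < \<delta>"
proof -
  obtain M where M: "M > 0" "\<forall>z\<in>dpts (insert u N) F2 P C. norm z \<le> M"
    using compact_imp_bounded[OF compact_dpts[OF dr2]] unfolding bounded_pos by blast
  have "\<delta> / (2 * M) * norm z < \<delta>" if "z \<in> dpts (insert u N) F2 P C" for z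
  proof -
    have "\<delta> / (2 * M) * norm z \<le> \<delta> / (2 * M) * M" using M that \<delta>(1) by (intro mult_left_mono) auto
    also have "\<dots> < \<delta>" using M(1) \<delta>(1) by simp
    finally show ?thesis .
  qed
  then show ?thesis using M(1) \<delta>(1) by (intro exI[of _ "\<delta> / (2 * M)"]) auto
qed

definition k where "k = (SOME k. k > 0 \<and> (\<forall>z\<in>dpts (insert u N) F2 P C. k * norm z < \<delta>))"

lemma k: "k > 0" "z \<in> dpts (insert u N) F2 P C \<Longrightarrow> k * norm z < \<delta>"
  using someI_ex[OF exists_scale, folded k_def] by auto

text \<open>The piece is shrunk by \<open>k\<close> and moved to \<open>p u\<close>. It needs no
  rotation, since it was built for the slots of \<open>u\<close>, and a positive factor changes no
  value of \<open>C\<close>.\<close>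

definition p' where "p' x = (if x \<in> W then p x else p u + of_real k * P x)"
definition c' where "c' x y = (if x \<in> W \<and> y \<in> W then c x y else C x y)"
definition w' where "w' x = (if x \<in> W then w x else w2 x)"

lemma p'_old: "x \<in> W \<Longrightarrow> p' x = p x" unfolding p'_def by simp

lemma p'_new: "x \<in> insert u N \<Longrightarrow> p' x = p u + of_real k * P x"
  unfolding p'_def using NW Pu u by auto

lemma c'_old: "{x, y} \<in> F \<Longrightarrow> c' x y = c x y"
  using draw_edge[OF dr, of x y] unfolding c'_def by simp

lemma c'_new: "{x, y} \<in> F2 \<Longrightarrow> c' x y = C x y"
  using draw_edge[OF dr2, of x y] NW unfolding c'_def by auto

lemma etrack_old: "X \<subseteq> F \<Longrightarrow> etrack p' c' X = etrack p c X"
proof -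
  assume X: "X \<subseteq> F"
  have "etrack p' c' X = (\<lambda>z. 0 + 1 * z) ` etrack p c X"
  proof (rule etrack_affine)
    fix x y assume "{x, y} \<in> X"
    then have e: "{x, y} \<in> F" using X by blast
    show "p' x = 0 + 1 * p x \<and> p' y = 0 + 1 * p y \<and> c' x y = c x y"
      using draw_edge[OF dr e] c'_old[OF e] p'_old[of x] p'_old[of y] by simp
  qed simp
  then show ?thesis by simp
qed

lemma etrack_new: "X \<subseteq> F2 \<Longrightarrow> etrack p' c' X = (\<lambda>z. p u + of_real k * z) ` etrack P C X"
proof (rule etrack_affine)
  fix x y assume "X \<subseteq> F2" "{x, y} \<in> X"
  then have e: "{x, y} \<in> F2" by blast
  show "p' x = p u + of_real k * P x \<and> p' y = p u + of_real k * P y \<and> c' x y = C x y"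
    using draw_edge[OF dr2 e] c'_new[OF e] p'_new[of x] p'_new[of y] by simp
qed (use k in simp)

lemma draw_old: "is_draw W F p' c'" "dpts W F p' c' = dpts W F p c"
  using is_draw_affine[OF dr, of 1 p' 0 c'] p'_old c'_old by simp_all

lemma draw_new: "is_draw (insert u N) F2 p' c'"
    "dpts (insert u N) F2 p' c' = (\<lambda>z. p u + of_real k * z) ` dpts (insert u N) F2 P C"
proof -
  have "of_real k \<noteq> (0 :: complex)" using k by simp
  from is_draw_affine[OF dr2 this, of p' "p u" c', OF p'_new c'_new]
  show "is_draw (insert u N) F2 p' c'"
    "dpts (insert u N) F2 p' c' = (\<lambda>z. p u + of_real k * z) ` dpts (insert u N) F2 P C" by simp_all
qed

lemma new_in_Z: "dpts (insert u N) F2 p' c' \<subseteq> insert (p u) Z"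
proof
  fix y assume "y \<in> dpts (insert u N) F2 p' c'"
  then obtain z where z: "z \<in> dpts (insert u N) F2 P C" "y = p u + of_real k * z" unfolding draw_new by auto
  show "y \<in> insert (p u) Z"
  proof (cases "z = 0")
    case False
    have "sgn (of_real k * z) = sgn z" using k(1) by (simp add: sgn_mult sgn_of_real)
    then have "y \<in> Z" unfolding Z_iff using z k dirs False by (auto simp: dist_norm norm_mult)
    then show ?thesis by simp
  qed (use z in simp)
qed

lemma dpts_Un: "dpts (W \<union> N) (F \<union> F2) p' c' = dpts W F p' c' \<union> dpts (insert u N) F2 p' c'"
  unfolding dpts_def etrack_def using u by blast

lemma draw_all: "is_draw (W \<union> N) (F \<union> F2) p' c'"
proof -
  have "is_draw (W \<union> insert u N) (F \<union> F2) p' c'"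
  proof (rule is_draw_union[OF draw_old(1) draw_new(1)])
    show "dpts W F p' c' \<inter> dpts (insert u N) F2 p' c' \<subseteq> p' ` (W \<inter> insert u N)"
      using new_in_Z Z_dpts u p'_old[OF u] unfolding draw_old(2) by auto
  qed
  moreover have "W \<union> insert u N = W \<union> N" using u by auto
  ultimately show ?thesis by simp
qed

lemma inside_new:
  assumes X: "X \<in> CY2"
  shows "inside (etrack p' c' X) \<inter> dpts (insert u N) F2 p' c' = {}"
proof -
  have "p u + of_real k * z \<notin> inside (etrack p' c' X)" if "z \<in> dpts (insert u N) F2 P C" for z
    using CY2[OF X] that k(1) unfolding etrack_new[OF conjunct1[OF CY2[OF X]]]
    by (intro not_inside_affine compact_etrack[OF dr2]) auto
  then show ?thesis unfolding draw_new(2) by auto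
qed

text \<open>The new curve lies in \<open>Z\<close> and its apex, so by the star shape of
  \<open>Z\<close> the enclosed region does as well and cannot touch anything old.\<close>

lemma inside_new_Z:
  assumes X: "X \<in> CY2"
  shows "inside (etrack p' c' X) \<subseteq> Z"
proof (rule inside_subset_star[OF _ _ Z_star])
  show "etrack p' c' X \<subseteq> insert (p u) Z"
    using etrack_mono[OF draw_new(1)] CY2[OF X] new_in_Z by blast
  have "p u \<in> dpts (insert u N) F2 p' c'" using vertex_dpts[OF draw_new(1), of u] p'_old[OF u] by simp
  then show "p u \<notin> inside (etrack p' c' X)" using inside_new[OF X] by blast
qed

lemma CY_all:
  assumes "X \<in> CY \<union> CY2"
  shows "X \<subseteq> F \<union> F2 \<and> inside (etrack p' c' X) \<inter> dpts (W \<union> N) (F \<union> F2) p' c' = {}"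
  using assms
proof
  assume X: "X \<in> CY"
  have "p u \<notin> inside (etrack p c X)" using CY(2)[OF X] vertex_dpts[OF dr u] by blast
  then have "inside (etrack p c X) \<inter> dpts (insert u N) F2 p' c' = {}"
    using new_in_Z Z_not_inside[OF X] by blast
  then show ?thesis unfolding dpts_Un draw_old(2) etrack_old[OF CY(1)[OF X]] using CY[OF X] by blast
next
  assume X: "X \<in> CY2"
  have "inside (etrack p' c' X) \<inter> dpts W F p c = {}" using inside_new_Z[OF X] Z_dpts by blast
  then show ?thesis unfolding dpts_Un draw_old(2) using inside_new[OF X] CY2[OF X] by blast
qed

lemma nbrs_F2: "v \<in> W \<Longrightarrow> v \<noteq> u \<Longrightarrow> nbrs F2 v = {}"
  unfolding nbrs_def using draw_edge[OF dr2] NW by blast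

lemma nbrs_F: "v \<in> N \<Longrightarrow> nbrs F v = {}"
  unfolding nbrs_def using draw_edge[OF dr] NW by blast

lemma deg_u: "deg (F \<union> F2) u = deg F u + deg F2 u"
proof -
  have "nbrs F u \<subseteq> W" "nbrs F2 u \<subseteq> N" unfolding nbrs_def using draw_edge[OF dr] draw_edge[OF dr2] by blast+
  then have "nbrs F u \<inter> nbrs F2 u = {}" using NW by blast
  then show ?thesis unfolding deg_def nbrs_Un
    using finite_nbrs[OF dr] finite_nbrs[OF dr2] by (simp add: card_Un_disjoint)
qed

lemma deg_old: "v \<in> W \<Longrightarrow> v \<noteq> u \<Longrightarrow> deg (F \<union> F2) v = deg F v"
  unfolding deg_def nbrs_Un nbrs_F2 by simp

lemma deg_new: "v \<in> N \<Longrightarrow> deg (F \<union> F2) v = deg F2 v"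
  unfolding deg_def nbrs_Un nbrs_F by simp

lemma edge_dirs_old: "v \<in> W \<Longrightarrow> edge_dirs F p' c' v = edge_dirs F p c v"
proof (rule edge_dirs_affine[where b = 0 and k = 1])
  fix x assume v: "v \<in> W" "x \<in> nbrs F v"
  then have e: "{v, x} \<in> F" by (simp add: nbrs_def)
  show "p' x = 0 + of_real 1 * p x \<and> c' v x = c v x" using p'_old draw_edge[OF dr e] c'_old[OF e] by simp
qed (auto simp: p'_old)

lemma edge_dirs_new: "v \<in> insert u N \<Longrightarrow> edge_dirs F2 p' c' v = edge_dirs F2 P C v"
proof (rule edge_dirs_affine[where b = "p u" and k = k])
  fix x assume v: "v \<in> insert u N" "x \<in> nbrs F2 v"
  then have e: "{v, x} \<in> F2" by (simp add: nbrs_def)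
  show "p' x = p u + of_real k * P x \<and> c' v x = C v x" using p'_new[of x] draw_edge[OF dr2 e] c'_new[OF e] by simp
qed (auto simp: p'_new k)

lemma edge_dirs_Un: "edge_dirs (F \<union> F2) p' c' v = edge_dirs F p' c' v \<union> edge_dirs F2 p' c' v"
  unfolding edge_dirs_def nbrs_Un image_Un ..

lemma slots:
  assumes v: "v \<in> W \<union> N"
  shows "norm (w' v) = 1 \<and> edge_dirs (F \<union> F2) p' c' v = slot D w' v ` {..<deg (F \<union> F2) v}"
proof -
  consider "v = u" | "v \<in> W" "v \<noteq> u" | "v \<in> N" using v by blast
  then show ?thesis
  proof cases
    case 1
    have "{..<deg F u + deg F2 u} = {..<deg F u} \<union> {deg F u..<deg F u + deg F2 u}" by auto
    then show ?thesis
      unfolding 1 edge_dirs_Un deg_u edge_dirs_old[OF u] edge_dirs_new[OF insertI1] w(2)[OF u] dirs_u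
      using w(1)[OF u] u by (simp add: image_Un w'_def slot_def)
  next
    case 2
    have "edge_dirs F2 p' c' v = {}" unfolding edge_dirs_def nbrs_F2[OF 2] by simp
    then show ?thesis
      unfolding edge_dirs_Un deg_old[OF 2] edge_dirs_old[OF 2(1)] w(2)[OF 2(1)]
      using w(1)[OF 2(1)] 2 by (simp add: w'_def slot_def)
  next
    case 3
    have "edge_dirs F p' c' v = {}" unfolding edge_dirs_def nbrs_F[OF 3] by simp
    moreover have "v \<notin> W" using 3 NW by blast
    ultimately show ?thesis
      unfolding edge_dirs_Un deg_new[OF 3] using edge_dirs_new[of v] w2[OF 3] 3
      by (simp add: w'_def slot_def)
  qed
qed

lemma free_all:
  assumes v: "v \<in> W \<union> N" and j: "deg (F \<union> F2) v \<le> j" "j < D v" and X: "X \<in> CY \<union> CY2"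
  shows "eventually (\<lambda>z. z \<notin> inside (etrack p' c' X)) (dirf (p' v) (slot D w' v j))"
proof -
  have Z: "eventually (\<lambda>z. z \<notin> inside (etrack p' c' X)) F" if "eventually (\<lambda>z. z \<notin> Z) F" "X \<in> CY2" for F
    using that(1) by eventually_elim (use inside_new_Z[OF that(2)] in blast)
  \<comment> \<open>An old cycle at an old vertex is inherited. A new cycle stays in
    \<open>Z\<close>, which the remaining slots at \<open>u\<close> leave because they miss
    \<open>A\<close>, and from which the other old vertices are separated. New vertices lie in the
    open outside of each old cycle. The last case is the shrunken copy of
    \<open>free2\<close>.\<close>
  consider "v \<in> W" "X \<in> CY" | "v = u" "X \<in> CY2" | "v \<in> W" "v \<noteq> u" "X \<in> CY2" | "v \<in> N" "X \<in> CY" | "v \<in> N" "X \<in> CY2"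
    using v X by blast
  then show ?thesis
  proof cases
    case 1
    have "deg F v \<le> j" using j(1) deg_u deg_old[OF 1(1)] by (cases "v = u") auto
    then show ?thesis
      using free[OF 1(1) _ j(2) 1(2)] 1(1) p'_old[OF 1(1)] unfolding etrack_old[OF CY(1)[OF 1(2)]]
      by (simp add: slot_def w'_def)
  next
    case 2
    have "slot D w u j \<notin> A" using j unfolding 2 deg_u by (intro A_out) auto
    then have "eventually (\<lambda>z. sgn (z - p u) \<in> - A) (dirf (p u) (slot D w u j))"
      using A(1) by (intro topological_tendstoD[OF sgn_tendsto_dirf]) (auto simp: compact_imp_closed)
    then have "eventually (\<lambda>z. z \<notin> Z) (dirf (p u) (slot D w u j))"
      by eventually_elim (auto simp: Z_iff)
    then have "eventually (\<lambda>z. z \<notin> inside (etrack p' c' X)) (dirf (p u) (slot D w u j))"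
      using 2(2) by (rule Z)
    then show ?thesis unfolding 2(1) using u by (simp add: slot_def w'_def p'_old)
  next
    case 3
    have "eventually (\<lambda>z. z \<notin> cball (p u) \<delta>) (dirf (p v) (slot D w' v j))"
      using \<delta>(3)[OF 3(1,2)] by (intro eventually_not_closed_dirf) (auto simp: dist_commute)
    then have "eventually (\<lambda>z. z \<notin> Z) (dirf (p v) (slot D w' v j))"
      by eventually_elim (auto simp: Z_iff dist_commute)
    then show ?thesis unfolding p'_old[OF 3(1)] using 3(3) by (rule Z)
  next
    case 4
    have "P v \<noteq> 0" using draw_inj[OF dr2] Pu 4(1) NW u by (auto simp: inj_on_def)
    then have "p' v \<noteq> p u" using p'_new[of v] 4(1) k(1) by simp
    then have "p' v \<in> Z" using new_in_Z vertex_dpts[OF draw_new(1), of v] 4(1) by blast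
    then have "p' v \<in> outside (etrack p c X)"
      using Z_not_inside[OF 4(2)] Z_dpts etrack_mono[OF dr CY(1)[OF 4(2)]] unfolding outside_inside by blast
    moreover have "closed (- outside (etrack p c X))"
      using open_outside[OF compact_imp_closed[OF compact_etrack[OF dr CY(1)[OF 4(2)]]]] by (simp add: closed_def)
    ultimately have "eventually (\<lambda>z. z \<notin> - outside (etrack p c X)) (dirf (p' v) (slot D w' v j))"
      by (intro eventually_not_closed_dirf) auto
    then show ?thesis unfolding etrack_old[OF CY(1)[OF 4(2)]]
      by eventually_elim (auto simp: outside_inside)
  next
    case 5
    have X2: "X \<subseteq> F2" using CY2[OF 5(2)] by blast
    have "eventually (\<lambda>z. z \<notin> inside ((\<lambda>z. p u + of_real k * z) ` etrack P C X)) (dirf (p u + of_real k * P v) (slot D w2 v j))"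
      using j 5 deg_new[OF 5(1)] by (intro eventually_not_inside_affine k compact_etrack[OF dr2 X2] free2) auto
    moreover have "v \<notin> W" using 5 NW by blast
    ultimately show ?thesis unfolding etrack_new[OF X2] using p'_new[of v] 5 by (simp add: slot_def w'_def)
  qed
qed

lemma attached: "dstate D (CY \<union> CY2) (W \<union> N) (F \<union> F2) p' c' w'"
  unfolding dstate_def using draw_all slots CY_all free_all by blast

end

lemma dstate_empty: "dstate D {} {} {} p c w"
  unfolding dstate_def is_draw_def by simp

lemma dstate_isolated:
  assumes S: "dstate D CY W F p c w" and x: "x \<notin> W"
  shows "\<exists>p w. dstate D CY (insert x W) F p c w"
proof -
  have dr: "is_draw W F p c"
    and w: "\<And>v. v \<in> W \<Longrightarrow> norm (w v) = 1" "\<And>v. v \<in> W \<Longrightarrow> edge_dirs F p c v = slot D w v ` {..<deg F v}"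
    and CY: "\<And>X. X \<in> CY \<Longrightarrow> X \<subseteq> F" "\<And>X. X \<in> CY \<Longrightarrow> inside (etrack p c X) \<inter> dpts W F p c = {}"
    and free: "\<And>v k X. v \<in> W \<Longrightarrow> deg F v \<le> k \<Longrightarrow> k < D v \<Longrightarrow> X \<in> CY \<Longrightarrow>
        eventually (\<lambda>z. z \<notin> inside (etrack p c X)) (dirf (p v) (slot D w v k))"
    using S unfolding dstate_def by simp_all
  obtain M where M: "M > 0" "\<forall>z\<in>dpts W F p c. norm z \<le> M"
    using compact_imp_bounded[OF compact_dpts[OF dr]] unfolding bounded_pos by blast
  \<comment> \<open>A point beyond a disc around the whole drawing is outside every cycle, and all
    slots of the new vertex are free.\<close>
  define q where "q = complex_of_real (M + 1)"
  define p' where "p' = p(x := q)"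
  define w' where "w' = w(x := 1)"
  have q: "norm q > M" unfolding q_def using M(1) by (simp only: norm_of_real)
  then have qK: "q \<notin> dpts W F p c" using M by force
  have p': "p' v = p v" "w' v = w v" if "v \<in> W" for v using that x unfolding p'_def w'_def by auto
  have q_out: "q \<in> outside (etrack p c X)" if "X \<subseteq> F" for X
  proof -
    have "etrack p c X \<subseteq> cball 0 M" using etrack_mono[OF dr that] M(2) by auto
    then have "- cball 0 M \<subseteq> outside (etrack p c X)" by (intro outside_subset_convex) auto
    then show ?thesis using q by auto
  qed
  have track: "etrack p' c X = etrack p c X" if "X \<subseteq> F" for X
  proof -
    have "etrack p' c X = (\<lambda>z. 0 + 1 * z) ` etrack p c X"
    proof (rule etrack_affine)
      fix a b assume "{a, b} \<in> X"
      then show "p' a = 0 + 1 * p a \<and> p' b = 0 + 1 * p b \<and> c a b = c a b"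
        using draw_edge[OF dr, of a b] that p' by auto
    qed simp
    then show ?thesis by simp
  qed
  have d1: "is_draw W F p' c" and pts: "dpts W F p' c = dpts W F p c"
    using is_draw_affine[OF dr, of 1 p' 0 c] p' by simp_all
  have d2: "is_draw {x} {} p' c" unfolding is_draw_def by simp
  have pts2: "dpts {x} {} p' c = {q}" unfolding dpts_def etrack_def p'_def by simp
  have "is_draw (W \<union> {x}) (F \<union> {}) p' c"
    using d1 d2 by (rule is_draw_union) (use qK in \<open>simp add: pts pts2\<close>)
  then have d: "is_draw (insert x W) F p' c" by simp
  have pts3: "dpts (insert x W) F p' c = insert q (dpts W F p c)"
  proof -
    have "p' ` W = p ` W" using p' by (intro image_cong) auto
    moreover have "p' x = q" unfolding p'_def by simp
    ultimately show ?thesis unfolding dpts_def track[OF order_refl] by simp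
  qed
  have nx: "nbrs F x = {}" using draw_edge[OF dr] x unfolding nbrs_def by blast
  have dirs: "edge_dirs F p' c v = edge_dirs F p c v" if "v \<in> W" for v
  proof (rule edge_dirs_affine[where b = 0 and k = 1])
    fix y assume y: "y \<in> nbrs F v"
    then have "y \<in> W" using draw_edge[OF dr, of v y] by (simp add: nbrs_def)
    then show "p' y = 0 + of_real 1 * p y \<and> c v y = c v y" using p' by simp
  qed (use that p' in auto)
  have "dstate D CY (insert x W) F p' c w'"
    unfolding dstate_def
  proof (intro conjI ballI allI impI; (elim conjE)?)
    show "is_draw (insert x W) F p' c" by (rule d)
    fix v assume v: "v \<in> insert x W"
    show "norm (w' v) = 1"
    proof (cases "v = x")
      case False
      then have "v \<in> W" using v by simp
      then show ?thesis using p'(2)[of v] w(1)[of v] by simp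
    qed (simp add: w'_def)
    show "edge_dirs F p' c v = slot D w' v ` {..<deg F v}"
    proof (cases "v = x")
      case True
      then show ?thesis using nx by (simp add: edge_dirs_def deg_def)
    next
      case False
      then have "v \<in> W" using v by simp
      from w(2)[OF this] show ?thesis using dirs[OF \<open>v \<in> W\<close>] p'(2)[OF \<open>v \<in> W\<close>] by (simp add: slot_def)
    qed
    fix k X assume k: "deg F v \<le> k" "k < D v" and X: "X \<in> CY"
    have XF: "X \<subseteq> F" using CY(1) X .
    show "eventually (\<lambda>z. z \<notin> inside (etrack p' c X)) (dirf (p' v) (slot D w' v k))"
    proof (cases "v = x")
      case True
      have "closed (- outside (etrack p c X))"
        using open_outside[OF compact_imp_closed[OF compact_etrack[OF dr XF]]] by (simp add: closed_def)
      then have "eventually (\<lambda>z. z \<notin> - outside (etrack p c X)) (dirf q (slot D w' v k))"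
        using q_out[OF XF] by (intro eventually_not_closed_dirf) auto
      then have "eventually (\<lambda>z. z \<notin> inside (etrack p c X)) (dirf q (slot D w' v k))"
        by (rule eventually_mono) (auto simp: outside_inside)
      moreover have "p' v = q" unfolding True p'_def by simp
      ultimately show ?thesis unfolding track[OF XF] by simp
    next
      case False
      then have "v \<in> W" using v by simp
      then have "eventually (\<lambda>z. z \<notin> inside (etrack p c X)) (dirf (p v) (slot D w v k))"
        using free k X by simp
      then show ?thesis unfolding track[OF XF] using p'[OF \<open>v \<in> W\<close>] by (simp add: slot_def)
    qed
  next
    fix X assume X: "X \<in> CY"
    show XF: "X \<subseteq> F" using CY(1) X .
    note CY(2)[OF X]
    moreover have "q \<notin> inside (etrack p c X)" using q_out[OF XF] unfolding outside_inside by blast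
    ultimately show "inside (etrack p' c X) \<inter> dpts (insert x W) F p' c = {}"
      unfolding track[OF XF] pts3 by blast
  qed
  then show ?thesis by blast
qed

lemma slot_inj:
  assumes "norm (w v) = 1" "j < k" "k < D v"
  shows "slot D w v j \<noteq> slot D w v k"
proof -
  have D: "real (D v) > 0" using assms by simp
  have "2 * pi * real k / real (D v) - 2 * pi * real j / real (D v) = 2 * pi * ((real k - real j) / real (D v))"
    using D by (simp add: field_simps)
  moreover obtain t where t: "t = (real k - real j) / real (D v)" by blast
  moreover have "0 < t" "t < 1" unfolding t using D assms by auto
  then have "0 < 2 * pi * t" "2 * pi * t < 2 * pi" by auto
  ultimately have "cis (2 * pi * real k / real (D v)) \<noteq> cis (2 * pi * real j / real (D v))"
    by (intro cis_neq) simp_all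
  then show ?thesis unfolding slot_def using assms(1) by auto
qed

lemma norm_slot: "norm (w v) = 1 \<Longrightarrow> norm (slot D w v k) = 1"
  unfolding slot_def by (simp add: norm_mult)

lemma carc_segment:
  assumes "z \<in> carc 0 d 1" "z \<noteq> 0" "norm d = 1"
  shows "sgn z = d"
proof -
  obtain s where s: "0 \<le> s" "s \<le> 1" "of_real (1 - s) * (z - 0) = of_real s * 1 * (d - z)"
    using assms(1) unfolding carc_def by blast
  then have "z = of_real s * d" by (simp add: algebra_simps)
  moreover have "s \<noteq> 0" using calculation assms(2) by auto
  ultimately show ?thesis using s assms(3) sgn_scale_unit[of s d] by simp
qed

lemma dstate_bridge:
  assumes S: "dstate D CY W F p c w" and u: "u \<in> W" and v: "v \<notin> W" and D: "deg F u < D u" "0 < D v"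
  shows "\<exists>p c w. dstate D CY (insert v W) (insert {u, v} F) p c w"
proof -
  have wu: "norm (w u) = 1" using S u unfolding dstate_def by simp
  have uv: "u \<noteq> v" using u v by auto
  define d where "d = slot D w u (deg F u)"
  have d: "norm d = 1" unfolding d_def using wu by (rule norm_slot[of w u])
  then have d0: "d \<noteq> 0" by auto
  have sd: "sgn d = d" using d by (simp add: sgn_div_norm)
  define P where "P x = (if x = v then d else 0)" for x
  define C :: "'a \<Rightarrow> 'a \<Rightarrow> complex" where "C = (\<lambda>_ _. 1)"
  have P: "P u = 0" "P v = d" unfolding P_def using uv by auto
  have edge: "{x, y} \<in> {{u, v}} \<longleftrightarrow> (x = u \<and> y = v) \<or> (x = v \<and> y = u)" for x y
    by (auto simp: doubleton_eq_iff)
  have nb: "nbrs {{u, v}} u = {v}" "nbrs {{u, v}} v = {u}"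
    unfolding nbrs_def edge using uv by auto
  have dg: "deg {{u, v}} u = 1" "deg {{u, v}} v = 1" unfolding deg_def nb by simp_all
  have trk: "etrack P C {{u, v}} = carc 0 d 1"
  proof -
    have "{carc (P x) (P y) (C x y) | x y. {x, y} \<in> {{u, v}}} = {carc (P u) (P v) 1, carc (P v) (P u) 1}"
      unfolding edge C_def by blast
    moreover have "carc d 0 1 = carc 0 d 1" using carc_swap[of 1 0 d] by simp
    ultimately show ?thesis unfolding etrack_def P by simp
  qed
  \<comment> \<open>The reference direction \<open>- d\<close> at \<open>v\<close> makes the edge
    back to \<open>u\<close> occupy slot \<open>0\<close> there.\<close>
  have "attachment D CY W F p c w u {v} {{u, v}} P C {} {d} (\<lambda>_. - d)"
  proof
    show "is_draw (insert u {v}) {{u, v}} P C"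
      unfolding is_draw_def
    proof (intro conjI allI impI ballI; (elim conjE)?)
      show "inj_on P (insert u {v})" using P d0 by (auto simp: inj_on_def)
      show "\<exists>x y. e = {x, y}" if "e \<in> {{u, v}}" for e using that by blast
      fix x y assume e: "{x, y} \<in> {{u, v}}"
      then have xy: "(x = u \<and> y = v) \<or> (x = v \<and> y = u)" unfolding edge .
      show "x \<noteq> y" "x \<in> insert u {v}" "y \<in> insert u {v}" using xy uv by auto
      show "norm (C x y) = 1" "C x y \<noteq> -1" "C y x = cnj (C x y)" unfolding C_def by simp_all
      show "z \<in> {x, y}" if "z \<in> insert u {v}" for z using e that by simp
      show "carc (P x) (P y) (C x y) \<inter> carc (P a) (P b) (C a b) \<subseteq> P ` ({x, y} \<inter> {a, b})"
        if "{a, b} \<in> {{u, v}}" "{x, y} \<noteq> {a, b}" for a b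
        using e that by simp
    qed simp
    show "sgn z \<in> {d}" if "z \<in> dpts (insert u {v}) {{u, v}} P C" "z \<noteq> 0" for z
    proof (cases "z \<in> carc 0 d 1")
      case True
      then show ?thesis using carc_segment that(2) d by simp
    next
      case False
      then have "z = d" using that P unfolding dpts_def trk by simp
      then show ?thesis using sd by simp
    qed
    show "edge_dirs {{u, v}} P C u = slot D w u ` {deg F u..<deg F u + deg {{u, v}} u}"
      unfolding edge_dirs_def nb dg by (simp add: C_def P sd d_def[symmetric])
    show "slot D w u k \<notin> {d}" if "k < D u" "k < deg F u \<or> deg F u + deg {{u, v}} u \<le> k" for k
    proof -
      have "k < deg F u \<or> deg F u < k" using that(2) unfolding dg by linarith
      then show ?thesis
        using slot_inj[of w u k "deg F u" D, OF wu] slot_inj[of w u "deg F u" k D, OF wu] D(1) that(1)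
        unfolding d_def by (elim disjE) simp_all
    qed
    fix x assume "x \<in> {v}"
    then have x: "x = v" by simp
    show "norm (- d) = 1 \<and> edge_dirs {{u, v}} P C x = slot D (\<lambda>_. - d) x ` {..<deg {{u, v}} x}"
    proof -
      have "{..<1::nat} = {0}" by auto
      then show ?thesis unfolding x edge_dirs_def nb dg using d sd by (simp add: C_def P slot_def sgn_minus)
    qed
  next
    show "dstate D CY W F p c w" by (rule S)
    show "u \<in> W" "{v} \<inter> W = {}" "P u = 0" using u v P by simp_all
    show "compact {d}" "connected {d}" "{d} \<subseteq> sphere 0 1" using d by simp_all
    show "0 < deg {{u, v}} u" "deg F u + deg {{u, v}} u \<le> D u" unfolding dg using D by simp_all
    show "slot D w u (deg F u) \<in> {d}" unfolding d_def by simp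
  qed simp_all
  from attachment.attached[OF this]
  have "\<exists>p c w. dstate D (CY \<union> {}) (W \<union> {v}) (F \<union> {{u, v}}) p c w" by (intro exI)
  then show ?thesis by simp
qed

section \<open>Drawing a cycle of the graph as a ring\<close>

lemma doubleton_in_cycle_edges:
  "{x, y} \<in> cycle_edges cs \<longleftrightarrow> (\<exists>i<length cs. (x = cs ! i \<and> y = cs ! ((i + 1) mod length cs))
     \<or> (y = cs ! i \<and> x = cs ! ((i + 1) mod length cs)))"
  unfolding cycle_edges_def by (auto simp: doubleton_eq_iff)

lemma mod_succ_succ_neq:
  assumes "3 \<le> n" "i < n"
  shows "((i + 1) mod n + 1) mod n \<noteq> (i :: nat)"
proof -
  consider "i + 1 < n" "i + 2 < n" | "i + 1 < n" "i + 2 = n" | "i + 1 = n" using assms by linarith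
  then show ?thesis using assms by cases auto
qed

context
  fixes cs :: "'v list"
  assumes dist: "distinct cs" and n: "3 \<le> length cs"
begin

lemma nbrs_cycle_edges:
  assumes i: "i < length cs"
  shows "nbrs (cycle_edges cs) (cs ! ((i + 1) mod length cs))
    = {cs ! (((i + 1) mod length cs + 1) mod length cs), cs ! i}"
proof
  let ?nx = "\<lambda>i. (i + 1) mod length cs"
  have nx_less: "?nx k < length cs" for k using n by (intro mod_less_divisor) linarith
  show "{cs ! ?nx (?nx i), cs ! i} \<subseteq> nbrs (cycle_edges cs) (cs ! ?nx i)"
  proof -
    have "{cs ! ?nx i, cs ! ?nx (?nx i)} \<in> cycle_edges cs" "{cs ! i, cs ! ?nx i} \<in> cycle_edges cs"
      unfolding cycle_edges_def using i nx_less[of i] by blast+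
    then show ?thesis unfolding nbrs_def by (simp add: insert_commute)
  qed
  show "nbrs (cycle_edges cs) (cs ! ?nx i) \<subseteq> {cs ! ?nx (?nx i), cs ! i}"
  proof
    fix y assume "y \<in> nbrs (cycle_edges cs) (cs ! ?nx i)"
    then obtain k where k: "k < length cs" "(cs ! ?nx i = cs ! k \<and> y = cs ! ?nx k) \<or> (y = cs ! k \<and> cs ! ?nx i = cs ! ?nx k)"
      unfolding nbrs_def doubleton_in_cycle_edges by auto
    from k(2) show "y \<in> {cs ! ?nx (?nx i), cs ! i}"
    proof
      assume "cs ! ?nx i = cs ! k \<and> y = cs ! ?nx k"
      moreover have "?nx i = k" using calculation nth_eq_iff_index_eq[OF dist nx_less k(1), of i] by simp
      ultimately show ?thesis by blast
    next
      assume *: "y = cs ! k \<and> cs ! ?nx i = cs ! ?nx k"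
      then have "?nx i = ?nx k" using nth_eq_iff_index_eq[OF dist nx_less nx_less, of i k] by simp
      then have "i = k" by (rule mod_succ_inj[OF i k(1)])
      with * show ?thesis by blast
    qed
  qed
qed

lemma deg_cycle_edges:
  assumes "i < length cs"
  shows "deg (cycle_edges cs) (cs ! i) = 2"
proof -
  let ?nx = "\<lambda>i. (i + 1) mod length cs"
  have nx_less: "?nx k < length cs" for k using n by (intro mod_less_divisor) linarith
  obtain k where k: "k < length cs" "?nx k = i" using mod_succ_surj[OF assms] by blast
  have "cs ! ?nx (?nx k) \<noteq> cs ! k"
    using nx_less[of "?nx k"] k(1) mod_succ_succ_neq[OF n k(1)] dist by (simp add: nth_eq_iff_index_eq)
  then show ?thesis unfolding deg_def k(2)[symmetric] nbrs_cycle_edges[OF k(1)] by simp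
qed

end

locale labelled_ring =
  fixes cs :: "'v list" and \<alpha> P0 C0
  assumes R: "arc_ring (length cs) \<alpha> P0 C0" and dist: "distinct cs"
begin

abbreviation "n \<equiv> length cs"

definition idx where "idx v = (THE i. i < n \<and> cs ! i = v)"

lemma idx: "i < n \<Longrightarrow> idx (cs ! i) = i"
  unfolding idx_def using dist by (intro the_equality) (auto simp: nth_eq_iff_index_eq)

definition P where "P v = P0 (idx v)"

text \<open>One value per ordered pair of neighbours: conjugate when the edge is run backwards.
  Since \<open>n\<close> is at least 3, the two orientations of an edge are never confused.\<close>

definition C where "C x y = (if idx y = (idx x + 1) mod n then C0 (idx x) else cnj (C0 (idx y)))"

abbreviation "nx i \<equiv> (i + 1) mod n"

lemma n: "3 \<le> n" by (rule ring_n[OF R])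

lemma nx_less: "nx i < n" by (rule ring_succ_less[OF R])

lemma nx_nx: "i < n \<Longrightarrow> nx (nx i) \<noteq> i" by (rule mod_succ_succ_neq[OF n])

lemma idx_nx: "idx (cs ! nx i) = nx i" by (rule idx[OF nx_less])

lemma C_forward: "i < n \<Longrightarrow> C (cs ! i) (cs ! nx i) = C0 i"
  unfolding C_def using idx idx_nx by simp

lemma C_backward: "i < n \<Longrightarrow> C (cs ! nx i) (cs ! i) = cnj (C0 i)"
  unfolding C_def using idx idx_nx nx_nx[of i] by auto

lemma carc_forward: "i < n \<Longrightarrow> carc (P (cs ! i)) (P (cs ! nx i)) (C (cs ! i) (cs ! nx i)) = rarc n P0 C0 i"
  unfolding rarc_def C_forward P_def idx idx_nx ..

lemma carc_backward: "i < n \<Longrightarrow> carc (P (cs ! nx i)) (P (cs ! i)) (C (cs ! nx i) (cs ! i)) = rarc n P0 C0 i"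
  unfolding rarc_def C_backward P_def idx idx_nx by (rule carc_swap[OF ring_norm[OF R]])

lemma edge_ex:
  assumes "{x, y} \<in> cycle_edges cs"
  shows "\<exists>i. i < n \<and> {x, y} = {cs ! i, cs ! nx i} \<and> carc (P x) (P y) (C x y) = rarc n P0 C0 i"
proof -
  obtain i where i: "i < n" "(x = cs ! i \<and> y = cs ! nx i) \<or> (y = cs ! i \<and> x = cs ! nx i)"
    using assms unfolding doubleton_in_cycle_edges by blast
  then have "{x, y} = {cs ! i, cs ! nx i}" by auto
  moreover have "carc (P x) (P y) (C x y) = rarc n P0 C0 i"
    using i(2) carc_forward[OF i(1)] carc_backward[OF i(1)] by (elim disjE) simp_all
  ultimately show ?thesis using i(1) by (intro exI[of _ i]) simp
qed

lemma etrack_ring: "etrack P C (cycle_edges cs) = rcurve n P0 C0"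
proof
  show "etrack P C (cycle_edges cs) \<subseteq> rcurve n P0 C0"
  proof
    fix z assume "z \<in> etrack P C (cycle_edges cs)"
    then obtain x y where "{x, y} \<in> cycle_edges cs" "z \<in> carc (P x) (P y) (C x y)"
      unfolding etrack_def by blast
    moreover from edge_ex[OF this(1)] obtain i where "i < n" "carc (P x) (P y) (C x y) = rarc n P0 C0 i" by blast
    ultimately show "z \<in> rcurve n P0 C0" unfolding rcurve_def by blast
  qed
  show "rcurve n P0 C0 \<subseteq> etrack P C (cycle_edges cs)"
  proof
    fix z assume "z \<in> rcurve n P0 C0"
    then obtain i where i: "i < n" "z \<in> rarc n P0 C0 i" unfolding rcurve_def by auto
    have "{cs ! i, cs ! nx i} \<in> cycle_edges cs" unfolding cycle_edges_def using i by blast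
    then show "z \<in> etrack P C (cycle_edges cs)"
      unfolding etrack_def using i(2) carc_forward[OF i(1)] by blast
  qed
qed

lemma P_vertex: "i < n \<Longrightarrow> P (cs ! i) = P0 i" unfolding P_def by (simp add: idx)

lemma image_P: "P ` set cs = P0 ` {..<n}"
  using P_vertex by (force simp: in_set_conv_nth image_iff)

lemma dpts_ring: "dpts (set cs) (cycle_edges cs) P C = rcurve n P0 C0"
  unfolding dpts_def etrack_ring image_P using ring_vertex_in_rcurve[OF R] by auto

lemma is_draw_ring: "is_draw (set cs) (cycle_edges cs) P C"
  unfolding is_draw_def
proof (intro conjI allI impI ballI; (elim conjE)?)
  show "\<exists>u v. e = {u, v}" if "e \<in> cycle_edges cs" for e using that unfolding cycle_edges_def by auto
  show "inj_on P (set cs)"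
  proof (rule inj_onI)
    fix x y assume "x \<in> set cs" "y \<in> set cs" and eq: "P x = P y"
    then obtain i j where ij: "i < n" "x = cs ! i" "j < n" "y = cs ! j" by (metis in_set_conv_nth)
    then show "x = y" using inj_onD[OF ring_inj[OF R], of i j] eq P_vertex[of i] P_vertex[of j] by simp
  qed
next
  fix u v assume e: "{u, v} \<in> cycle_edges cs"
  then obtain i where i: "i < n" "(u = cs ! i \<and> v = cs ! nx i) \<or> (v = cs ! i \<and> u = cs ! nx i)"
    unfolding doubleton_in_cycle_edges by blast
  have ne: "cs ! i \<noteq> cs ! nx i"
    using i(1) nx_less mod_succ_neq[OF n i(1)] dist by (simp add: nth_eq_iff_index_eq)
  have mem: "cs ! i \<in> set cs" "cs ! nx i \<in> set cs" using i(1) nx_less by simp_all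
  have c: "norm (C0 i) = 1" "C0 i \<noteq> -1" using ring_norm[OF R i(1)] ring_ne[OF R i(1)] .
  have "cnj (C0 i) \<noteq> -1" using c(2) by (metis complex_cnj_cnj complex_cnj_minus complex_cnj_one)
  then show "u \<noteq> v" "u \<in> set cs" "v \<in> set cs" "norm (C u v) = 1" "C u v \<noteq> -1" "C v u = cnj (C u v)"
    using i(2) ne mem c C_forward[OF i(1)] C_backward[OF i(1)] by (elim disjE; simp)+
next
  fix u v w assume e: "{u, v} \<in> cycle_edges cs" and w: "w \<in> set cs" "P w \<in> carc (P u) (P v) (C u v)"
  obtain i where i: "i < n" "{u, v} = {cs ! i, cs ! nx i}" "carc (P u) (P v) (C u v) = rarc n P0 C0 i"
    using edge_ex[OF e] by blast
  obtain k where k: "k < n" "w = cs ! k" using w(1) by (auto simp: in_set_conv_nth)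
  have "k = i \<or> k = nx i" using ring_vertex_arc[OF R k(1) i(1)] w(2) P_vertex[OF k(1)] k(2) i(3) by simp
  then show "w \<in> {u, v}" unfolding i(2) k(2) by blast
next
  fix u v x y assume e: "{u, v} \<in> cycle_edges cs" "{x, y} \<in> cycle_edges cs" "{u, v} \<noteq> {x, y}"
  obtain i where i: "i < n" "{u, v} = {cs ! i, cs ! nx i}" "carc (P u) (P v) (C u v) = rarc n P0 C0 i"
    using edge_ex[OF e(1)] by blast
  obtain j where j: "j < n" "{x, y} = {cs ! j, cs ! nx j}" "carc (P x) (P y) (C x y) = rarc n P0 C0 j"
    using edge_ex[OF e(2)] by blast
  have ij: "i \<noteq> j" using e(3) i(2) j(2) by auto
  have "rarc n P0 C0 i \<inter> rarc n P0 C0 j \<subseteq> P0 ` ({i, nx i} \<inter> {j, nx j})" by (rule ring_disj[OF R i(1) j(1) ij])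
  also have "\<dots> \<subseteq> P ` ({u, v} \<inter> {x, y})"
  proof
    fix z assume "z \<in> P0 ` ({i, nx i} \<inter> {j, nx j})"
    then obtain k where k: "z = P0 k" "k \<in> {i, nx i}" "k \<in> {j, nx j}" by blast
    then have "k < n" using i(1) nx_less[of i] by auto
    then have "z = P (cs ! k)" using k(1) P_vertex by simp
    moreover have "cs ! k \<in> {u, v} \<inter> {x, y}" unfolding i(2) j(2) using k(2,3) by auto
    ultimately show "z \<in> P ` ({u, v} \<inter> {x, y})" by blast
  qed
  finally show "carc (P u) (P v) (C u v) \<inter> carc (P x) (P y) (C x y) \<subseteq> P ` ({u, v} \<inter> {x, y})"
    unfolding i(3) j(3) .
qed simp

lemma nbrs_ring: "i < n \<Longrightarrow> nbrs (cycle_edges cs) (cs ! nx i) = {cs ! nx (nx i), cs ! i}"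
  by (rule nbrs_cycle_edges[OF dist n])

lemma deg_ring: "i < n \<Longrightarrow> deg (cycle_edges cs) (cs ! i) = 2"
  by (rule deg_cycle_edges[OF dist n])

lemma edge_dirs_ring:
  assumes i: "i < n"
  shows "edge_dirs (cycle_edges cs) P C (cs ! i) = {rout n P0 C0 i, rout n P0 C0 i * cis (\<alpha> i)}"
proof -
  obtain k where k: "k < n" "nx k = i" using mod_succ_surj[OF i] by blast
  have "sgn (P (cs ! nx i) - P (cs ! i)) * C (cs ! i) (cs ! nx i) = rout n P0 C0 i"
    unfolding rout_def C_forward[OF i] P_vertex[OF i] P_vertex[OF nx_less] ..
  moreover have "sgn (P (cs ! k) - P (cs ! i)) * C (cs ! i) (cs ! k) = rout n P0 C0 i * cis (\<alpha> i)"
    using ring_turn[OF R k(1)] C_backward[OF k(1)] unfolding k(2) P_vertex[OF i] P_vertex[OF k(1)]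
    by (simp add: mult.commute)
  ultimately show ?thesis
    unfolding edge_dirs_def using nbrs_ring[OF k(1)] unfolding k(2) by simp
qed

end

text \<open>Vertex \<open>cs ! 0\<close> has the smallest angle, as required by \<open>ring_exists\<close>; the attachment vertex is \<open>cs ! j\<close>.\<close>

lemma dstate_cycle_max:
  assumes S: "dstate D CY W F p c w" and j: "j < length cs" "cs ! j \<in> W" "set cs \<inter> W = {cs ! j}"
    and cs: "distinct cs" "3 \<le> length cs"
    and D: "deg F (cs ! j) + 2 \<le> D (cs ! j)" "\<And>i. i < length cs \<Longrightarrow> 2 \<le> D (cs ! i) \<and> D (cs ! i) \<le> D (cs ! 0)"
  shows "\<exists>p c w. dstate D (insert (cycle_edges cs) CY) (W \<union> set cs) (F \<union> cycle_edges cs) p c w"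
proof -
  let ?n = "length cs"
  define \<alpha> where "\<alpha> i = 2 * pi / real (D (cs ! i))" for i
  define u where "u = cs ! j"
  define \<omega> where "\<omega> = slot D w u (deg F u)"
  have wu: "norm (w u) = 1" using S j(2) unfolding dstate_def u_def by simp
  have \<omega>: "norm \<omega> = 1" unfolding \<omega>_def using wu by (rule norm_slot[of w u])
  have \<omega>0: "\<omega> \<noteq> 0" using \<omega> by auto
  have \<alpha>: "\<alpha> 0 \<le> \<alpha> i \<and> \<alpha> i \<le> pi" if "i < ?n" for i
    using D(2)[OF that] unfolding \<alpha>_def by (auto simp: field_simps)
  have \<alpha>0: "0 < \<alpha> i" if "i < ?n" for i using D(2)[OF that] unfolding \<alpha>_def by auto
  have n0: "0 < ?n" using cs(2) by linarith
  obtain P1 C1 where 1: "arc_ring ?n \<alpha> P1 C1" "ring_ext ?n \<alpha> P1 C1"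
    using ring_exists[of ?n \<alpha>, OF cs(2) \<alpha> \<alpha>0[OF n0]] by blast
  have "\<exists>P C. arc_ring ?n \<alpha> P C \<and> ring_ext ?n \<alpha> P C \<and> P j = 0 \<and> rout ?n P C j = \<omega> \<and>
    (\<forall>z\<in>rcurve ?n P C. z \<noteq> 0 \<longrightarrow> sgn z \<in> (\<lambda>x. \<omega> * cis x) ` {-\<alpha> j / 2..3 * \<alpha> j / 2})"
  \<comment> \<open>Degree 2 means a straight angle; from degree 3 on the angle is at most
    \<open>2 * pi / 3\<close>, as the cone construction requires.\<close>
  proof (cases "D (cs ! j) = 2")
    case True
    then show ?thesis by (intro ring_normalize_flat[OF 1 j(1) _ \<omega>]) (simp add: \<alpha>_def)
  next
    case False
    then have "3 \<le> D (cs ! j)" using D(2)[OF j(1)] by simp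
    then have "\<alpha> j \<le> 2 * pi / 3" unfolding \<alpha>_def by (intro divide_left_mono) auto
    then show ?thesis using \<alpha>0[OF j(1)] by (intro ring_normalize_sharp[OF 1 j(1) _ _ \<omega>])
  qed
  then obtain P0 C0 where R: "arc_ring ?n \<alpha> P0 C0" and ext: "ring_ext ?n \<alpha> P0 C0" and Pj: "P0 j = 0"
    and rj: "rout ?n P0 C0 j = \<omega>"
    and sector: "\<And>z. z \<in> rcurve ?n P0 C0 \<Longrightarrow> z \<noteq> 0 \<Longrightarrow> sgn z \<in> (\<lambda>x. \<omega> * cis x) ` {-\<alpha> j / 2..3 * \<alpha> j / 2}"
    by blast
  interpret labelled_ring cs \<alpha> P0 C0 using R cs(1) by unfold_locales
  \<comment> \<open>The two slots taken at \<open>u\<close> are at angles \<open>0\<close> and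
    \<open>\<alpha> j\<close>; half a slot is added on either side.\<close>
  define A where "A = (\<lambda>x. \<omega> * cis x) ` {-\<alpha> j / 2..3 * \<alpha> j / 2}"
  have cont: "continuous_on {-\<alpha> j / 2..3 * \<alpha> j / 2} (\<lambda>x. \<omega> * cis x)" by (intro continuous_intros)
  define w2 where "w2 v = rout ?n P0 C0 (idx v)" for v
  have ins: "insert u (set cs - {u}) = set cs" unfolding u_def using j(1) by auto
  have degu: "deg (cycle_edges cs) u = 2" unfolding u_def by (rule deg_ring[OF j(1)])
  have Du: "real (D u) > 0" using D(2)[OF j(1)] unfolding u_def by simp
  have slot_shift: "slot D w u k = \<omega> * cis ((real k - real (deg F u)) * \<alpha> j)" for k
  proof -
    have "2 * pi * real k / real (D u) = 2 * pi * real (deg F u) / real (D u) + (real k - real (deg F u)) * \<alpha> j"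
      unfolding \<alpha>_def u_def[symmetric] using Du by (simp add: field_simps)
    then show ?thesis unfolding slot_def \<omega>_def by (simp flip: cis_mult)
  qed
  have "attachment D CY W F p c w u (set cs - {u}) (cycle_edges cs) P C {cycle_edges cs} A w2"
  proof
    show "is_draw (insert u (set cs - {u})) (cycle_edges cs) P C" unfolding ins by (rule is_draw_ring)
    show "(set cs - {u}) \<inter> W = {}" using j(3) unfolding u_def by blast
    show "P u = 0" unfolding u_def P_vertex[OF j(1)] by (rule Pj)
    show "compact A" "connected A"
      unfolding A_def using cont by (auto intro: compact_continuous_image connected_continuous_image)
    show "A \<subseteq> sphere 0 1" unfolding A_def using \<omega> by (auto simp: norm_mult)
    show "sgn z \<in> A" if "z \<in> dpts (insert u (set cs - {u})) (cycle_edges cs) P C" "z \<noteq> 0" for z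
      using that sector unfolding ins dpts_ring A_def by blast
    show "X \<subseteq> cycle_edges cs \<and> inside (etrack P C X) \<inter> dpts (insert u (set cs - {u})) (cycle_edges cs) P C = {}"
      if "X \<in> {cycle_edges cs}" for X
      using that inside_no_overlap[of "rcurve ?n P0 C0"] unfolding ins dpts_ring by (simp add: etrack_ring)
    show "edge_dirs (cycle_edges cs) P C u = slot D w u ` {deg F u..<deg F u + deg (cycle_edges cs) u}"
    proof -
      have "{deg F u..<deg F u + 2} = {deg F u, deg F u + 1}" by auto
      then show ?thesis unfolding degu unfolding u_def edge_dirs_ring[OF j(1)] rj
        by (simp add: slot_shift[unfolded u_def])
    qed
    show "slot D w u (deg F u) \<in> A"
      unfolding slot_shift A_def using \<alpha>0[OF j(1)] by (intro image_eqI[of _ _ 0]) auto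
    \<comment> \<open>Measured from the first new slot, earlier slots have angles from
      \<open>- (D u - 2) * \<alpha> j\<close> to \<open>- \<alpha> j\<close> and later ones from
      \<open>2 * \<alpha> j\<close> to \<open>(D u - 1) * \<alpha> j\<close>. They differ from the
      angles of \<open>A\<close> by less than \<open>D u * \<alpha> j = 2 * pi\<close>, hence not by
      a full turn.\<close>
    show "slot D w u k \<notin> A" if k: "k < D u" "k < deg F u \<or> deg F u + deg (cycle_edges cs) u \<le> k" for k
    proof
      assume "slot D w u k \<in> A"
      then obtain x where x: "- \<alpha> j / 2 \<le> x" "x \<le> 3 * \<alpha> j / 2" "cis ((real k - real (deg F u)) * \<alpha> j) = cis x"
        unfolding slot_shift A_def using \<omega>0 by auto
      have full: "real (D u) * \<alpha> j = 2 * pi" unfolding \<alpha>_def u_def[symmetric] using Du by simp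
      note aj = \<alpha>0[OF j(1)]
      from k(2) show False
      proof
        assume "k < deg F u"
        then have "1 \<le> real (deg F u) - real k" "real (deg F u) - real k \<le> real (D u) - 2"
          using D(1) unfolding u_def by auto
        then have "1 * \<alpha> j \<le> (real (deg F u) - real k) * \<alpha> j" "(real (deg F u) - real k) * \<alpha> j \<le> (real (D u) - 2) * \<alpha> j"
          using aj by (auto intro!: mult_right_mono)
        then have "cis x \<noteq> cis ((real k - real (deg F u)) * \<alpha> j)"
          using x(1,2) full aj by (intro cis_neq) (simp_all add: algebra_simps)
        with x(3) show False by simp
      next
        assume "deg F u + deg (cycle_edges cs) u \<le> k"
        then have "2 \<le> real k - real (deg F u)" "real k - real (deg F u) \<le> real (D u) - 1"
          using k(1) unfolding degu by auto
        then have "2 * \<alpha> j \<le> (real k - real (deg F u)) * \<alpha> j" "(real k - real (deg F u)) * \<alpha> j \<le> (real (D u) - 1) * \<alpha> j"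
          using aj by (auto intro!: mult_right_mono)
        then have "cis ((real k - real (deg F u)) * \<alpha> j) \<noteq> cis x"
          using x(1,2) full aj by (intro cis_neq) (simp_all add: algebra_simps)
        with x(3) show False by simp
      qed
    qed
    fix v assume "v \<in> set cs - {u}"
    then obtain i where i: "i < ?n" "v = cs ! i" by (auto simp: in_set_conv_nth)
    have slot2: "slot D w2 v k = rout ?n P0 C0 i * cis (2 * pi * real k / real (D (cs ! i)))" for k
      unfolding slot_def w2_def i(2) idx[OF i(1)] ..
    have "{..<2} = {0::nat, 1}" by auto
    then have "edge_dirs (cycle_edges cs) P C v = slot D w2 v ` {..<deg (cycle_edges cs) v}"
      unfolding i(2) deg_ring[OF i(1)] edge_dirs_ring[OF i(1)] by (simp add: slot2[unfolded i(2)] \<alpha>_def)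
    then show "norm (w2 v) = 1 \<and> edge_dirs (cycle_edges cs) P C v = slot D w2 v ` {..<deg (cycle_edges cs) v}"
      unfolding w2_def i(2) idx[OF i(1)] using norm_rout[OF R i(1)] by simp
    fix k X assume k: "deg (cycle_edges cs) v \<le> k" "k < D v" and X: "X \<in> {cycle_edges cs}"
    \<comment> \<open>Slots \<open>0\<close> and \<open>1\<close> bound the wedge of the cycle; all
      further ones are at angles covered by \<open>ring_ext\<close>.\<close>
    have "2 \<le> k" using k(1) unfolding i(2) deg_ring[OF i(1)] .
    moreover have "real (D (cs ! i)) > 0" using D(2)[OF i(1)] by simp
    ultimately have "\<alpha> i < 2 * pi * real k / real (D (cs ! i)) \<and> 2 * pi * real k / real (D (cs ! i)) < 2 * pi"
      unfolding \<alpha>_def using k(2) i(2) by (auto simp: field_simps)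
    then have "eventually (\<lambda>z. z \<notin> inside (rcurve ?n P0 C0)) (dirf (P0 i) (rout ?n P0 C0 i * cis (2 * pi * real k / real (D (cs ! i)))))"
      using ext i(1) unfolding ring_ext_def by blast
    then show "eventually (\<lambda>z. z \<notin> inside (etrack P C X)) (dirf (P v) (slot D w2 v k))"
      using X unfolding slot2 by (simp add: etrack_ring P_vertex i)
  qed (use S j D(1) in \<open>auto simp: degu[unfolded u_def] u_def\<close>)
  from attachment.attached[OF this]
  have "\<exists>p c w. dstate D (CY \<union> {cycle_edges cs}) (W \<union> (set cs - {u})) (F \<union> cycle_edges cs) p c w"
    by (intro exI)
  moreover have "W \<union> (set cs - {u}) = W \<union> set cs" using j(2) unfolding u_def by blast
  ultimately show ?thesis by simp
qed

section \<open>Growing a subgraph of a cactus\<close>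

lemma cycle_edges_rotate: "cycle_edges (rotate k cs) = cycle_edges cs"
proof -
  have sub: "cycle_edges (rotate k cs) \<subseteq> cycle_edges cs" for k and cs :: "'a list"
  proof
    fix e assume "e \<in> cycle_edges (rotate k cs)"
    then obtain i where i: "i < length cs"
      "e = {rotate k cs ! i, rotate k cs ! ((i + 1) mod length cs)}"
      unfolding cycle_edges_def by auto
    then have pos: "0 < length cs" by linarith
    have "e = {cs ! ((k + i) mod length cs), cs ! (((k + i) mod length cs + 1) mod length cs)}"
      unfolding i(2) using i(1) pos nth_rotate[of i cs k] nth_rotate[of "(i + 1) mod length cs" cs k]
      by (simp add: mod_simps)
    then show "e \<in> cycle_edges cs" unfolding cycle_edges_def using pos by force
  qed
  have "cycle_edges cs \<subseteq> cycle_edges (rotate k cs)"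
  proof (cases "cs = []")
    case False
    then have "k \<le> length cs * k" by (cases cs) auto
    \<comment> \<open>This second rotation undoes the first, so the inclusion already shown gives
      the converse.\<close>
    then have "rotate (length cs * k - k) (rotate k cs) = rotate (length cs * k) cs"
      by (simp add: rotate_rotate)
    also have "\<dots> = cs" by (subst rotate_conv_mod) simp
    finally show ?thesis using sub[of "length cs * k - k" "rotate k cs"] by simp
  qed (simp add: cycle_edges_def)
  with sub[of k cs] show ?thesis by blast
qed

lemma cycle_edges_rev: "cycle_edges (rev cs) = cycle_edges cs"
proof -
  have sub: "cycle_edges (rev cs) \<subseteq> cycle_edges cs" for cs :: "'a list"
  proof
    fix e assume "e \<in> cycle_edges (rev cs)"
    then obtain i where i: "i < length cs" "e = {rev cs ! i, rev cs ! ((i + 1) mod length cs)}"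
      unfolding cycle_edges_def by auto
    show "e \<in> cycle_edges cs"
    proof (cases "i + 1 = length cs")
      case True
      then have "rev cs ! i = cs ! 0" "rev cs ! ((i + 1) mod length cs) = cs ! (length cs - 1)"
        using i(1) True rev_nth[of i cs] rev_nth[of 0 cs] by (cases "cs = []"; simp)+
      then have "e = {cs ! (length cs - 1), cs ! ((length cs - 1 + 1) mod length cs)}"
      proof -
        have "length cs - 1 + 1 = length cs" using i(1) by linarith
        then have "(length cs - 1 + 1) mod length cs = 0" by (simp only: mod_self)
        then show ?thesis unfolding i(2) \<open>rev cs ! i = cs ! 0\<close>
            \<open>rev cs ! ((i + 1) mod length cs) = cs ! (length cs - 1)\<close> by (simp add: insert_commute)
      qed
      then show ?thesis unfolding cycle_edges_def using i(1) by force
    next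
      case False
      define k where "k = length cs - Suc (Suc i)"
      have k: "k < length cs" "k + 1 < length cs" "length cs - Suc i = k + 1" "length cs - Suc (Suc i) = k"
        unfolding k_def using i(1) False by auto
      have "e = {cs ! k, cs ! ((k + 1) mod length cs)}"
        unfolding i(2) using i(1) False k rev_nth[of i cs] rev_nth[of "i + 1" cs] by auto
      then show ?thesis unfolding cycle_edges_def using k(1) by blast
    qed
  qed
  show ?thesis using sub[of cs] sub[of "rev cs"] by simp
qed

lemma is_cycle_iff:
  "is_cycle V E cs \<longleftrightarrow> 3 \<le> length cs \<and> distinct cs \<and> set cs \<subseteq> V \<and> cycle_edges cs \<subseteq> E"
  unfolding is_cycle_def cycle_edges_def by blast

lemma is_cycle_rotate: "is_cycle V E (rotate k cs) \<longleftrightarrow> is_cycle V E cs"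
  unfolding is_cycle_iff cycle_edges_rotate by simp

lemma is_cycle_rev: "is_cycle V E (rev cs) \<longleftrightarrow> is_cycle V E cs"
  unfolding is_cycle_iff cycle_edges_rev by simp

section \<open>Paths and cycles\<close>

abbreviation "adj E \<equiv> \<lambda>x y. {x, y} \<in> E"

lemma cycle_edges_path:
  assumes "successively (adj E) xs" "{last xs, hd xs} \<in> E"
  shows "cycle_edges xs \<subseteq> E"
proof
  fix e assume "e \<in> cycle_edges xs"
  then obtain i where i: "i < length xs" "e = {xs ! i, xs ! ((i + 1) mod length xs)}"
    unfolding cycle_edges_def by auto
  show "e \<in> E"
  proof (cases "i + 1 = length xs")
    case True
    then have "xs \<noteq> []" "i = length xs - 1" by auto
    then have "e = {last xs, hd xs}" unfolding i(2) using True by (simp add: last_conv_nth hd_conv_nth)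
    then show ?thesis using assms(2) by simp
  next
    case False
    then have "Suc i < length xs" using i(1) by simp
    then show ?thesis using assms(1) unfolding i(2) successively_conv_nth by simp
  qed
qed

lemma path_edge_in_cycle_edges: "Suc i < length xs \<Longrightarrow> {xs ! i, xs ! Suc i} \<in> cycle_edges xs"
  unfolding cycle_edges_def by (auto intro!: exI[of _ i])

lemma closing_edge_in_cycle_edges: "xs \<noteq> [] \<Longrightarrow> {last xs, hd xs} \<in> cycle_edges xs"
  unfolding cycle_edges_def by (auto intro!: exI[of _ "length xs - 1"] simp: last_conv_nth hd_conv_nth)

text \<open>A step back to a vertex of the path cuts the path off at that vertex.\<close>

lemma simple_path:
  assumes "(adj F)\<^sup>*\<^sup>* x y"
  shows "\<exists>xs. xs \<noteq> [] \<and> hd xs = x \<and> last xs = y \<and> distinct xs \<and> successively (adj F) xs"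
  using assms
proof (induction rule: rtranclp_induct)
  case base
  show ?case by (intro exI[of _ "[x]"]) simp
next
  case (step y z)
  then obtain xs where xs: "xs \<noteq> []" "hd xs = x" "last xs = y" "distinct xs" "successively (adj F) xs" by blast
  show ?case
  proof (cases "z \<in> set xs")
    case True
    then obtain as bs where "xs = as @ z # bs" by (meson split_list)
    then have "xs = (as @ [z]) @ bs" by simp
    then have "distinct (as @ [z])" "successively (adj F) (as @ [z])" "hd (as @ [z]) = x"
      using xs unfolding successively_append_iff[of _ "as @ [z]" bs] by (auto simp: successively_append_iff hd_append)
    then show ?thesis by (intro exI[of _ "as @ [z]"]) simp
  next
    case False
    then show ?thesis using xs step(2) by (intro exI[of _ "xs @ [z]"]) (auto simp: successively_append_iff)
  qed
qed

lemma adj_rtranclp_sym: "(adj F)\<^sup>*\<^sup>* x y \<Longrightarrow> (adj F)\<^sup>*\<^sup>* y x"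
  by (metis (no_types, lifting) insert_commute sympI symp_rtranclp sympD)

lemma adj_rtranclp_mono: "F \<subseteq> G \<Longrightarrow> (adj F)\<^sup>*\<^sup>* x y \<Longrightarrow> (adj G)\<^sup>*\<^sup>* x y"
  by (rule rtranclp_mono[THEN predicate2D, rotated]) auto

lemma cycle_reach:
  assumes "i < length cs"
  shows "(adj (cycle_edges cs))\<^sup>*\<^sup>* (cs ! 0) (cs ! i)"
  using assms
proof (induction i)
  case (Suc i)
  then have "(adj (cycle_edges cs))\<^sup>*\<^sup>* (cs ! 0) (cs ! i)" by simp
  moreover have "{cs ! i, cs ! Suc i} \<in> cycle_edges cs" using Suc.prems by (rule path_edge_in_cycle_edges)
  ultimately show ?case by (rule rtranclp.rtrancl_into_rtrancl)
qed simp

lemma path_vertices: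
  assumes "successively (adj F) xs" "\<And>x y. {x, y} \<in> F \<Longrightarrow> x \<in> W \<and> y \<in> W" "xs \<noteq> []" "hd xs \<in> W"
  shows "set xs \<subseteq> W"
proof
  fix v assume "v \<in> set xs"
  then obtain i where i: "i < length xs" "v = xs ! i" by (auto simp: in_set_conv_nth)
  show "v \<in> W"
  proof (cases i)
    case 0
    then show ?thesis using i assms(3,4) by (simp add: hd_conv_nth)
  next
    case (Suc k)
    then have "{xs ! k, xs ! i} \<in> F" using assms(1) i(1) unfolding successively_conv_nth by simp
    then show ?thesis using assms(2) i(2) by blast
  qed
qed

lemma successively_adj_mono: "F \<subseteq> G \<Longrightarrow> successively (adj F) xs \<Longrightarrow> successively (adj G) xs"
  unfolding successively_conv_nth by auto

lemma successively_adj_nth: "successively (adj F) xs \<Longrightarrow> Suc i < length xs \<Longrightarrow> {xs ! i, xs ! Suc i} \<in> F"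
  unfolding successively_conv_nth by simp

text \<open>The last condition (no cycle is drawn partially) together with the connectivity condition makes \<open>F\<close> the
  subgraph induced on \<open>W\<close> and lets a cycle leaving \<open>W\<close> meet it in one vertex only.\<close>

definition grown :: "'v set \<Rightarrow> 'v set set \<Rightarrow> 'v set \<Rightarrow> 'v set set \<Rightarrow> bool" where
  "grown V E W F \<longleftrightarrow> W \<subseteq> V \<and> F \<subseteq> E \<and> (\<forall>x y. {x, y} \<in> F \<longrightarrow> x \<in> W \<and> y \<in> W) \<and>
     (\<forall>x\<in>W. \<forall>y\<in>W. (adj E)\<^sup>*\<^sup>* x y \<longrightarrow> (adj F)\<^sup>*\<^sup>* x y) \<and>
     (\<forall>cs. is_cycle V E cs \<and> cycle_edges cs \<inter> F \<noteq> {} \<longrightarrow> cycle_edges cs \<subseteq> F)"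

context
  fixes V :: "'v set" and E W F
  assumes G: "grown V E W F"
begin

lemma grown_W: "W \<subseteq> V"
  and grown_F: "F \<subseteq> E"
  and grown_edge: "{x, y} \<in> F \<Longrightarrow> x \<in> W \<and> y \<in> W"
  and grown_reach: "x \<in> W \<Longrightarrow> y \<in> W \<Longrightarrow> (adj E)\<^sup>*\<^sup>* x y \<Longrightarrow> (adj F)\<^sup>*\<^sup>* x y"
  and grown_cycle: "is_cycle V E cs \<Longrightarrow> e \<in> cycle_edges cs \<Longrightarrow> e \<in> F \<Longrightarrow> cycle_edges cs \<subseteq> F"
proof -
  note g = G[unfolded grown_def]
  show "W \<subseteq> V" using g by (elim conjE)
  show "F \<subseteq> E" using g by (elim conjE)
  have 1: "\<forall>x y. {x, y} \<in> F \<longrightarrow> x \<in> W \<and> y \<in> W" using g by (elim conjE)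
  show "x \<in> W \<and> y \<in> W" if "{x, y} \<in> F" by (rule 1[rule_format, OF that])
  have 2: "\<forall>x\<in>W. \<forall>y\<in>W. (adj E)\<^sup>*\<^sup>* x y \<longrightarrow> (adj F)\<^sup>*\<^sup>* x y" using g by (elim conjE)
  show "(adj F)\<^sup>*\<^sup>* x y" if "x \<in> W" "y \<in> W" "(adj E)\<^sup>*\<^sup>* x y" by (rule 2[rule_format, OF that])
  have 3: "\<forall>cs. is_cycle V E cs \<and> cycle_edges cs \<inter> F \<noteq> {} \<longrightarrow> cycle_edges cs \<subseteq> F" using g by (elim conjE)
  show "cycle_edges cs \<subseteq> F" if "is_cycle V E cs" "e \<in> cycle_edges cs" "e \<in> F"
    by (rule 3[rule_format]) (use that in blast)
qed

text \<open>A simple path in \<open>F\<close> from \<open>x\<close> to \<open>y\<close> either is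
  the edge itself or is closed by it to a cycle that has an edge in \<open>F\<close>, and therefore
  all its edges.\<close>

lemma grown_induced:
  assumes e: "{x, y} \<in> E" and xy: "x \<noteq> y" "x \<in> W" "y \<in> W"
  shows "{x, y} \<in> F"
proof -
  have "(adj F)\<^sup>*\<^sup>* x y" by (rule grown_reach[OF xy(2,3)], rule r_into_rtranclp, rule e)
  from simple_path[OF this] obtain xs where xs: "xs \<noteq> []" "hd xs = x" "last xs = y" "distinct xs" "successively (adj F) xs"
    by (elim exE conjE)
  have W: "set xs \<subseteq> W" by (rule path_vertices[OF xs(5) grown_edge xs(1)]) (simp_all add: xs(2) xy(2))
  have len: "2 \<le> length xs"
  proof (cases xs)
    case (Cons a as)
    then show ?thesis using xs(2,3) xy(1) by (cases as) auto
  qed (use xs(1) in simp)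
  have e01: "{xs ! 0, xs ! Suc 0} \<in> F" by (rule successively_adj_nth[OF xs(5)]) (use len in simp)
  show ?thesis
  proof (cases "length xs = 2")
    case True
    then have "xs ! 0 = x" "xs ! Suc 0 = y"
      using xs(1-3) by (simp_all add: hd_conv_nth last_conv_nth)
    then show ?thesis using e01 by simp
  next
    case False
    have "successively (adj E) xs" by (rule successively_adj_mono[OF grown_F xs(5)])
    moreover have "{last xs, hd xs} \<in> E" using e xs by (simp add: insert_commute)
    ultimately have "is_cycle V E xs"
      unfolding is_cycle_iff using cycle_edges_path[of E xs] False len xs(4) W grown_W by simp
    moreover have "{xs ! 0, xs ! Suc 0} \<in> cycle_edges xs" using len by (intro path_edge_in_cycle_edges) simp
    ultimately have "cycle_edges xs \<subseteq> F" using grown_cycle[of xs "{xs ! 0, xs ! Suc 0}"] e01 by simp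
    then have "{y, x} \<in> F" using closing_edge_in_cycle_edges[OF xs(1)] unfolding xs(2,3) by (rule subsetD)
    then show ?thesis by (simp add: insert_commute)
  qed
qed

text \<open>A second visit to \<open>W\<close> could be joined back to \<open>cs ! 0\<close> inside
  \<open>F\<close>. The resulting cycle has an edge in \<open>F\<close>, hence lies in
  \<open>F\<close>, although its first edge leads out of \<open>W\<close>.\<close>

lemma grown_cycle_meets:
  assumes cs: "is_cycle V E cs" and u: "cs ! 0 \<in> W" and v: "cs ! 1 \<notin> W"
  shows "set cs \<inter> W = {cs ! 0}"
proof (rule ccontr)
  have len: "3 \<le> length cs" and dist: "distinct cs" and sub: "set cs \<subseteq> V" "cycle_edges cs \<subseteq> E"
    using cs unfolding is_cycle_iff by auto
  have l0: "0 < length cs" using len by linarith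
  then have "cs ! 0 \<in> set cs" by simp
  moreover assume "set cs \<inter> W \<noteq> {cs ! 0}"
  ultimately obtain y where y: "y \<in> set cs" "y \<in> W" "y \<noteq> cs ! 0" using u by blast
  then obtain i where i: "i < length cs" "cs ! i = y" by (auto simp: in_set_conv_nth)
  then have "0 < i \<and> i < length cs \<and> cs ! i \<in> W" using y by (cases i) auto
  then have ex: "\<exists>j. 0 < j \<and> j < length cs \<and> cs ! j \<in> W" by blast
  \<comment> \<open>The first return to \<open>W\<close>; minimality keeps the initial stretch of
    \<open>cs\<close> disjoint from the path in \<open>F\<close>, apart from
    \<open>cs ! 0\<close>.\<close>
  define j where "j = (LEAST j. 0 < j \<and> j < length cs \<and> cs ! j \<in> W)"
  have j: "0 < j" "j < length cs" "cs ! j \<in> W"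
    using LeastI_ex[OF ex] unfolding j_def by auto
  have least: "cs ! k \<notin> W" if "0 < k" "k < j" for k
    using not_less_Least[of k "\<lambda>j. 0 < j \<and> j < length cs \<and> cs ! j \<in> W"] that j(2) unfolding j_def by auto
  have j2: "2 \<le> j" using j(1,3) v by (cases "j = 1") auto
  have "(adj E)\<^sup>*\<^sup>* (cs ! j) (cs ! 0)"
    by (rule adj_rtranclp_sym, rule adj_rtranclp_mono[OF sub(2)], rule cycle_reach[OF j(2)])
  then have "(adj F)\<^sup>*\<^sup>* (cs ! j) (cs ! 0)" by (rule grown_reach[OF j(3) u])
  from simple_path[OF this] obtain xs
    where xs: "xs \<noteq> []" "hd xs = cs ! j" "last xs = cs ! 0" "distinct xs" "successively (adj F) xs"
    by (elim exE conjE)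
  have W: "set xs \<subseteq> W" by (rule path_vertices[OF xs(5) grown_edge xs(1)]) (simp_all add: xs(2) j(3))
  have ne: "cs ! j \<noteq> cs ! 0" using dist j(1,2) l0 by (simp add: nth_eq_iff_index_eq)
  obtain ys where ys: "xs = ys @ [cs ! 0]" using xs(1,3) by (metis append_butlast_last_id)
  have ys0: "ys \<noteq> []" using ys xs(2) ne by auto
  define zs where "zs = take j cs @ ys"
  have tk: "take j cs \<noteq> []" "hd (take j cs) = cs ! 0" "last (take j cs) = cs ! (j - 1)"
  proof -
    show ne: "take j cs \<noteq> []" using j by auto
    show "hd (take j cs) = cs ! 0" unfolding hd_conv_nth[OF ne] using j(1) by simp
    show "last (take j cs) = cs ! (j - 1)" unfolding last_conv_nth[OF ne] using j(1,2) by simp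
  qed
  have hys: "hd ys = cs ! j" using xs(2) ys ys0 by simp
  have FE: "successively (adj E) xs" by (rule successively_adj_mono[OF grown_F xs(5)])
  have lastF: "{last ys, cs ! 0} \<in> F" using xs(5) ys0 unfolding ys successively_append_iff by simp
  have "distinct zs"
  proof -
    have "x \<notin> set ys" if "x \<in> set (take j cs)" for x
    proof -
      obtain k where k: "k < j" "x = cs ! k" using \<open>x \<in> set (take j cs)\<close> j(2) by (auto simp: in_set_conv_nth)
      show ?thesis
      proof (cases k)
        case 0
        then show ?thesis using xs(4) k unfolding ys by simp
      next
        case (Suc m)
        then show ?thesis using least[of k] k W unfolding ys by auto
      qed
    qed
    then show ?thesis unfolding zs_def using dist xs(4) unfolding ys by auto
  qed
  moreover have "successively (adj E) zs"
  proof -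
    have step: "{cs ! k, cs ! Suc k} \<in> E" if "Suc k < length cs" for k
      by (rule subsetD[OF sub(2) path_edge_in_cycle_edges[OF that]])
    have "successively (adj E) (take j cs)"
      unfolding successively_conv_nth using step j(2) by simp
    moreover have "{last (take j cs), hd ys} \<in> E"
      unfolding tk(3) hys using step[of "j - 1"] j(1,2) by simp
    moreover have "successively (adj E) ys" using FE unfolding ys successively_append_iff by simp
    ultimately show ?thesis unfolding zs_def successively_append_iff by simp
  qed
  moreover have last_zs: "last zs = last ys" "hd zs = cs ! 0" unfolding zs_def using tk ys0 by auto
  have "set ys \<subseteq> V" using W grown_W unfolding ys by auto
  then have "set zs \<subseteq> V" unfolding zs_def using sub(1) set_take_subset[of j cs] by auto
  moreover have "3 \<le> length zs" unfolding zs_def using j j2 ys0 by (cases ys) auto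
  moreover have "{last zs, hd zs} \<in> E" unfolding last_zs using lastF grown_F by blast
  ultimately have cyc: "is_cycle V E zs" unfolding is_cycle_iff using cycle_edges_path[of E zs] by simp
  have "zs \<noteq> []" unfolding zs_def using tk by simp
  then have "{last ys, cs ! 0} \<in> cycle_edges zs" using closing_edge_in_cycle_edges[of zs] unfolding last_zs by simp
  then have "cycle_edges zs \<subseteq> F" using grown_cycle[OF cyc] lastF by simp
  moreover have "{zs ! 0, zs ! Suc 0} \<in> cycle_edges zs" using \<open>3 \<le> length zs\<close> by (intro path_edge_in_cycle_edges) simp
  ultimately have "{zs ! 0, zs ! Suc 0} \<in> F" by blast
  moreover have "zs ! Suc 0 = cs ! 1" unfolding zs_def using j2 j(2) by (simp add: nth_append)
  ultimately show False using grown_edge[of "zs ! 0" "zs ! Suc 0"] v by simp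
qed

end

section \<open>Parametrised circular arcs\<close>

text \<open>Uniform motion on the circle: the angle \<open>Arg c\<close> between chord and tangent
  corresponds to the central angle \<open>2 * Arg c\<close>. For \<open>c = 1\<close> the circle
  degenerates to a segment. Being defined for all real \<open>t\<close>, the path has the two-sided
  derivative at \<open>0\<close> that the Lombardi condition uses.\<close>

definition epath :: "complex \<Rightarrow> complex \<Rightarrow> complex \<Rightarrow> real \<Rightarrow> complex" where
  "epath a b c = (if c = 1 then linepath a b
     else (\<lambda>t. a + (b - a) * (1 - cis (- 2 * Arg c * t)) / (1 - cis (- 2 * Arg c))))"

lemma one_minus_cis: "1 - cis (- 2 * x) = 2 * \<i> * of_real (sin x) * cis (- x)"
proof -
  have "1 - cis (- 2 * x) = (cis x - cis (- x)) * cis (- x)"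
    by (simp add: left_diff_distrib cis_mult)
  also have "cis x - cis (- x) = 2 * \<i> * of_real (sin x)"
    by (simp add: complex_eq_iff)
  finally show ?thesis .
qed

context
  fixes a b c :: complex
  assumes ab: "a \<noteq> b" and c: "norm c = 1" "c \<noteq> -1"
begin

lemma cis_Arg_unit: "cis (Arg c) = c"
proof -
  have "c \<noteq> 0" using c(1) by auto
  then have "cis (Arg c) = sgn c" by (rule cis_Arg)
  then show ?thesis using c(1) by (simp add: sgn_div_norm)
qed

lemma Arg_unit_less: "\<bar>Arg c\<bar> < pi"
proof -
  have "Arg c \<noteq> pi" using cis_Arg_unit c(2) by (metis cis_pi)
  then show ?thesis using Arg_bounded[of c] by auto
qed

lemma Arg_unit_nz: "c \<noteq> 1 \<Longrightarrow> Arg c \<noteq> 0"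
  using cis_Arg_unit by (metis cis_zero)

lemma sin_ratio_pos:
  assumes "x \<noteq> 0" "\<bar>x\<bar> < pi"
  shows "x / sin x > 0" "sin x \<noteq> 0"
proof -
  have "0 < sin x \<and> 0 < x \<or> sin x < 0 \<and> x < 0"
    using assms sin_gt_zero[of x] sin_gt_zero[of "- x"] by (cases "x > 0") auto
  then show "x / sin x > 0" "sin x \<noteq> 0" by (auto simp: zero_less_divide_iff)
qed

text \<open>The quotient of the two differences is a real quotient of sines times
  \<open>cis (Arg c) = c\<close>, which is the equation of \<open>carc\<close>.\<close>

lemma epath_sin:
  assumes "c \<noteq> 1"
  shows "epath a b c t - a = (b - a) * of_real (sin (Arg c * t) / sin (Arg c)) * cis (Arg c * (1 - t))"
    "b - epath a b c t = (b - a) * of_real (sin (Arg c * (1 - t)) / sin (Arg c)) * cis (- Arg c * t)"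
proof -
  let ?e = "Arg c"
  have s: "sin ?e \<noteq> 0" using sin_ratio_pos(2)[OF Arg_unit_nz[OF assms] Arg_unit_less] .
  have 1: "1 - cis (- 2 * ?e * t) = 2 * \<i> * of_real (sin (?e * t)) * cis (- (?e * t))"
    using one_minus_cis[of "?e * t"] by (simp add: mult.assoc)
  have d: "1 - cis (- 2 * ?e) = 2 * \<i> * of_real (sin ?e) * cis (- ?e)" by (rule one_minus_cis)
  have q: "cis (- (?e * t)) / cis (- ?e) = cis (?e * (1 - t))"
    unfolding cis_divide by (simp add: algebra_simps)
  have "epath a b c t - a = (b - a) * (1 - cis (- 2 * ?e * t)) / (1 - cis (- 2 * ?e))"
    unfolding epath_def using assms by simp
  also have "\<dots> = (b - a) * of_real (sin (?e * t) / sin ?e) * (cis (- (?e * t)) / cis (- ?e))"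
    unfolding 1 d using s by (simp add: field_simps)
  finally show "epath a b c t - a = (b - a) * of_real (sin (?e * t) / sin ?e) * cis (?e * (1 - t))"
    unfolding q .
  have d0: "1 - cis (- 2 * ?e) \<noteq> 0" unfolding d using s by simp
  have 2: "cis (- 2 * ?e * t) - cis (- 2 * ?e) = cis (- 2 * ?e * t) * (1 - cis (- 2 * (?e * (1 - t))))"
    by (simp add: right_diff_distrib cis_mult)
  have "b - epath a b c t = (b - a) * (cis (- 2 * ?e * t) - cis (- 2 * ?e)) / (1 - cis (- 2 * ?e))"
    unfolding epath_def using assms d0 by (simp add: field_simps)
  also have "\<dots> = (b - a) * of_real (sin (?e * (1 - t)) / sin ?e)
      * (cis (- 2 * ?e * t) * cis (- (?e * (1 - t))) / cis (- ?e))"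
    unfolding 2 one_minus_cis[of "?e * (1 - t)"] d using s by (simp add: field_simps)
  also have "cis (- 2 * ?e * t) * cis (- (?e * (1 - t))) / cis (- ?e) = cis (- ?e * t)"
    unfolding cis_mult cis_divide by (simp add: algebra_simps)
  finally show "b - epath a b c t = (b - a) * of_real (sin (?e * (1 - t)) / sin ?e) * cis (- ?e * t)" .
qed

lemma pathstart_epath: "pathstart (epath a b c) = a"
  unfolding epath_def pathstart_def by (simp add: linepath_def)

lemma pathfinish_epath: "pathfinish (epath a b c) = b"
proof (cases "c = 1")
  case False
  then have "b - epath a b c 1 = 0" using epath_sin(2)[OF False, of 1] by simp
  then show ?thesis unfolding pathfinish_def by simp
qed (simp add: epath_def)

lemma circ_arc_epath: "circ_arc (epath a b c)"
proof (cases "c = 1")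
  case True
  then show ?thesis unfolding circ_arc_def epath_def using ab by auto
next
  case False
  let ?e = "Arg c"
  \<comment> \<open>The circle has centre \<open>a + k\<close> and radius \<open>norm k\<close>. The
    swept angle \<open>- 2 * Arg c\<close> is less than a full turn because
    \<open>c \<noteq> -1\<close>.\<close>
  define k where "k = (b - a) / (1 - cis (- 2 * ?e))"
  have s: "sin ?e \<noteq> 0" using sin_ratio_pos(2)[OF Arg_unit_nz[OF False] Arg_unit_less] .
  then have k: "k \<noteq> 0" unfolding k_def one_minus_cis using ab by simp
  have "epath a b c = (\<lambda>t. (a + k) + of_real (norm k) * cis (Arg (- k) + t * ((Arg (- k) - 2 * ?e) - Arg (- k))))"
  proof
    fix t
    have k': "of_real (norm k) * cis (Arg (- k)) = - k"
      using k cis_Arg[of "- k"] by (simp add: sgn_eq)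
    have arg: "Arg (- k) + t * ((Arg (- k) - 2 * ?e) - Arg (- k)) = Arg (- k) + - 2 * ?e * t" by simp
    have rot: "of_real (norm k) * cis (Arg (- k) + t * ((Arg (- k) - 2 * ?e) - Arg (- k))) = - k * cis (- 2 * ?e * t)"
      unfolding arg cis_mult[symmetric] mult.assoc[symmetric] k' ..
    have "epath a b c t = a + k * (1 - cis (- 2 * ?e * t))"
      unfolding epath_def k_def using False by simp
    then show "epath a b c t = (a + k) + of_real (norm k) * cis (Arg (- k) + t * ((Arg (- k) - 2 * ?e) - Arg (- k)))"
      unfolding rot by (simp add: algebra_simps)
  qed
  moreover have "norm k > 0" "Arg (- k) \<noteq> Arg (- k) - 2 * ?e" "\<bar>(Arg (- k) - 2 * ?e) - Arg (- k)\<bar> < 2 * pi"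
    using k Arg_unit_nz[OF False] Arg_unit_less by auto
  ultimately show ?thesis unfolding circ_arc_def by blast
qed

text \<open>For \<open>c \<noteq> 1\<close>, \<open>epath\<close> is \<open>cpt\<close> after a
  continuous change of parameter that fixes \<open>0\<close> and \<open>1\<close>; the intermediate
  value theorem makes it onto.\<close>

lemma path_image_epath: "path_image (epath a b c) = carc a b c"
proof (cases "c = 1")
  case True
  have cpt: "cpt a b 1 s = linepath a b s" for s
    unfolding cpt_def linepath_def by (simp add: scaleR_conv_of_real)
  show ?thesis
    using carc_eq_image[of 1 a b] cpt unfolding path_image_def epath_def True by simp
next
  case False
  let ?e = "Arg c"
  note e0 = Arg_unit_nz[OF False]
  have s: "sin ?e \<noteq> 0" using sin_ratio_pos(2)[OF e0 Arg_unit_less] .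
  define f g where "f t = sin (?e * t) / sin ?e" and "g t = sin (?e * (1 - t)) / sin ?e" for t
  have pos: "sin (?e * t) / sin ?e \<ge> 0" if "0 \<le> t" "t \<le> 1" for t
  proof (cases "?e > 0")
    case True
    have "?e * t \<le> ?e" using mult_left_mono[of t 1 ?e] that True by simp
    then have "?e * t \<le> pi" using Arg_unit_less by linarith
    moreover have "0 \<le> ?e * t" using that True by simp
    ultimately have "sin (?e * t) \<ge> 0" by (intro sin_ge_zero)
    moreover have "sin ?e \<ge> 0" using True Arg_unit_less by (intro sin_ge_zero) auto
    ultimately show ?thesis by simp
  next
    case False
    have "- ?e * t \<le> - ?e" using mult_left_mono[of t 1 "- ?e"] that False by simp
    then have "- (?e * t) \<le> pi" using Arg_unit_less by linarith
    moreover have "0 \<le> - (?e * t)" using that False by (simp add: mult_le_0_iff)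
    ultimately have "sin (- (?e * t)) \<ge> 0" by (intro sin_ge_zero)
    moreover have "sin (- ?e) \<ge> 0" using False Arg_unit_less by (intro sin_ge_zero) auto
    ultimately show ?thesis by (simp add: divide_nonpos_nonpos)
  qed
  have fg0: "f t \<ge> 0" "g t \<ge> 0" if "0 \<le> t" "t \<le> 1" for t
    using pos[of t] pos[of "1 - t"] that unfolding f_def g_def by auto
  have sum: "f t + g t > 0" if t: "0 \<le> t" "t \<le> 1" for t
  proof (rule ccontr)
    assume "\<not> f t + g t > 0"
    then have "f t = 0" "g t = 0" using fg0[OF t] by linarith+
    then have "sin (?e * t) = 0" "sin (?e * (1 - t)) = 0" using s unfolding f_def g_def by simp_all
    moreover have "sin ?e = sin (?e * t) * cos (?e * (1 - t)) + cos (?e * t) * sin (?e * (1 - t))"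
      unfolding sin_add[symmetric] by (simp add: algebra_simps)
    ultimately show False using s by simp
  qed
  have eq: "of_real (g t) * (epath a b c t - a) = of_real (f t) * c * (b - epath a b c t)" for t
  proof -
    have "of_real (g t) * (epath a b c t - a) = (b - a) * of_real (f t) * of_real (g t) * cis (?e * (1 - t))"
      unfolding epath_sin(1)[OF False] f_def g_def by simp
    also have "cis (?e * (1 - t)) = c * cis (- ?e * t)"
      using cis_mult[of ?e "- ?e * t"] unfolding cis_Arg_unit by (simp add: algebra_simps)
    finally show ?thesis unfolding epath_sin(2)[OF False] f_def g_def by simp
  qed
  define h where "h t = f t / (f t + g t)" for t
  have h: "0 \<le> h t" "h t \<le> 1" "epath a b c t = cpt a b c (h t)" if t: "0 \<le> t" "t \<le> 1" for t
  proof -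
    have h1: "1 - h t = g t / (f t + g t)" unfolding h_def using sum[OF t] by (simp add: field_simps)
    show "0 \<le> h t" unfolding h_def using fg0[OF t] by simp
    have "0 \<le> 1 - h t" unfolding h1 using fg0[OF t] by simp
    then show "h t \<le> 1" by simp
    have "of_real (1 - h t) * (epath a b c t - a) = of_real (g t) * (epath a b c t - a) / of_real (f t + g t)"
      unfolding h1 by simp
    also have "\<dots> = of_real (h t) * c * (b - epath a b c t)" unfolding eq h_def by simp
    finally have "of_real (1 - h t) * (epath a b c t - a) = of_real (h t) * c * (b - epath a b c t)" .
    then show "epath a b c t = cpt a b c (h t)"
      unfolding cpt_def using cpt_denom_nonzero[OF c \<open>0 \<le> h t\<close> \<open>h t \<le> 1\<close>] by (simp add: eq_divide_eq algebra_simps)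
  qed
  have "h ` {0..1} = {0..1}"
  proof
    show "h ` {0..1} \<subseteq> {0..1}" using h by auto
    show "{0..1} \<subseteq> h ` {0..1}"
    proof
      fix y :: real assume y: "y \<in> {0..1}"
      have "continuous_on {0..1} h"
        unfolding h_def f_def g_def using s sum unfolding f_def g_def
        by (intro continuous_intros) force+
      moreover have "h 0 = 0" "h 1 = 1" unfolding h_def f_def g_def using s by simp_all
      ultimately obtain t where "0 \<le> t" "t \<le> 1" "h t = y" using IVT'[of h 0 y 1] y by auto
      then show "y \<in> h ` {0..1}" by auto
    qed
  qed
  then have "cpt a b c ` {0..1} = (\<lambda>t. cpt a b c (h t)) ` {0..1}" by (metis image_image)
  also have "\<dots> = epath a b c ` {0..1}" using h by (intro image_cong) auto
  finally show ?thesis unfolding path_image_def carc_eq_image[OF c] by simp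
qed

lemma epath_tangent: "sgn (vector_derivative (epath a b c) (at 0)) = sgn (b - a) * c"
proof (cases "c = 1")
  case True
  then show ?thesis unfolding epath_def by simp
next
  case False
  let ?e = "Arg c"
  note e0 = Arg_unit_nz[OF False]
  have s: "sin ?e \<noteq> 0" "?e / sin ?e > 0" using sin_ratio_pos[OF e0 Arg_unit_less] by auto
  have cisd: "((\<lambda>t. cis (- 2 * ?e * t)) has_vector_derivative of_real (- 2 * ?e) * \<i>) (at 0)"
  proof -
    have "((\<lambda>z. exp (\<i> * of_real (- 2 * ?e) * z)) has_field_derivative of_real (- 2 * ?e) * \<i>) (at (of_real 0))"
      by (auto intro!: derivative_eq_intros)
    from has_vector_derivative_real_field[OF this] show ?thesis
      by (simp add: cis_conv_exp mult_ac)
  qed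
  have "((\<lambda>t. a + (b - a) / (1 - cis (- 2 * ?e)) * (1 - cis (- 2 * ?e * t))) has_vector_derivative
      0 + (b - a) / (1 - cis (- 2 * ?e)) * (0 - of_real (- 2 * ?e) * \<i>)) (at 0)"
    by (intro has_vector_derivative_add has_vector_derivative_const has_vector_derivative_mult_right
        has_vector_derivative_diff cisd)
  moreover have "(\<lambda>t. a + (b - a) / (1 - cis (- 2 * ?e)) * (1 - cis (- 2 * ?e * t))) = epath a b c"
    unfolding epath_def using False by auto
  ultimately have "vector_derivative (epath a b c) (at 0)
      = (b - a) / (1 - cis (- 2 * ?e)) * (of_real (2 * ?e) * \<i>)"
    using vector_derivative_at by force
  also have "\<dots> = (b - a) * of_real (?e / sin ?e) * (1 / cis (- ?e))"
    unfolding one_minus_cis using s by (simp add: field_simps)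
  also have "1 / cis (- ?e) = c" using cis_divide[of 0 "- ?e"] cis_Arg_unit by simp
  finally have "sgn (vector_derivative (epath a b c) (at 0)) = sgn (b - a) * sgn (of_real (?e / sin ?e)) * sgn c"
    by (simp only: sgn_mult)
  moreover have "sgn (of_real (?e / sin ?e) :: complex) = 1" unfolding sgn_of_real sgn_pos[OF s(2)] by simp
  moreover have "sgn c = c" using c(1) by (simp add: sgn_div_norm)
  ultimately show ?thesis by (simp only:) simp
qed

lemma reversepath_epath: "epath b a (cnj c) = reversepath (epath a b c)"
proof (cases "c = 1")
  case True
  then show ?thesis unfolding epath_def by (simp add: reversepath_linepath)
next
  case False
  let ?e = "Arg c"
  have c1: "cnj c \<noteq> 1" using False by (metis complex_cnj_cnj complex_cnj_one)
  have s: "sin ?e \<noteq> 0" using sin_ratio_pos(2)[OF Arg_unit_nz[OF False] Arg_unit_less] .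
  have Ac: "Arg (cnj c) = - ?e"
  proof (rule cis_Arg_unique)
    show "sgn (cnj c) = cis (- ?e)" using c(1) cis_Arg_unit by (simp add: sgn_div_norm cis_cnj[symmetric])
  qed (use Arg_unit_less in auto)
  have p1: "1 - cis (- 2 * ?e) = 2 * \<i> * of_real (sin ?e) * cis (- ?e)" by (rule one_minus_cis)
  have p2: "1 - cis (2 * ?e) = - (2 * \<i> * of_real (sin ?e) * cis ?e)" using one_minus_cis[of "- ?e"] by simp
  show ?thesis
  proof
    fix t
    have "b - epath b a (cnj c) t = (b - a) * ((1 - cis (2 * ?e * t)) / (1 - cis (2 * ?e)))"
    proof -
      obtain X where X: "X = (1 - cis (2 * ?e * t)) / (1 - cis (2 * ?e))" by blast
      have "epath b a (cnj c) t = b + (a - b) * X" unfolding epath_def Ac X using c1 by simp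
      then show ?thesis unfolding X[symmetric] by (simp add: algebra_simps)
    qed
    also have "(1 - cis (2 * ?e * t)) / (1 - cis (2 * ?e)) = of_real (sin (?e * t) / sin ?e) * (cis (?e * t) / cis ?e)"
    proof -
      have p3: "1 - cis (2 * ?e * t) = - (2 * \<i> * of_real (sin (?e * t)) * cis (?e * t))"
        using one_minus_cis[of "- (?e * t)"] by (simp add: mult.assoc)
      show ?thesis unfolding p2 p3 using s by simp
    qed
    also have "cis (?e * t) / cis ?e = cis (- ?e * (1 - t))" unfolding cis_divide by (simp add: algebra_simps)
    finally have "b - epath b a (cnj c) t = b - epath a b c (1 - t)"
      unfolding epath_sin(2)[OF False] by simp
    then show "epath b a (cnj c) t = reversepath (epath a b c) t" unfolding reversepath_def by simp
  qed
qed

end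

section \<open>Drawing a cactus\<close>

text \<open>Edge sets rather than lists, since rotations and reversals of a list trace the same
  curve.\<close>

definition cycle_family :: "'v set \<Rightarrow> 'v set set \<Rightarrow> 'v set set \<Rightarrow> 'v set set set" where
  "cycle_family V E F = {cycle_edges cs | cs. is_cycle V E cs \<and> cycle_edges cs \<subseteq> F}"

definition realised :: "'v set \<Rightarrow> 'v set set \<Rightarrow> 'v set \<Rightarrow> 'v set set \<Rightarrow> bool" where
  "realised V E W F \<longleftrightarrow> grown V E W F \<and> (\<exists>p c w. dstate (deg E) (cycle_family V E F) W F p c w)"

text \<open>Both vertices are connected in \<open>F'\<close> to vertices of \<open>W\<close>, and
  these are connected in \<open>F\<close> by the invariant.\<close>

lemma grown_reach_extend:
  assumes G: "grown V E W F" and F': "F \<subseteq> F'" "F' \<subseteq> E" and u: "u \<in> W"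
    and N: "\<And>x. x \<in> N \<Longrightarrow> (adj F')\<^sup>*\<^sup>* u x" and xy: "x \<in> W \<union> N" "y \<in> W \<union> N" "(adj E)\<^sup>*\<^sup>* x y"
  shows "(adj F')\<^sup>*\<^sup>* x y"
proof -
  have root: "\<exists>r\<in>W. (adj F')\<^sup>*\<^sup>* r z" if "z \<in> W \<union> N" for z
    using that
  proof
    assume "z \<in> W"
    then show ?thesis by (intro bexI[of _ z] rtranclp.rtrancl_refl)
  next
    assume "z \<in> N"
    then show ?thesis using N u by (intro bexI[of _ u])
  qed
  obtain r s where r: "r \<in> W" "(adj F')\<^sup>*\<^sup>* r x" and s: "s \<in> W" "(adj F')\<^sup>*\<^sup>* s y"
    using root[OF xy(1)] root[OF xy(2)] by (elim bexE)
  have "(adj E)\<^sup>*\<^sup>* r x" "(adj E)\<^sup>*\<^sup>* y s"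
    using adj_rtranclp_mono[OF F'(2) r(2)] adj_rtranclp_sym[OF adj_rtranclp_mono[OF F'(2) s(2)]] .
  then have "(adj E)\<^sup>*\<^sup>* r s" using rtranclp_trans[OF rtranclp_trans[OF _ xy(3)]] by simp
  then have "(adj F)\<^sup>*\<^sup>* r s" by (rule grown_reach[OF G r(1) s(1)])
  then have "(adj F')\<^sup>*\<^sup>* r s" by (rule adj_rtranclp_mono[OF F'(1)])
  then show ?thesis
    using rtranclp_trans[OF rtranclp_trans[OF adj_rtranclp_sym[OF r(2)]] s(2)] by simp
qed

lemma cycle_orient:
  assumes c: "is_cycle V E c" and e: "{u, v} \<in> cycle_edges c"
  shows "\<exists>cs. is_cycle V E cs \<and> cs ! 0 = u \<and> cs ! 1 = v"
proof -
  have len: "3 \<le> length c" using c unfolding is_cycle_iff by simp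
  have nth: "rotate i d ! 0 = d ! i" "rotate i d ! 1 = d ! ((i + 1) mod length d)"
    if "i < length d" "3 \<le> length d" for i and d :: "'a list"
  proof -
    have "0 < length d" "1 < length d" using that(2) by linarith+
    then show "rotate i d ! 0 = d ! i" "rotate i d ! 1 = d ! ((i + 1) mod length d)"
      using nth_rotate[of 0 d i] nth_rotate[of 1 d i] that(1) by simp_all
  qed
  obtain i where i: "i < length c" "(u = c ! i \<and> v = c ! ((i + 1) mod length c)) \<or> (v = c ! i \<and> u = c ! ((i + 1) mod length c))"
    using e unfolding doubleton_in_cycle_edges by blast
  from i(2) show ?thesis
  proof
    assume "u = c ! i \<and> v = c ! ((i + 1) mod length c)"
    then show ?thesis
      using nth[OF i(1) len] c by (intro exI[of _ "rotate i c"]) (simp add: is_cycle_rotate)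
  next
    assume uv: "v = c ! i \<and> u = c ! ((i + 1) mod length c)"
    \<comment> \<open>After rotation the list begins with \<open>v, u\<close>; after reversal it
      ends with \<open>u, v\<close>, and a rotation by \<open>length c - 2\<close> brings these two
      to the front.\<close>
    define d where "d = rev (rotate i c)"
    have dl: "length d = length c" unfolding d_def by simp
    have "d ! (length c - 1) = v" "d ! (length c - 2) = u"
      using nth[OF i(1) len] uv len unfolding d_def by (simp_all add: rev_nth Suc_diff_Suc numeral_2_eq_2)
    moreover have "(length c - 2 + 1) mod length c = length c - 1" using len by (simp add: Suc_diff_Suc numeral_2_eq_2)
    ultimately have "rotate (length c - 2) d ! 0 = u" "rotate (length c - 2) d ! 1 = v"
      using nth[of "length c - 2" d] len unfolding dl by simp_all
    moreover have "is_cycle V E (rotate (length c - 2) d)"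
      unfolding is_cycle_rotate d_def is_cycle_rev by (rule c)
    ultimately show ?thesis by blast
  qed
qed

text \<open>Rotating the list puts a vertex of largest degree at position \<open>0\<close>, wherever
  the attachment vertex may be.\<close>

lemma dstate_cycle:
  assumes S: "dstate D CY W F p c w" and u: "u \<in> W" "set cs \<inter> W = {u}"
    and cs: "distinct cs" "3 \<le> length cs"
    and D: "deg F u + 2 \<le> D u" "\<And>v. v \<in> set cs \<Longrightarrow> 2 \<le> D v"
  shows "\<exists>p c w. dstate D (insert (cycle_edges cs) CY) (W \<union> set cs) (F \<union> cycle_edges cs) p c w"
proof -
  have ne: "set cs \<noteq> {}" using cs by auto
  obtain m where m: "m \<in> set cs" "\<And>v. v \<in> set cs \<Longrightarrow> D v \<le> D m"
    using finite_imageI[of "set cs" D] Max_in[of "D ` set cs"] Max_ge[of "D ` set cs"] ne by fastforce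
  obtain i where i: "i < length cs" "m = cs ! i" using m(1) by (auto simp: in_set_conv_nth)
  define d where "d = rotate i cs"
  have d: "distinct d" "length d = length cs" "set d = set cs" "cycle_edges d = cycle_edges cs"
    unfolding d_def using cs by (simp_all add: cycle_edges_rotate)
  have d0: "d ! 0 = m" unfolding d_def using nth_rotate[of 0 cs i] i by (cases "cs = []") simp_all
  have "u \<in> set d" using u d(3) by auto
  then obtain j where j: "j < length d" "u = d ! j" by (auto simp: in_set_conv_nth)
  have bound: "2 \<le> D (d ! k) \<and> D (d ! k) \<le> D (d ! 0)" if "k < length d" for k
    using nth_mem[OF that] m(2) D(2) unfolding d0 d(3) by simp
  have "\<exists>p c w. dstate D (insert (cycle_edges d) CY) (W \<union> set d) (F \<union> cycle_edges d) p c w"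
    by (rule dstate_cycle_max[OF S j(1) _ _ d(1)]) (use u j D(1) bound cs d in simp_all)
  then show ?thesis unfolding d .
qed

context
  fixes V :: "'v set" and E :: "'v set set"
  assumes cactus: "cactus V E"
begin

lemma cactus_finite: "finite V"
  using cactus unfolding cactus_def simple_graph_def by simp

lemma cactus_edge: "{x, y} \<in> E \<Longrightarrow> x \<noteq> y \<and> x \<in> V \<and> y \<in> V"
proof -
  assume "{x, y} \<in> E"
  moreover have "\<forall>e\<in>E. \<exists>u v. u \<noteq> v \<and> u \<in> V \<and> v \<in> V \<and> e = {u, v}"
    using cactus unfolding cactus_def simple_graph_def by (elim conjE)
  ultimately have "\<exists>u v. u \<noteq> v \<and> u \<in> V \<and> v \<in> V \<and> {x, y} = {u, v}" by (rule bspec[rotated])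
  then show ?thesis by (auto simp: doubleton_eq_iff)
qed

lemma cactus_pair: "e \<in> E \<Longrightarrow> \<exists>x y. e = {x, y}"
proof -
  assume "e \<in> E"
  moreover have "\<forall>e\<in>E. \<exists>u v. u \<noteq> v \<and> u \<in> V \<and> v \<in> V \<and> e = {u, v}"
    using cactus unfolding cactus_def simple_graph_def by (elim conjE)
  ultimately show ?thesis by blast
qed

lemma cactus_cycles:
  assumes "is_cycle V E c1" "is_cycle V E c2" "e \<in> cycle_edges c1" "e \<in> cycle_edges c2"
  shows "cycle_edges c1 = cycle_edges c2"
proof -
  have "e \<in> E" using assms(1,3) unfolding is_cycle_iff by blast
  have "\<forall>e\<in>E. \<forall>c1 c2. is_cycle V E c1 \<and> is_cycle V E c2 \<and>
        e \<in> cycle_edges c1 \<and> e \<in> cycle_edges c2 \<longrightarrow> cycle_edges c1 = cycle_edges c2"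
    using cactus unfolding cactus_def by (elim conjE)
  from this[rule_format, OF \<open>e \<in> E\<close>, of c1 c2] assms show ?thesis by simp
qed

lemma finite_nbrs_E: "finite (nbrs E v)"
proof (rule finite_subset[OF _ cactus_finite])
  show "nbrs E v \<subseteq> V"
  proof
    fix x assume "x \<in> nbrs E v"
    then show "x \<in> V" using cactus_edge[of v x] unfolding nbrs_def by simp
  qed
qed

lemma deg_add_le:
  assumes "F \<subseteq> E" "G \<subseteq> E" "nbrs F v \<inter> nbrs G v = {}"
  shows "deg F v + deg G v \<le> deg E v"
proof -
  have sub: "nbrs F v \<subseteq> nbrs E v" "nbrs G v \<subseteq> nbrs E v" using assms unfolding nbrs_def by auto
  then have "finite (nbrs F v)" "finite (nbrs G v)" using finite_nbrs_E finite_subset by blast+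
  then have "deg F v + deg G v = card (nbrs F v \<union> nbrs G v)"
    unfolding deg_def using assms(3) by (simp add: card_Un_disjoint)
  also have "\<dots> \<le> deg E v" unfolding deg_def using sub by (intro card_mono finite_nbrs_E) auto
  finally show ?thesis .
qed

lemma nbrs_grown:
  assumes "grown V E W F"
  shows "nbrs F v \<subseteq> W"
proof
  fix x assume "x \<in> nbrs F v"
  then show "x \<in> W" using grown_edge[OF assms, of v x] unfolding nbrs_def by simp
qed

lemma realised_bridge:
  assumes R: "realised V E W F" and u: "u \<in> W" and v: "v \<notin> W" and e: "{u, v} \<in> E"
    and no: "\<And>cs. is_cycle V E cs \<Longrightarrow> {u, v} \<notin> cycle_edges cs"
  shows "realised V E (insert v W) (insert {u, v} F)"
proof -
  have G: "grown V E W F" using R unfolding realised_def by simp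
  obtain p c w where S: "dstate (deg E) (cycle_family V E F) W F p c w" using R unfolding realised_def by auto
  have uv: "u \<noteq> v" "v \<in> V" using cactus_edge[OF e] by auto
  have nb: "nbrs {{u, v}} u = {v}" "nbrs {{u, v}} v = {u}"
    unfolding nbrs_def using uv by (auto simp: doubleton_eq_iff)
  have "nbrs F u \<inter> nbrs {{u, v}} u = {}" unfolding nb using nbrs_grown[OF G] v by auto
  then have "deg F u + deg {{u, v}} u \<le> deg E u" using e by (intro deg_add_le grown_F[OF G]) auto
  then have du: "deg F u < deg E u" unfolding deg_def[of "{{u, v}}"] nb by simp
  have "deg {} v + deg {{u, v}} v \<le> deg E v" using e by (intro deg_add_le) (auto simp: nbrs_def)
  then have dv: "0 < deg E v" unfolding deg_def[of "{{u, v}}"] nb by simp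
  \<comment> \<open>The new edge lies on no cycle, so it completes none.\<close>
  have family: "cycle_family V E (insert {u, v} F) = cycle_family V E F"
    unfolding cycle_family_def using no by (intro Collect_cong iff_exI) (auto simp: subset_insert)
  have "grown V E (insert v W) (insert {u, v} F)"
    unfolding grown_def
  proof (intro conjI allI ballI impI)
    show "insert v W \<subseteq> V" using uv grown_W[OF G] by simp
    show "insert {u, v} F \<subseteq> E" using e grown_F[OF G] by simp
    fix x y
    { assume "{x, y} \<in> insert {u, v} F"
      then have "{x, y} = {u, v} \<or> {x, y} \<in> F" by simp
      then have "x \<in> insert v W \<and> y \<in> insert v W"
      proof
        assume "{x, y} = {u, v}"
        then show ?thesis using u by (auto simp: doubleton_eq_iff)
      next
        assume "{x, y} \<in> F"
        then show ?thesis using grown_edge[OF G] by simp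
      qed }
    then show "{x, y} \<in> insert {u, v} F \<Longrightarrow> x \<in> insert v W" "{x, y} \<in> insert {u, v} F \<Longrightarrow> y \<in> insert v W"
      by simp_all
    assume xy: "x \<in> insert v W" "y \<in> insert v W" "(adj E)\<^sup>*\<^sup>* x y"
    show "(adj (insert {u, v} F))\<^sup>*\<^sup>* x y"
    proof (rule grown_reach_extend[OF G _ _ u, where N = "{v}"])
      show "insert {u, v} F \<subseteq> E" using e grown_F[OF G] by simp
      show "(adj (insert {u, v} F))\<^sup>*\<^sup>* u z" if "z \<in> {v}" for z
        by (rule r_into_rtranclp) (use that in simp)
    qed (use xy in auto)
  next
    fix cs assume cs: "is_cycle V E cs \<and> cycle_edges cs \<inter> insert {u, v} F \<noteq> {}"
    then obtain e' where "e' \<in> cycle_edges cs" "e' \<in> F" using no[of cs] by auto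
    then have "cycle_edges cs \<subseteq> F" using cs grown_cycle[OF G] by blast
    then show "cycle_edges cs \<subseteq> insert {u, v} F" by auto
  qed
  then show ?thesis
    unfolding realised_def family using dstate_bridge[OF S u v du dv] by simp
qed

lemma realised_cycle:
  assumes R: "realised V E W F" and cs: "is_cycle V E cs" and u: "cs ! 0 \<in> W" and v: "cs ! 1 \<notin> W"
  shows "realised V E (W \<union> set cs) (F \<union> cycle_edges cs)"
proof -
  have G: "grown V E W F" using R unfolding realised_def by simp
  obtain p c w where S: "dstate (deg E) (cycle_family V E F) W F p c w" using R unfolding realised_def by auto
  have c: "3 \<le> length cs" "distinct cs" "set cs \<subseteq> V" "cycle_edges cs \<subseteq> E" using cs unfolding is_cycle_iff by simp_all
  let ?u = "cs ! 0"
  have l0: "0 < length cs" using c(1) by linarith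
  have meets: "set cs \<inter> W = {?u}" by (rule grown_cycle_meets[OF G cs u v])
  have fresh: "x \<notin> W" if "{?u, x} \<in> cycle_edges cs" for x
  proof -
    from iffD1[OF doubleton_in_cycle_edges that] obtain i where i: "i < length cs"
      "(?u = cs ! i \<and> x = cs ! ((i + 1) mod length cs)) \<or> (x = cs ! i \<and> ?u = cs ! ((i + 1) mod length cs))"
      by (elim exE conjE)
    have "cs ! i \<in> set cs" "cs ! ((i + 1) mod length cs) \<in> set cs" using i(1) l0 by simp_all
    with i(2) have "x \<in> set cs" by (elim disjE) simp_all
    moreover have "{?u, x} \<in> E" using c(4) that by (rule subsetD)
    from cactus_edge[OF this] have "x \<noteq> ?u" by (elim conjE) (rule not_sym)
    ultimately show ?thesis using meets by blast
  qed
  have "nbrs F ?u \<inter> nbrs (cycle_edges cs) ?u = {}"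
  proof -
    have "x \<notin> W" if "x \<in> nbrs (cycle_edges cs) ?u" for x using fresh that unfolding nbrs_def by simp
    then show ?thesis using nbrs_grown[OF G, of ?u] by blast
  qed
  then have "deg F ?u + deg (cycle_edges cs) ?u \<le> deg E ?u" by (rule deg_add_le[OF grown_F[OF G] c(4)])
  then have du: "deg F ?u + 2 \<le> deg E ?u" unfolding deg_cycle_edges[OF c(2,1) l0] .
  have d2: "2 \<le> deg E x" if x: "x \<in> set cs" for x
  proof -
    obtain i where i: "i < length cs" "x = cs ! i" using x by (auto simp: in_set_conv_nth)
    have "deg {} x + deg (cycle_edges cs) x \<le> deg E x"
      by (rule deg_add_le[OF empty_subsetI c(4)]) (simp add: nbrs_def)
    then show ?thesis unfolding i(2) deg_cycle_edges[OF c(2,1) i(1)] by simp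
  qed
  have share: "cycle_edges d = cycle_edges cs" if "is_cycle V E d" "e \<in> cycle_edges d" "e \<in> cycle_edges cs" for d e
    by (rule cactus_cycles[OF that(1) cs that(2,3)])
  \<comment> \<open>By the cactus property a cycle that shares an edge with \<open>cs\<close> has
    the same edge set, so exactly one member is added.\<close>
  have family: "cycle_family V E (F \<union> cycle_edges cs) = insert (cycle_edges cs) (cycle_family V E F)"
  proof (intro set_eqI iffI)
    fix X assume "X \<in> cycle_family V E (F \<union> cycle_edges cs)"
    then obtain d where d: "is_cycle V E d" "X = cycle_edges d" "cycle_edges d \<subseteq> F \<union> cycle_edges cs"
      unfolding cycle_family_def by blast
    show "X \<in> insert (cycle_edges cs) (cycle_family V E F)"
    proof (cases "cycle_edges d \<inter> cycle_edges cs = {}")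
      case True
      then have "cycle_edges d \<subseteq> F" using d(3) by blast
      then show ?thesis unfolding cycle_family_def d(2) using d(1) by blast
    next
      case False
      then obtain e where "e \<in> cycle_edges d" "e \<in> cycle_edges cs" by blast
      then show ?thesis unfolding d(2) using share[OF d(1)] by simp
    qed
  next
    fix X assume "X \<in> insert (cycle_edges cs) (cycle_family V E F)"
    then show "X \<in> cycle_family V E (F \<union> cycle_edges cs)" unfolding cycle_family_def using cs by blast
  qed
  have "grown V E (W \<union> set cs) (F \<union> cycle_edges cs)"
    unfolding grown_def
  proof (intro conjI allI ballI impI)
    show "W \<union> set cs \<subseteq> V" using c(3) grown_W[OF G] by simp
    show "F \<union> cycle_edges cs \<subseteq> E" using c(4) grown_F[OF G] by simp
    fix x y
    have ends: "x \<in> W \<union> set cs \<and> y \<in> W \<union> set cs" if "{x, y} \<in> F \<union> cycle_edges cs"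
      using that
    proof
      assume "{x, y} \<in> F"
      then show ?thesis using grown_edge[OF G] by simp
    next
      assume "{x, y} \<in> cycle_edges cs"
      then obtain i where i: "i < length cs" "(x = cs ! i \<and> y = cs ! ((i + 1) mod length cs)) \<or> (y = cs ! i \<and> x = cs ! ((i + 1) mod length cs))"
        unfolding doubleton_in_cycle_edges by blast
      have "cs ! i \<in> set cs" "cs ! ((i + 1) mod length cs) \<in> set cs" using i(1) l0 by simp_all
      with i(2) show ?thesis by (elim disjE) simp_all
    qed
    then show "{x, y} \<in> F \<union> cycle_edges cs \<Longrightarrow> x \<in> W \<union> set cs" "{x, y} \<in> F \<union> cycle_edges cs \<Longrightarrow> y \<in> W \<union> set cs"
      by simp_all
    assume xy: "x \<in> W \<union> set cs" "y \<in> W \<union> set cs" "(adj E)\<^sup>*\<^sup>* x y"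
    show "(adj (F \<union> cycle_edges cs))\<^sup>*\<^sup>* x y"
    proof (rule grown_reach_extend[OF G _ _ u _ xy])
      show "F \<union> cycle_edges cs \<subseteq> E" using c(4) grown_F[OF G] by simp
      fix z assume "z \<in> set cs"
      then obtain i where i: "i < length cs" "z = cs ! i" by (auto simp: in_set_conv_nth)
      show "(adj (F \<union> cycle_edges cs))\<^sup>*\<^sup>* ?u z"
        unfolding i(2) by (rule adj_rtranclp_mono[OF _ cycle_reach[OF i(1)]]) simp
    qed simp
  next
    fix d assume d: "is_cycle V E d \<and> cycle_edges d \<inter> (F \<union> cycle_edges cs) \<noteq> {}"
    then obtain e where e: "e \<in> cycle_edges d" "e \<in> F \<or> e \<in> cycle_edges cs" by blast
    from e(2) show "cycle_edges d \<subseteq> F \<union> cycle_edges cs"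
    proof
      assume "e \<in> F"
      then show ?thesis using grown_cycle[OF G _ e(1)] d by blast
    next
      assume "e \<in> cycle_edges cs"
      then show ?thesis using share[OF _ e(1)] d by blast
    qed
  qed
  then show ?thesis
    unfolding realised_def family using dstate_cycle[OF S u meets c(2,1) du d2] by simp
qed

text \<open>No edge leaves \<open>W\<close>, so \<open>W\<close> is a union of components and
  \<open>x\<close> is not connected to it: a new component begins.\<close>

lemma realised_isolated:
  assumes R: "realised V E W F" and x: "x \<in> V" "x \<notin> W"
    and no: "\<And>u v. u \<in> W \<Longrightarrow> v \<notin> W \<Longrightarrow> {u, v} \<notin> E"
  shows "realised V E (insert x W) F"
proof -
  have G: "grown V E W F" using R unfolding realised_def by simp
  obtain p c w where S: "dstate (deg E) (cycle_family V E F) W F p c w" using R unfolding realised_def by auto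
  have closed: "z \<in> W" if "(adj E)\<^sup>*\<^sup>* y z" "y \<in> W" for y z
    using that by (induction rule: rtranclp_induct) (use no in blast)+
  have "grown V E (insert x W) F"
    unfolding grown_def
  proof (intro conjI allI ballI impI)
    fix a b
    show "insert x W \<subseteq> V" using x grown_W[OF G] by simp
    show "F \<subseteq> E" by (rule grown_F[OF G])
    show "a \<in> insert x W" "b \<in> insert x W" if "{a, b} \<in> F" using grown_edge[OF G that] by simp_all
    assume ab: "a \<in> insert x W" "b \<in> insert x W" "(adj E)\<^sup>*\<^sup>* a b"
    show "(adj F)\<^sup>*\<^sup>* a b"
    proof (cases "a \<in> W")
      case True
      then show ?thesis using grown_reach[OF G True closed[OF ab(3) True] ab(3)] by simp
    next
      case False
      then have "a = x" using ab(1) by simp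
      moreover have "b \<notin> W" using closed[OF adj_rtranclp_sym[OF ab(3)]] False by blast
      ultimately show ?thesis using ab(2) by simp
    qed
  next
    fix cs assume "is_cycle V E cs \<and> cycle_edges cs \<inter> F \<noteq> {}"
    then show "cycle_edges cs \<subseteq> F" using grown_cycle[OF G] by blast
  qed
  then show ?thesis
    unfolding realised_def using dstate_isolated[OF S x(2)] by blast
qed

lemma realised_step:
  assumes R: "realised V E W F" and W: "W \<noteq> V"
  shows "\<exists>W' F'. realised V E W' F' \<and> W \<subset> W'"
proof -
  have G: "grown V E W F" using R unfolding realised_def by simp
  show ?thesis
  proof (cases "\<exists>u\<in>W. \<exists>v. v \<notin> W \<and> {u, v} \<in> E")
    case True
    then obtain u v where uv: "u \<in> W" "v \<notin> W" "{u, v} \<in> E" by blast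
    show ?thesis
    proof (cases "\<exists>cs. is_cycle V E cs \<and> {u, v} \<in> cycle_edges cs")
      case True
      then obtain cs where cs: "is_cycle V E cs" "cs ! 0 = u" "cs ! 1 = v" using cycle_orient by metis
      have "realised V E (W \<union> set cs) (F \<union> cycle_edges cs)"
        using realised_cycle[OF R cs(1)] uv cs by simp
      moreover have "1 < length cs" using cs(1) unfolding is_cycle_iff by simp
      from nth_mem[OF this] have "v \<in> set cs" unfolding cs(3) .
      ultimately show ?thesis using uv(2) by blast
    next
      case False
      then have "realised V E (insert v W) (insert {u, v} F)"
        using realised_bridge[OF R uv] by blast
      then show ?thesis using uv(2) by blast
    qed
  next
    case False
    obtain x where "x \<in> V" "x \<notin> W" using W grown_W[OF G] by blast
    then have "realised V E (insert x W) F" using realised_isolated[OF R] False by blast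
    then show ?thesis using \<open>x \<notin> W\<close> by blast
  qed
qed

lemma realised_empty: "realised V E {} {}"
proof -
  have "X \<noteq> {}" if "X \<in> cycle_family V E F" for X F
    using that unfolding cycle_family_def is_cycle_iff cycle_edges_def by force
  then have "cycle_family V E {} = {}" unfolding cycle_family_def by blast
  then have "dstate (deg E) (cycle_family V E {}) {} {} (\<lambda>_. 0) (\<lambda>_ _. 0) (\<lambda>_. 0)"
    by (simp add: dstate_empty)
  moreover have "grown V E {} {}" unfolding grown_def by simp
  ultimately show ?thesis unfolding realised_def by blast
qed

lemma realised_all: "\<exists>F. realised V E V F"
proof -
  have "\<exists>F. realised V E V F" if "realised V E W F" for W F
    using that
  proof (induction "card (V - W)" arbitrary: W F rule: less_induct)
    case less
    show ?case
    proof (cases "W = V")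
      case False
      then obtain W' F' where W': "realised V E W' F'" "W \<subset> W'" using realised_step[OF less.prems] by blast
      then have "W' \<subseteq> V" using grown_W unfolding realised_def by blast
      then have "V - W' \<subset> V - W" using W'(2) by blast
      then have "card (V - W') < card (V - W)" using cactus_finite by (intro psubset_card_mono) auto
      then show ?thesis using less.hyps W'(1) by blast
    qed (use less.prems in blast)
  qed
  then show ?thesis using realised_empty by blast
qed

text \<open>Once \<open>W\<close> is all of \<open>V\<close>, \<open>grown_induced\<close> forces
  every edge into \<open>F\<close>.\<close>

lemma cactus_dstate: "\<exists>p c w. dstate (deg E) (cycle_family V E E) V E p c w"
proof -
  obtain F where R: "realised V E V F" using realised_all by blast
  then have G: "grown V E V F" unfolding realised_def by simp
  have "E \<subseteq> F"
  proof
    fix e assume e: "e \<in> E"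
    then obtain x y where xy: "e = {x, y}" using cactus_pair by blast
    then show "e \<in> F" using grown_induced[OF G] e cactus_edge[of x y] by simp
  qed
  then have "F = E" using grown_F[OF G] by blast
  then show ?thesis using R unfolding realised_def by simp
qed

end

lemma dstate_drawing:
  assumes S: "dstate (deg E) (cycle_family V E E) V E p c w"
  defines "dr \<equiv> \<lambda>u v. epath (p u) (p v) (c u v)"
  shows "lombardi_drawing V E p dr" "planar_drawing V E p dr" "natural_embedding V E p dr"
proof -
  have D: "is_draw V E p c"
    and w: "\<And>v. v \<in> V \<Longrightarrow> norm (w v) = 1" "\<And>v. v \<in> V \<Longrightarrow> edge_dirs E p c v = slot (deg E) w v ` {..<deg E v}"
    and nat: "\<And>X. X \<in> cycle_family V E E \<Longrightarrow> inside (etrack p c X) \<inter> dpts V E p c = {}"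
    using S unfolding dstate_def by simp_all
  have pne: "p u \<noteq> p v" if "{u, v} \<in> E" for u v
    using draw_edge[OF D that] draw_inj[OF D] by (auto simp: inj_on_def)
  have img: "path_image (dr u v) = carc (p u) (p v) (c u v)" if "{u, v} \<in> E" for u v
    unfolding dr_def by (rule path_image_epath[OF pne[OF that] draw_norm[OF D that] draw_ne[OF D that]])
  show "lombardi_drawing V E p dr"
    unfolding lombardi_drawing_def
  proof (intro conjI allI impI ballI)
    fix u v assume e: "{u, v} \<in> E"
    note a = pne[OF e] draw_norm[OF D e] draw_ne[OF D e]
    show "circ_arc (dr u v)" "pathstart (dr u v) = p u" "pathfinish (dr u v) = p v"
      unfolding dr_def using circ_arc_epath[OF a] pathstart_epath[OF a] pathfinish_epath[OF a] .
    show "dr v u = reversepath (dr u v)"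
      unfolding dr_def draw_cnj[OF D e] by (rule reversepath_epath[OF a])
  next
    fix v assume v: "v \<in> V"
    have "sgn (vector_derivative (dr v u) (at 0)) = sgn (p u - p v) * c v u" if "u \<in> nbrs E v" for u
    proof -
      have e: "{v, u} \<in> E" using that unfolding nbrs_def by simp
      show ?thesis unfolding dr_def by (rule epath_tangent[OF pne[OF e] draw_norm[OF D e] draw_ne[OF D e]])
    qed
    then have "(\<lambda>u. sgn (vector_derivative (dr v u) (at 0))) ` nbrs E v = edge_dirs E p c v"
      unfolding edge_dirs_def by (intro image_cong) auto
    \<comment> \<open>All edges are drawn and slots were spaced by \<open>deg E\<close> from the
      start, so the occupied initial segment is the full set of equally spaced directions.\<close>
    also have "\<dots> = {w v * cis (2 * pi * real k / real (deg E v)) | k. k < deg E v}"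
      unfolding w(2)[OF v] slot_def by auto
    finally show "\<exists>w. norm w = 1 \<and> (\<lambda>u. sgn (vector_derivative (dr v u) (at 0))) ` nbrs E v =
             {w * cis (2 * pi * real k / real (deg E v)) | k. k < deg E v}"
      using w(1)[OF v] by blast
  qed
  show "planar_drawing V E p dr"
    unfolding planar_drawing_def
  proof (intro conjI allI impI)
    show "inj_on p V" by (rule draw_inj[OF D])
    show "p z \<notin> path_image (dr u v)" if "{u, v} \<in> E \<and> z \<in> V \<and> z \<notin> {u, v}" for u v z
      using that draw_off[OF D, of u v z] img[of u v] by blast
    fix u v x y assume e: "{u, v} \<in> E \<and> {x, y} \<in> E \<and> {u, v} \<noteq> {x, y}"
    then have "carc (p u) (p v) (c u v) \<inter> carc (p x) (p y) (c x y) \<subseteq> p ` ({u, v} \<inter> {x, y})"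
      using draw_disj[OF D, of u v x y] by (elim conjE)
    then show "path_image (dr u v) \<inter> path_image (dr x y) \<subseteq> p ` ({u, v} \<inter> {x, y})"
      using img[of u v] img[of x y] e by simp
  qed
  show "natural_embedding V E p dr"
    unfolding natural_embedding_def
  proof (intro allI impI)
    fix cs assume cs: "is_cycle V E cs"
    let ?n = "length cs"
    have E: "cycle_edges cs \<subseteq> E" using cs unfolding is_cycle_iff by simp
    have step: "{cs ! i, cs ! ((i + 1) mod ?n)} \<in> cycle_edges cs" if "i < ?n" for i
      unfolding cycle_edges_def using that by blast
    have "(\<Union>i<?n. path_image (dr (cs ! i) (cs ! ((i + 1) mod ?n)))) = etrack p c (cycle_edges cs)"
    proof (intro set_eqI iffI)
      fix z assume "z \<in> (\<Union>i<?n. path_image (dr (cs ! i) (cs ! ((i + 1) mod ?n))))"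
      then obtain i where i: "i < ?n" "z \<in> path_image (dr (cs ! i) (cs ! ((i + 1) mod ?n)))" by blast
      have "{cs ! i, cs ! ((i + 1) mod ?n)} \<in> E" using step[OF i(1)] E by (rule subsetD[rotated])
      then have "z \<in> carc (p (cs ! i)) (p (cs ! ((i + 1) mod ?n))) (c (cs ! i) (cs ! ((i + 1) mod ?n)))"
        using i(2) img by simp
      then show "z \<in> etrack p c (cycle_edges cs)" unfolding etrack_def using step[OF i(1)] by blast
    next
      fix z assume "z \<in> etrack p c (cycle_edges cs)"
      then obtain x y where xy: "{x, y} \<in> cycle_edges cs" "z \<in> carc (p x) (p y) (c x y)" unfolding etrack_def by blast
      obtain i where i: "i < ?n" "(x = cs ! i \<and> y = cs ! ((i + 1) mod ?n)) \<or> (y = cs ! i \<and> x = cs ! ((i + 1) mod ?n))"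
        using xy(1) unfolding doubleton_in_cycle_edges by blast
      let ?a = "cs ! i" and ?b = "cs ! ((i + 1) mod ?n)"
      have e: "{?a, ?b} \<in> E" using step[OF i(1)] E by (rule subsetD[rotated])
      have "carc (p ?b) (p ?a) (c ?b ?a) = carc (p ?a) (p ?b) (c ?a ?b)"
        unfolding draw_cnj[OF D e] by (rule carc_swap[OF draw_norm[OF D e]])
      then have "z \<in> path_image (dr ?a ?b)" using xy(2) i(2) unfolding img[OF e] by (elim disjE) simp_all
      then show "z \<in> (\<Union>i<?n. path_image (dr (cs ! i) (cs ! ((i + 1) mod ?n))))" using i(1) by blast
    qed
    moreover have "drawing_points V E p dr = dpts V E p c"
    proof -
      have "{path_image (dr u v) | u v. {u, v} \<in> E} = {carc (p u) (p v) (c u v) | u v. {u, v} \<in> E}"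
      proof (intro Collect_cong iff_exI)
        show "z = path_image (dr u v) \<and> {u, v} \<in> E \<longleftrightarrow> z = carc (p u) (p v) (c u v) \<and> {u, v} \<in> E" for z u v
          using img[of u v] by (cases "{u, v} \<in> E") simp_all
      qed
      then show ?thesis unfolding drawing_points_def dpts_def etrack_def by simp
    qed
    moreover have "cycle_edges cs \<in> cycle_family V E E" unfolding cycle_family_def using cs E by blast
    ultimately show "inside (\<Union>i<?n. path_image (dr (cs ! i) (cs ! ((i + 1) mod ?n)))) \<inter> drawing_points V E p dr = {}"
      using nat by simp
  qed
qed

theorem mainTheorem13:
  fixes V :: "'v set" and E :: "'v set set"
  assumes "cactus V E"
  shows "\<exists>p dr. lombardi_drawing V E p dr \<and> planar_drawing V E p dr \<and>
                 natural_embedding V E p dr"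
proof -
  obtain p c w where "dstate (deg E) (cycle_family V E E) V E p c w"
    using cactus_dstate[OF assms] by blast
  from dstate_drawing[OF this] show ?thesis by blast
qed

end
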